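(* Let $p\in[1,\infty)$ and let $W:\mathbb{R}^n\to M_m(\mathbb{C})$ be a matrix weight in $\mathcal{A}_p$. Then $$M^{0}_{p,1}(W)\hookrightarrow L^{p}(W)\hookrightarrow M^{0}_{p,\infty}(W).$$
   Context: Fix $n,m\in\mathbb{N}$. $M_m(\mathbb{C})$ is the set of complex $m\times m$ matrices, $|\cdot|$ is the Euclidean norm on $\mathbb{C}^m$ and $\|\cdot\|$ the operator norm on $M_m(\mathbb{C})$. The symbol $\hookrightarrow$ denotes a continuous inclusion; functions are identified with the (vector-valued) tempered distributions they define. A matrix weight is a function $W:\mathbb{R}^n\to M_m(\mathbb{C})$ such that $W(x)$ is nonnegative definite for every $x$, invertible for almost every $x$, and has locally integrable entries. For $1<p<\infty$, $W\in\mathcal{A}_p$ means $\sup_B\frac1{|B|}\int_B\big(\frac1{|B|}\int_B\|W^{1/p}(x)W^{-1/p}(y)\|^{p'}dy\big)^{p/p'}dx<\infty$, with $1/p+1/p'=1$; $W\in\mathcal{A}_1$ means $\sup_B\operatorname{ess\,sup}_{y\in B}\frac1{|B|}\int_B\|W(t)W^{-1}(y)\|dt<\infty$; suprema are over all balls $B\subset\mathbb{R}^n$. $L^p(W)$ is the space of measurable $\vec f:\mathbb{R}^n\to\mathbb{C}^m$ with $\|\vec f\|_{L^p(W)}=\big(\int_{\mathbb{R}^n}|W^{1/p}(x)\vec f(x)|^pdx\big)^{1/p}<\infty$. Let $Q_k=k+[-1/2,1/2)^n$ for $k\in\mathbb{Z}^n$. $Y$ is the set of sequences $\{\phi_k\}_{k\in\mathbb{Z}^n}$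 of smooth functions such that, with constants $c>0$ and $C_\beta$ independent of $k$: $|\phi_k(\xi)|\ge c$ for $\xi\in Q_k$; $\operatorname{supp}\phi_k\subset\{\xi:|\xi-k|\le\sqrt n\}$; $\sum_k\phi_k(\xi)=1$ for all $\xi$; and $|D^\alpha\phi_k(\xi)|\le C_\beta$ for all $\xi\in\mathbb{R}^n$, $|\alpha|\le\beta$. Fix $\{\phi_k\}\in Y$ and let $\square_k=\mathcal{F}^{-1}\phi_k\mathcal{F}$, acting componentwise on $[\mathcal{S}'(\mathbb{R}^n)]^m$, the space of $m$-vectors of tempered distributions. $M^0_{p,1}(W)$ and $M^0_{p,\infty}(W)$ are the sets of $\vec f\in[\mathcal{S}'(\mathbb{R}^n)]^m$ for which, respectively, $\|\vec f\|_{M^0_{p,1}(W)}=\sum_{k\in\mathbb{Z}^n}\|W^{1/p}\square_k\vec f\|_{L^p}<\infty$ and $\|\vec f\|_{M^0_{p,\infty}(W)}=\sup_{k\in\mathbb{Z}^n}\|W^{1/p}\square_k\vec f\|_{L^p}<\infty$. *)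

theory Defs
  imports "HOL-Probability.Probability"
begin

definition conj_transpose :: "complex^'m^'m \<Rightarrow> complex^'m^'m" where
  "conj_transpose A = (\<chi> i j. cnj (A $ j $ i))"

definition unitary :: "complex^'m^'m \<Rightarrow> bool" where
  "unitary U \<longleftrightarrow> conj_transpose U ** U = mat 1 \<and> U ** conj_transpose U = mat 1"

definition nonneg_definite :: "complex^'m^'m \<Rightarrow> bool" where
  "nonneg_definite A \<longleftrightarrow> conj_transpose A = A \<and>
     (\<forall>v. 0 \<le> Re (\<Sum>i\<in>UNIV. (A *v v) $ i * cnj (v $ i)))"

definition diag_matrix :: "('m \<Rightarrow> real) \<Rightarrow> complex^'m^'m" where
  "diag_matrix d = (\<chi> i j. if i = j then complex_of_real (d i) else 0)"

text \<open>Real powers of a nonnegative definite matrix, by diagonalization. Since \<open>0 powr r = 0\<close>, a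
  negative power of a singular matrix is a pseudo-inverse; for matrix weights this only concerns a
  null set.\<close>
definition mat_powr :: "complex^'m^'m \<Rightarrow> real \<Rightarrow> complex^'m^'m" where
  "mat_powr A r = (THE B. \<exists>U d. unitary U \<and> (\<forall>i. 0 \<le> d i) \<and>
     A = U ** diag_matrix d ** conj_transpose U \<and>
     B = U ** diag_matrix (\<lambda>i. d i powr r) ** conj_transpose U)"

definition op_norm :: "complex^'m^'m \<Rightarrow> real" where
  "op_norm A = onorm (\<lambda>v. A *v v)"

definition matrix_weight :: "(real^'n \<Rightarrow> complex^'m^'m) \<Rightarrow> bool" where
  "matrix_weight W \<longleftrightarrow> (\<forall>x. nonneg_definite (W x)) \<and> (AE x in lebesgue. invertible (W x)) \<and>
     (\<forall>i j K. compact K \<longrightarrow> set_integrable lebesgue K (\<lambda>x. W x $ i $ j))"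

text \<open>Used for positive exponents only.\<close>
definition enn_powr :: "ennreal \<Rightarrow> real \<Rightarrow> ennreal" where
  "enn_powr a r = (if a = \<top> then \<top> else ennreal (enn2real a powr r))"

definition avg :: "(real^'n) set \<Rightarrow> (real^'n \<Rightarrow> ennreal) \<Rightarrow> ennreal" where
  "avg B f = (\<integral>\<^sup>+x\<in>B. f x \<partial>lebesgue) / emeasure lebesgue B"

definition balls :: "(real^'n) set set" where
  "balls = {ball c r |c r. 0 < r}"

definition in_Ap :: "real \<Rightarrow> (real^'n \<Rightarrow> complex^'m^'m) \<Rightarrow> bool" where
  "in_Ap p W \<longleftrightarrow>
     (if p = 1 then
        (SUP B\<in>balls. esssup (restrict_space lebesgue B)
           (\<lambda>y. avg B (\<lambda>t. ennreal (op_norm (W t ** matrix_inv (W y)))))) < \<top>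
      else
        (let p' = p / (p - 1) in
         (SUP B\<in>balls. avg B (\<lambda>x. enn_powr
            (avg B (\<lambda>y. ennreal
               (op_norm (mat_powr (W x) (1 / p) ** mat_powr (W y) (- 1 / p)) powr p')))
            (p / p'))) < \<top>))"

definition Lp_norm :: "real \<Rightarrow> (real^'n \<Rightarrow> complex^'m^'m) \<Rightarrow> (real^'n \<Rightarrow> complex^'m) \<Rightarrow> ennreal" where
  "Lp_norm p W f =
     enn_powr (\<integral>\<^sup>+x. ennreal (norm (mat_powr (W x) (1 / p) *v f x) powr p) \<partial>lebesgue) (1 / p)"

definition Lp :: "real \<Rightarrow> (real^'n \<Rightarrow> complex^'m^'m) \<Rightarrow> (real^'n \<Rightarrow> complex^'m) set" where
  "Lp p W = {f \<in> borel_measurable lebesgue. Lp_norm p W f < \<top>}"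

definition partial_deriv :: "'n \<Rightarrow> (real^'n \<Rightarrow> complex) \<Rightarrow> real^'n \<Rightarrow> complex" where
  "partial_deriv i f x = frechet_derivative f (at x) (axis i 1)"

text \<open>Multi-indices are represented by lists of coordinates (the length being the order); on smooth
  functions only the number of occurrences of each coordinate matters.\<close>
fun pderivs :: "'n list \<Rightarrow> (real^'n \<Rightarrow> complex) \<Rightarrow> real^'n \<Rightarrow> complex" where
  "pderivs [] f = f"
| "pderivs (i # \<alpha>) f = partial_deriv i (pderivs \<alpha> f)"

definition smooth :: "(real^'n \<Rightarrow> complex) \<Rightarrow> bool" where
  "smooth f \<longleftrightarrow> (\<forall>\<alpha> x. pderivs \<alpha> f differentiable at x)"

definition schwartz :: "(real^'n \<Rightarrow> complex) set" where
  "schwartz = {f. smooth f \<and>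
     (\<forall>\<alpha> N. bounded (range (\<lambda>x. (1 + norm x) ^ N *\<^sub>R pderivs \<alpha> f x)))}"

definition schwartz_norm :: "nat \<Rightarrow> (real^'n \<Rightarrow> complex) \<Rightarrow> real" where
  "schwartz_norm N f =
     (SUP (\<alpha>, x) \<in> {\<alpha>. length \<alpha> \<le> N} \<times> UNIV. (1 + norm x) ^ N * norm (pderivs \<alpha> f x))"

text \<open>Only the values on \<^const>\<open>schwartz\<close> of a functional are meaningful; none of the notions below
  depends on the other values.\<close>
type_synonym 'n functional = "(real^'n \<Rightarrow> complex) \<Rightarrow> complex"

definition tempered :: "('n::finite) functional \<Rightarrow> bool" where
  "tempered u \<longleftrightarrow>
     (\<forall>f\<in>schwartz. \<forall>g\<in>schwartz. u (\<lambda>x. f x + g x) = u f + u g) \<and>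
     (\<forall>f\<in>schwartz. \<forall>c. u (\<lambda>x. c * f x) = c * u f) \<and>
     (\<exists>C N. \<forall>f\<in>schwartz. norm (u f) \<le> C * schwartz_norm N f)"

text \<open>\<open>[S']\<^sup>m\<close>: the \<open>m\<close>-vectors of tempered distributions, indexed by the type \<open>'m\<close>.\<close>
definition temp_dists :: "('m \<Rightarrow> ('n::finite) functional) set" where
  "temp_dists = {u. \<forall>j. tempered (u j)}"

text \<open>The identification of a function with the distribution it defines.\<close>
definition represents :: "(real^'n \<Rightarrow> complex^'m) \<Rightarrow> ('m \<Rightarrow> 'n functional) \<Rightarrow> bool" where
  "represents f u \<longleftrightarrow> f \<in> borel_measurable lebesgue \<and>
     (\<forall>j. \<forall>\<psi>\<in>schwartz. integrable lebesgue (\<lambda>x. f x $ j * \<psi> x) \<and>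
        u j \<psi> = (LINT x|lebesgue. f x $ j * \<psi> x))"

text \<open>The unitary normalization with phase \<open>x \<bullet> \<xi>\<close>.\<close>
definition fourier :: "(real^'n \<Rightarrow> complex) \<Rightarrow> real^'n \<Rightarrow> complex" where
  "fourier f \<xi> = complex_of_real ((2 * pi) powr (- real CARD('n) / 2)) *
     (LINT x|lebesgue. f x * cis (- (x \<bullet> \<xi>)))"

definition inv_fourier :: "(real^'n \<Rightarrow> complex) \<Rightarrow> real^'n \<Rightarrow> complex" where
  "inv_fourier f x = complex_of_real ((2 * pi) powr (- real CARD('n) / 2)) *
     (LINT \<xi>|lebesgue. f \<xi> * cis (x \<bullet> \<xi>))"

definition dist_fourier :: "('n::finite) functional \<Rightarrow> 'n functional" where
  "dist_fourier u = (\<lambda>\<psi>. u (fourier \<psi>))"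

definition dist_inv_fourier :: "('n::finite) functional \<Rightarrow> 'n functional" where
  "dist_inv_fourier u = (\<lambda>\<psi>. u (inv_fourier \<psi>))"

definition dist_mult :: "(real^'n \<Rightarrow> complex) \<Rightarrow> 'n functional \<Rightarrow> 'n functional" where
  "dist_mult \<phi> u = (\<lambda>\<psi>. u (\<lambda>\<xi>. \<phi> \<xi> * \<psi> \<xi>))"

definition lattice_pt :: "int^'n \<Rightarrow> real^'n" where
  "lattice_pt k = (\<chi> i. real_of_int (k $ i))"

definition cube :: "int^'n \<Rightarrow> (real^'n) set" where
  "cube k = {\<xi>. \<forall>i. real_of_int (k $ i) - 1/2 \<le> \<xi> $ i \<and> \<xi> $ i < real_of_int (k $ i) + 1/2}"

definition Y_family :: "(int^'n \<Rightarrow> real^'n \<Rightarrow> complex) set" where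
  "Y_family = {\<phi>.
     (\<forall>k. smooth (\<phi> k)) \<and>
     (\<exists>c>0. \<forall>k. \<forall>\<xi>\<in>cube k. c \<le> norm (\<phi> k \<xi>)) \<and>
     (\<forall>k. closure {\<xi>. \<phi> k \<xi> \<noteq> 0} \<subseteq> cball (lattice_pt k) (sqrt (real CARD('n)))) \<and>
     (\<forall>\<xi>. ((\<lambda>k. \<phi> k \<xi>) has_sum 1) UNIV) \<and>
     (\<forall>\<beta>. \<exists>C. \<forall>k \<xi> \<alpha>. length \<alpha> \<le> \<beta> \<longrightarrow> norm (pderivs \<alpha> (\<phi> k) \<xi>) \<le> C)}"

text \<open>\<open>\<F>\<^sup>-\<^sup>1 \<phi> \<F>\<close> acting componentwise, i.e. \<open>\<box>\<^sub>k\<close> for \<open>\<phi> = \<phi>\<^sub>k\<close>.\<close>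
definition freq_proj :: "(real^'n \<Rightarrow> complex) \<Rightarrow> ('m \<Rightarrow> 'n functional) \<Rightarrow> 'm \<Rightarrow> 'n functional" where
  "freq_proj \<phi> u = (\<lambda>j. dist_inv_fourier (dist_mult \<phi> (dist_fourier (u j))))"

text \<open>The \<open>L\<^sup>p(W)\<close> norm of a distribution given by a function. That function is unique up to null
  sets, so the infimum is over a single value; it is \<open>\<top>\<close> if the distribution is not a function.\<close>
definition dist_Lp_norm ::
    "real \<Rightarrow> (real^'n \<Rightarrow> complex^'m^'m) \<Rightarrow> ('m \<Rightarrow> 'n functional) \<Rightarrow> ennreal" where
  "dist_Lp_norm p W u = (INF f\<in>{f. represents f u}. Lp_norm p W f)"

definition dist_Lp ::
    "real \<Rightarrow> (real^'n \<Rightarrow> complex^'m^'m) \<Rightarrow> ('m \<Rightarrow> 'n functional) set" where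
  "dist_Lp p W = {u \<in> temp_dists. \<exists>f\<in>Lp p W. represents f u}"

definition M_1_norm :: "(int^'n \<Rightarrow> real^'n \<Rightarrow> complex) \<Rightarrow> real \<Rightarrow>
    (real^'n \<Rightarrow> complex^'m^'m) \<Rightarrow> ('m \<Rightarrow> 'n functional) \<Rightarrow> ennreal" where
  "M_1_norm \<phi> p W u = (\<Sum>\<^sub>\<infinity>k\<in>UNIV. dist_Lp_norm p W (freq_proj (\<phi> k) u))"

definition M_inf_norm :: "(int^'n \<Rightarrow> real^'n \<Rightarrow> complex) \<Rightarrow> real \<Rightarrow>
    (real^'n \<Rightarrow> complex^'m^'m) \<Rightarrow> ('m \<Rightarrow> 'n functional) \<Rightarrow> ennreal" where
  "M_inf_norm \<phi> p W u = (SUP k. dist_Lp_norm p W (freq_proj (\<phi> k) u))"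

definition M_1 :: "(int^'n \<Rightarrow> real^'n \<Rightarrow> complex) \<Rightarrow> real \<Rightarrow>
    (real^'n \<Rightarrow> complex^'m^'m) \<Rightarrow> ('m \<Rightarrow> 'n functional) set" where
  "M_1 \<phi> p W = {u \<in> temp_dists. M_1_norm \<phi> p W u < \<top>}"

definition M_inf :: "(int^'n \<Rightarrow> real^'n \<Rightarrow> complex) \<Rightarrow> real \<Rightarrow>
    (real^'n \<Rightarrow> complex^'m^'m) \<Rightarrow> ('m \<Rightarrow> 'n functional) set" where
  "M_inf \<phi> p W = {u \<in> temp_dists. M_inf_norm \<phi> p W u < \<top>}"

definition cont_incl :: "('m \<Rightarrow> ('n::finite) functional) set \<Rightarrow> (('m \<Rightarrow> 'n functional) \<Rightarrow> ennreal) \<Rightarrow>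
    ('m \<Rightarrow> 'n functional) set \<Rightarrow> (('m \<Rightarrow> 'n functional) \<Rightarrow> ennreal) \<Rightarrow> bool" where
  "cont_incl X NX Y NY \<longleftrightarrow> X \<subseteq> Y \<and>
     (\<forall>u\<in>X. \<forall>\<epsilon>>0::real. \<exists>\<delta>>0::real. \<forall>v\<in>X.
        NX (\<lambda>j \<psi>. v j \<psi> - u j \<psi>) < ennreal \<delta> \<longrightarrow> NY (\<lambda>j \<psi>. v j \<psi> - u j \<psi>) < ennreal \<epsilon>)"

end

theory Submission
  imports Defs
begin

text \<open>The matrix \<open>A\<^sub>p\<close> condition enters only through the averaging inequality
  \<open>\<integral>\<^sub>B (\<integral>\<^sub>B |W(x)\<^bsup>1/p\<^esup> f(y)| dy)\<^sup>p dx \<le> C |B|\<^sup>p \<integral>\<^sub>B |W(y)\<^bsup>1/p\<^esup> f(y)|\<^sup>p dy\<close> over balls \<open>B\<close>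
  (Hoelder's inequality for \<open>p > 1\<close>, Tonelli's theorem for \<open>p = 1\<close>). Restricting \<open>x\<close> to a set of
  positive measure on which \<open>W(x)\<^bsup>-1/p\<^esup>\<close> is bounded, it gives
  \<open>\<integral> |f(y)| (1 + |y|)\<^bsup>-N\<^esup> dy \<le> C \<parallel>f\<parallel>\<close>, so that functions in \<open>L\<^sup>p(W)\<close> are tempered distributions.
  Splitting \<open>(1 + |x - y|)\<^bsup>-N\<^esup>\<close> into shells \<open>|x - y| < j + 1\<close>, it shows that convolution with a kernel
  bounded by \<open>(1 + |\<cdot>|)\<^bsup>-N\<^esup>\<close> is bounded on \<open>L\<^sup>p(W)\<close>. The operators \<open>\<box>\<^sub>k\<close> are such convolutions, with bounds
  uniform in \<open>k\<close>, whence the second embedding. For the first, \<open>\<Sum>\<^sub>k \<box>\<^sub>k u\<close> converges absolutely in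
  \<open>L\<^sup>p(W)\<close>; the sum represents \<open>u\<close> because the partial sums of \<open>\<Sum>\<^sub>k \<F>(\<phi>\<^sub>k \<F>\<^sup>-\<^sup>1 \<psi>)\<close> converge to \<open>\<psi>\<close> in
  the Schwartz space.\<close>

section \<open>Powers of nonnegative definite matrices\<close>

text \<open>The decay exponents are dictated by the weight. The averaging inequality on a ball of
  radius R + 1 costs a factor (R + 1)^n, and letting the ball move with x costs at most one more, so
  a kernel must decay like (1 + |z|)^(-2n-2) for its shells to be summable. The uniform derivative
  bounds in \<open>Y_family\<close> provide decay of every order, uniformly in k. A second obstacle
  is that \<open>mat_powr\<close> is a definite description. That it is well defined, and that
  \<open>mat_powr (W x) r\<close> is measurable in x, both follow from one fact: the power is a
  limit of polynomials in the matrix whose coefficients depend on r alone. A third is that the norm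
  of a distribution is an infimum over representing functions. Estimates therefore start from strict
  inequalities, which yield an actual function; for a series of pieces the available slack is
  distributed geometrically over the terms.\<close>

definition hinner :: "complex^'m \<Rightarrow> complex^'m \<Rightarrow> complex" where
  "hinner x y = (\<Sum>i\<in>UNIV. x $ i * cnj (y $ i))"

text \<open>Compactness, dimension counts and the first variation below use the real Euclidean
  structure of \<open>complex^'m\<close>, orthogonality of eigenvectors the Hermitian one; this
  identity connects them.\<close>

lemma Re_hinner: "Re (hinner x y) = x \<bullet> y"
  by (simp add: hinner_def inner_vec_def inner_complex_def)

lemma hinner_commute: "hinner y x = cnj (hinner x y)"
  by (simp add: hinner_def mult.commute)

lemma hinner_add_left: "hinner (x + y) z = hinner x z + hinner y z"
  by (simp add: hinner_def distrib_right sum.distrib)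

lemma hinner_scale_left: "hinner (c *s x) z = c * hinner x z"
  by (simp add: hinner_def sum_distrib_left mult.assoc)

lemma hinner_scale_right: "hinner x (c *s z) = cnj c * hinner x z"
  by (simp add: hinner_def sum_distrib_left mult_ac)

lemma hinner_scaleR_left: "hinner (a *\<^sub>R x) z = of_real a * hinner x z"
  unfolding hinner_def sum_distrib_left by (intro sum.cong) (auto simp: scaleR_conv_of_real[where 'a=complex] mult_ac)

lemma hinner_self: "hinner x x = of_real ((norm x)\<^sup>2)"
proof -
  have "Im (hinner x x) = 0" using arg_cong[OF hinner_commute[of x x], of Im] by simp
  then show ?thesis by (simp add: complex_eq_iff Re_hinner power2_norm_eq_inner)
qed

lemma hinner_matrix: "hinner (A *v x) y = hinner x (conj_transpose A *v y)"
proof -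
  have "hinner (A *v x) y = (\<Sum>i\<in>UNIV. \<Sum>j\<in>UNIV. A $ i $ j * x $ j * cnj (y $ i))"
    by (simp add: hinner_def matrix_vector_mult_def sum_distrib_right)
  also have "\<dots> = (\<Sum>j\<in>UNIV. \<Sum>i\<in>UNIV. A $ i $ j * x $ j * cnj (y $ i))"
    by (rule sum.swap)
  also have "\<dots> = hinner x (conj_transpose A *v y)"
    by (simp add: hinner_def matrix_vector_mult_def conj_transpose_def sum_distrib_left mult_ac)
  finally show ?thesis .
qed

lemma continuous_on_hinner[continuous_intros]:
  "continuous_on S f \<Longrightarrow> continuous_on S g \<Longrightarrow> continuous_on S (\<lambda>x. hinner (f x) (g x))"
  unfolding hinner_def by (intro continuous_intros)

lemma matrix_vector_scaleR: "A *v (a *\<^sub>R x) = a *\<^sub>R (A *v x)" for A :: "complex^'n^'m"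
  using bounded_linear.linear[OF matrix_vector_mul_bounded_linear] by (rule linear_scale)

text \<open>The first-order condition at a maximum. Dividing by |c| + 1 keeps the test point defined
  for every c; since c is at most |c| + 1, the value there is at most -b^2 / (|c| + 1).\<close>

lemma nonneg_quadratic_imp_zero:
  fixes b c :: real
  assumes "\<And>t. 2 * t * b + t\<^sup>2 * c \<ge> 0"
  shows "b = 0"
proof (rule ccontr)
  assume b: "b \<noteq> 0"
  define t where "t = - b / (\<bar>c\<bar> + 1)"
  have "2 * t * b + t\<^sup>2 * c \<le> 2 * t * b + t\<^sup>2 * (\<bar>c\<bar> + 1)" by (intro add_left_mono mult_left_mono) auto
  also have "\<dots> = - (b\<^sup>2 / (\<bar>c\<bar> + 1))"
  proof -
    define s where "s = \<bar>c\<bar> + 1"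
    have "s > 0" by (simp add: s_def)
    then show ?thesis unfolding t_def s_def[symmetric] by (simp add: power2_eq_square field_simps)
  qed
  also have "\<dots> < 0" using b by (simp add: divide_pos_pos)
  finally show False using assms[of t] by simp
qed

text \<open>The eigenvector is a maximiser of the Rayleigh quotient on the orthogonal complement.\<close>
lemma hermitian_eigenvector_orthogonal:
  fixes A :: "complex^'m^'m"
  assumes A: "conj_transpose A = A" and S: "finite S" "card S < CARD('m)"
    and eig: "\<forall>s\<in>S. \<exists>l::real. A *v s = of_real l *s s"
  shows "\<exists>v (l::real). norm v = 1 \<and> (\<forall>s\<in>S. hinner v s = 0) \<and> A *v v = of_real l *s v"
proof -
  define P where "P = {w. \<forall>s\<in>S. hinner w s = 0}"
  define T where "T = P \<inter> sphere 0 1"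
  have P_add: "x + y \<in> P" if "x \<in> P" "y \<in> P" for x y using that by (auto simp: P_def hinner_add_left)
  have P_scale: "a *\<^sub>R x \<in> P" if "x \<in> P" for x a using that by (auto simp: P_def hinner_scaleR_left)
  have P_A: "A *v x \<in> P" if "x \<in> P" for x
    unfolding P_def
  proof clarify
    fix s assume s: "s \<in> S"
    with eig obtain l :: real where "A *v s = of_real l *s s" by blast
    then show "hinner (A *v x) s = 0" using that s
      by (simp add: hinner_matrix A hinner_scale_right P_def)
  qed
  \<comment> \<open>Complex orthogonality to s is real orthogonality to both s and \<i> s. This
    makes at most \<open>2 * card S\<close> real constraints in a space of real dimension
    \<open>2 * CARD('m)\<close>, so a nonzero vector satisfies them.\<close>
  have "dim (S \<union> (\<lambda>s. \<i> *s s) ` S) < DIM(complex^'m)"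
  proof -
    have "dim (S \<union> (\<lambda>s. \<i> *s s) ` S) \<le> card (S \<union> (\<lambda>s. \<i> *s s) ` S)"
      using S by (intro dim_le_card') auto
    also have "\<dots> \<le> card S + card S"
      by (rule order_trans[OF card_Un_le]) (simp add: card_image_le S)
    finally show ?thesis using S by simp
  qed
  from orthogonal_to_subspace_exists[OF this] obtain x
    where x: "x \<noteq> 0" "\<And>y. y \<in> span (S \<union> (\<lambda>s. \<i> *s s) ` S) \<Longrightarrow> orthogonal x y" by blast
  have "x \<in> P" unfolding P_def
  proof clarify
    fix s assume s: "s \<in> S"
    have "x \<bullet> s = 0" "x \<bullet> (\<i> *s s) = 0"
      using x(2)[OF span_base] s by (auto simp: orthogonal_def)
    then show "hinner x s = 0"
      unfolding Re_hinner[symmetric] hinner_scale_right by (simp add: complex_eq_iff)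
  qed
  with x(1) have "(1 / norm x) *\<^sub>R x \<in> T" by (simp add: T_def P_scale)
  then have "T \<noteq> {}" by blast
  moreover have "compact T"
  proof -
    have "closed P"
    proof -
      have "P = (\<Inter>s\<in>S. {w. hinner w s = 0})" by (auto simp: P_def)
      moreover have "closed {w. hinner w s = 0}" for s :: "complex^'m"
        by (intro closed_Collect_eq continuous_intros)
      ultimately show ?thesis by auto
    qed
    then show ?thesis unfolding T_def by (simp add: closed_Int_compact)
  qed
  moreover have "continuous_on T (\<lambda>v. (A *v v) \<bullet> v)"
    by (intro continuous_intros linear_continuous_on matrix_vector_mul_bounded_linear)
  ultimately obtain v where v: "v \<in> T" "\<And>w. w \<in> T \<Longrightarrow> (A *v w) \<bullet> w \<le> (A *v v) \<bullet> v"
    using continuous_attains_sup[of T "\<lambda>v. (A *v v) \<bullet> v"] by blast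
  define l where "l = (A *v v) \<bullet> v"
  have vP: "v \<in> P" and nv: "norm v = 1" using v(1) by (auto simp: T_def)
  have le: "(A *v w) \<bullet> w \<le> l * (w \<bullet> w)" if "w \<in> P" for w
  proof (cases "w = 0")
    case False
    let ?w = "(1 / norm w) *\<^sub>R w"
    have "?w \<in> T" using that False by (simp add: T_def P_scale)
    from v(2)[OF this] have "((A *v w) \<bullet> w) / (norm w)\<^sup>2 \<le> l"
      unfolding matrix_vector_scaleR inner_scaleR_left inner_scaleR_right l_def[symmetric]
      by (simp add: power2_eq_square)
    then show ?thesis using False by (simp add: divide_le_eq power2_norm_eq_inner)
  qed simp
  have sym: "(A *v x) \<bullet> y = x \<bullet> (A *v y)" for x y
    unfolding Re_hinner[symmetric] by (simp add: hinner_matrix A)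
  \<comment> \<open>The residual of the eigenvalue equation. It lies in P because A maps P into
    itself, so it is an admissible direction of variation, and the vanishing first variation in this
    direction reads |w|^2 = 0.\<close>
  define w where "w = l *\<^sub>R v - A *v v"
  have wP: "w \<in> P"
    using P_add[OF P_scale[OF vP, of l] P_scale[OF P_A[OF vP], of "-1"]] by (simp add: w_def)
  have "(l *\<^sub>R v - A *v v) \<bullet> w = 0"
  proof (rule nonneg_quadratic_imp_zero[where c = "l * (w \<bullet> w) - (A *v w) \<bullet> w"])
    fix t :: real
    have "v + t *\<^sub>R w \<in> P" using vP wP by (intro P_add P_scale)
    from le[OF this] have "0 \<le> l * ((v + t *\<^sub>R w) \<bullet> (v + t *\<^sub>R w)) - (A *v (v + t *\<^sub>R w)) \<bullet> (v + t *\<^sub>R w)" by simp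
    also have "\<dots> = (l * (v \<bullet> v) - l) + 2 * t * ((l *\<^sub>R v - A *v v) \<bullet> w) + t\<^sup>2 * (l * (w \<bullet> w) - (A *v w) \<bullet> w)"
    proof -
      have "(A *v w) \<bullet> v = (A *v v) \<bullet> w" using sym[of w v] by (simp add: inner_commute)
      moreover have "w \<bullet> v = v \<bullet> w" by (rule inner_commute)
      ultimately show ?thesis
        unfolding matrix_vector_right_distrib matrix_vector_scaleR inner_add_left inner_add_right
          inner_diff_left inner_scaleR_left inner_scaleR_right l_def[symmetric]
        by (simp only: power2_eq_square) (simp add: algebra_simps)
    qed
    also have "l * (v \<bullet> v) = l" using nv by (simp add: norm_eq_1)
    finally show "0 \<le> 2 * t * ((l *\<^sub>R v - A *v v) \<bullet> w) + t\<^sup>2 * (l * (w \<bullet> w) - (A *v w) \<bullet> w)" by simp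
  qed
  then have "w = 0" unfolding w_def by simp
  then have "A *v v = of_real l *s v" by (simp add: w_def vec_eq_iff scaleR_conv_of_real[where 'a=complex])
  with vP nv show ?thesis by (auto simp: P_def)
qed

lemma hermitian_orthonormal_eigenvectors:
  fixes A :: "complex^'m^'m"
  assumes A: "conj_transpose A = A" and "n \<le> CARD('m)"
  shows "\<exists>S. finite S \<and> card S = n \<and> (\<forall>s\<in>S. norm s = 1) \<and>
    (\<forall>s\<in>S. \<forall>t\<in>S. s \<noteq> t \<longrightarrow> hinner s t = 0) \<and> (\<forall>s\<in>S. \<exists>l::real. A *v s = of_real l *s s)"
  using assms(2)
proof (induction n)
  case 0
  show ?case by (rule exI[of _ "{}"]) simp
next
  case (Suc n)
  then obtain S where S: "finite S" "card S = n" "\<forall>s\<in>S. norm s = 1"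
    "\<forall>s\<in>S. \<forall>t\<in>S. s \<noteq> t \<longrightarrow> hinner s t = 0" "\<forall>s\<in>S. \<exists>l::real. A *v s = of_real l *s s" by auto
  from hermitian_eigenvector_orthogonal[OF A S(1) _ S(5)] Suc.prems S(2)
  obtain v and l :: real where v: "norm v = 1" "\<forall>s\<in>S. hinner v s = 0" "A *v v = of_real l *s v" by auto
  have "v \<notin> S"
  proof
    assume "v \<in> S"
    then have "hinner v v = 0" using v by auto
    then show False using v(1) by (simp add: hinner_self)
  qed
  moreover have "\<forall>s\<in>S. hinner s v = 0" using v(2) hinner_commute by (metis complex_cnj_zero)
  ultimately show ?case using S v by (intro exI[of _ "insert v S"]) auto
qed

lemma sandwich_diag_nth:
  "(U ** diag_matrix d ** conj_transpose U) $ i $ j = (\<Sum>l\<in>UNIV. of_real (d l) * (U $ i $ l * cnj (U $ j $ l)))"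
proof -
  have "(U ** diag_matrix d) $ i $ l = U $ i $ l * of_real (d l)" for l
    unfolding matrix_matrix_mult_def diag_matrix_def by (simp add: if_distrib[of "\<lambda>x. _ * x"] cong: if_cong)
  then show ?thesis
    unfolding matrix_matrix_mult_def[of "U ** diag_matrix d"]
    by (simp add: conj_transpose_def mult_ac)
qed

text \<open>The columns of U are orthonormal eigenvectors. Each eigenvalue is the value of the
  quadratic form at a unit vector and hence nonnegative.\<close>

theorem nonneg_definite_diagonalization:
  fixes A :: "complex^'m^'m"
  assumes "nonneg_definite A"
  shows "\<exists>U d. unitary U \<and> (\<forall>i. 0 \<le> d i) \<and> A = U ** diag_matrix d ** conj_transpose U"
proof -
  have A: "conj_transpose A = A" and pos: "\<And>v. 0 \<le> Re (hinner (A *v v) v)"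
    using assms by (auto simp: nonneg_definite_def hinner_def)
  from hermitian_orthonormal_eigenvectors[OF A, of "CARD('m)"] obtain S where
    S: "finite S" "card S = CARD('m)" "\<forall>s\<in>S. norm s = 1"
    "\<forall>s\<in>S. \<forall>t\<in>S. s \<noteq> t \<longrightarrow> hinner s t = 0" "\<forall>s\<in>S. \<exists>l::real. A *v s = of_real l *s s" by auto
  then obtain b where b: "bij_betw b (UNIV::'m set) S"
    using finite_same_card_bij[of "UNIV::'m set" S] by auto
  from S(5) obtain e where e: "\<And>s. s \<in> S \<Longrightarrow> A *v s = of_real (e s) *s s" by metis
  define U where "U = (\<chi> i j. b j $ i)"
  define d where "d j = e (b j)" for j
  have bS: "b j \<in> S" for j using b by (auto simp: bij_betw_def)
  have ortho: "hinner (b j) (b i) = (if i = j then 1 else 0)" for i j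
    using S(3,4) bS inj_onD[OF bij_betw_imp_inj_on[OF b], of j i] by (auto simp: hinner_self)
  have "conj_transpose U ** U = mat 1"
  proof -
    have "(conj_transpose U ** U) $ i $ j = mat 1 $ i $ j" for i j
      using ortho[of j i] by (simp add: matrix_matrix_mult_def conj_transpose_def U_def hinner_def mat_def mult.commute)
    then show ?thesis by (simp add: vec_eq_iff)
  qed
  moreover from this have UU: "U ** conj_transpose U = mat 1" by (simp add: matrix_left_right_inverse)
  moreover have "0 \<le> d i" for i
    using pos[of "b i"] e[OF bS[of i]] ortho[of i i] by (simp add: d_def hinner_scale_left)
  moreover have "A ** U = U ** diag_matrix d"
  proof -
    have "(A ** U) $ i $ j = (A *v b j) $ i" for i j
      by (simp add: matrix_matrix_mult_def matrix_vector_mult_def U_def)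
    moreover have "(U ** diag_matrix d) $ i $ j = (of_real (d j) *s b j) $ i" for i j
      unfolding matrix_matrix_mult_def diag_matrix_def
      by (simp add: if_distrib[of "\<lambda>x. _ * x"] U_def mult.commute cong: if_cong)
    ultimately show ?thesis using e[OF bS] by (simp add: vec_eq_iff d_def)
  qed
  then have "A = U ** diag_matrix d ** conj_transpose U"
    by (metis UU matrix_mul_assoc matrix_mul_rid)
  ultimately show ?thesis unfolding unitary_def by blast
qed

section \<open>Matrix powers as limits of polynomials in the matrix\<close>

primrec matrix_pow :: "complex^'m^'m \<Rightarrow> nat \<Rightarrow> complex^'m^'m" where
  "matrix_pow A 0 = mat 1"
| "matrix_pow A (Suc n) = A ** matrix_pow A n"

lemma diag_matrix_mult: "diag_matrix d ** diag_matrix e = diag_matrix (\<lambda>i. d i * e i)"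
proof -
  have "(diag_matrix d ** diag_matrix e) $ i $ j = diag_matrix (\<lambda>i. d i * e i) $ i $ j" for i j
  proof -
    have "(diag_matrix d ** diag_matrix e) $ i $ j =
        (\<Sum>k\<in>UNIV. if k = i then of_real (d i) * (if i = j then of_real (e i) else 0) else 0)"
      unfolding matrix_matrix_mult_def diag_matrix_def vec_lambda_beta by (rule sum.cong) auto
    then show ?thesis by (simp add: diag_matrix_def)
  qed
  then show ?thesis by (simp add: vec_eq_iff)
qed

lemma unitary_sandwich_mult:
  assumes "unitary U"
  shows "(U ** diag_matrix d ** conj_transpose U) ** (U ** diag_matrix e ** conj_transpose U) =
    U ** diag_matrix (\<lambda>i. d i * e i) ** conj_transpose U"
proof -
  have "(U ** diag_matrix d ** conj_transpose U) ** (U ** diag_matrix e ** conj_transpose U) =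
    U ** diag_matrix d ** (conj_transpose U ** U) ** diag_matrix e ** conj_transpose U"
    by (simp add: matrix_mul_assoc)
  also have "\<dots> = U ** (diag_matrix d ** diag_matrix e) ** conj_transpose U"
    using assms by (simp add: unitary_def matrix_mul_assoc)
  finally show ?thesis by (simp add: diag_matrix_mult)
qed

lemma diag_matrix_1: "diag_matrix (\<lambda>_. 1) = mat 1"
  by (simp add: diag_matrix_def mat_def vec_eq_iff)

lemma matrix_pow_sandwich:
  assumes "unitary U"
  shows "matrix_pow (U ** diag_matrix d ** conj_transpose U) n = U ** diag_matrix (\<lambda>i. d i ^ n) ** conj_transpose U"
proof (induction n)
  case 0
  then show ?case using assms by (simp add: diag_matrix_1 unitary_def)
next
  case (Suc n)
  then show ?case by (simp add: unitary_sandwich_mult[OF assms])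
qed

lemma sandwich_tendsto:
  assumes "\<And>i. (\<lambda>k. d k i) \<longlonglongrightarrow> e i"
  shows "(\<lambda>k. U ** diag_matrix (d k) ** conj_transpose U) \<longlonglongrightarrow> U ** diag_matrix e ** conj_transpose U"
  by (intro vec_tendstoI) (auto simp: sandwich_diag_nth intro!: tendsto_intros assms)

text \<open>The approximants have the form \<open>t * q t\<close>, so that they vanish at \<open>0\<close> like \<open>0 powr r\<close> does,
  whatever the sign of \<open>r\<close>.\<close>
lemma powr_polynomial_limit:
  fixes r :: real
  shows "\<exists>a (n::nat \<Rightarrow> nat). \<forall>t\<ge>0. (\<lambda>k. \<Sum>i\<le>n k. a k i * t ^ i) \<longlonglongrightarrow> t powr r"
proof -
  have "\<exists>a n. \<forall>t. (t = 0 \<longrightarrow> (\<Sum>i\<le>n. a i * t ^ i) = 0) \<and>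
      (t \<in> {1 / real (Suc k)..real (Suc k)} \<longrightarrow> \<bar>t powr r - (\<Sum>i\<le>(n::nat). a i * t ^ i)\<bar> < t / real (Suc k))" for k
  proof -
    \<comment> \<open>The interval stays away from 0, where the power may be singular, and exhausts
      the positive half line as k grows.\<close>
    let ?S = "{1 / real (Suc k)..real (Suc k)}"
    have "continuous_on ?S (\<lambda>t. t powr (r - 1))" by (intro continuous_intros) auto
    from Stone_Weierstrass_real_polynomial_function[OF _ this, of "1 / real (Suc k)"] obtain g where
      g: "real_polynomial_function g" "\<And>t. t \<in> ?S \<Longrightarrow> \<bar>t powr (r - 1) - g t\<bar> < 1 / real (Suc k)" by auto
    have "real_polynomial_function (\<lambda>t::real. t * g t)"
      by (intro real_polynomial_function.intros g bounded_linear_ident)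
    then obtain a n where an: "(\<lambda>t. t * g t) = (\<lambda>t. \<Sum>i\<le>n. a i * t ^ i)"
      unfolding real_polynomial_function_iff_sum by blast
    show ?thesis
    proof (rule exI[of _ a], rule exI[of _ n], intro allI conjI impI)
      fix t :: real assume "t = 0"
      then show "(\<Sum>i\<le>n. a i * t ^ i) = 0" using fun_cong[OF an, of t] by simp
    next
      fix t :: real assume t: "t \<in> ?S"
      then have t0: "0 < t" using less_le_trans[of 0 "1 / real (Suc k)" t] by simp
      have "t powr r = t * t powr (r - 1)" using t0 by (simp add: powr_diff)
      then have "t powr r - (\<Sum>i\<le>n. a i * t ^ i) = t * (t powr (r - 1) - g t)"
        using fun_cong[OF an, of t] by (simp add: algebra_simps)
      then have "\<bar>t powr r - (\<Sum>i\<le>n. a i * t ^ i)\<bar> = t * \<bar>t powr (r - 1) - g t\<bar>"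
        using t0 by (simp add: abs_mult)
      also have "\<dots> < t * (1 / real (Suc k))" by (intro mult_strict_left_mono g t t0)
      finally show "\<bar>t powr r - (\<Sum>i\<le>n. a i * t ^ i)\<bar> < t / real (Suc k)" by simp
    qed
  qed
  then obtain a n where an: "\<And>k t. t = 0 \<Longrightarrow> (\<Sum>i\<le>(n k::nat). a k i * t ^ i) = 0"
    "\<And>k t. t \<in> {1 / real (Suc k)..real (Suc k)} \<Longrightarrow> \<bar>t powr r - (\<Sum>i\<le>n k. a k i * t ^ i)\<bar> < t / real (Suc k)"
    by metis
  show ?thesis
  proof (rule exI[of _ a], rule exI[of _ n], intro allI impI)
    fix t :: real assume "0 \<le> t"
    show "(\<lambda>k. \<Sum>i\<le>n k. a k i * t ^ i) \<longlonglongrightarrow> t powr r"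
    proof (cases "t = 0")
      case True
      then show ?thesis using an(1) by simp
    next
      case False
      with \<open>0 \<le> t\<close> have t: "0 < t" by simp
      have "(\<lambda>k. (\<Sum>i\<le>n k. a k i * t ^ i) - t powr r) \<longlonglongrightarrow> 0"
      proof (rule Lim_null_comparison)
        obtain K :: nat where K: "real K > t" "real K > 1 / t"
          using reals_Archimedean2[of "max t (1 / t)"] by auto
        show "\<forall>\<^sub>F k in sequentially. norm ((\<Sum>i\<le>n k. a k i * t ^ i) - t powr r) \<le> t / real (Suc k)"
        proof (rule eventually_sequentiallyI[of K])
          fix k assume "K \<le> k"
          then have kk: "real (Suc k) > t" "real (Suc k) > 1 / t" using K by (auto intro: less_le_trans)
          then have "1 / real (Suc k) \<le> t" using t by (simp add: field_simps)
          then have "t \<in> {1 / real (Suc k)..real (Suc k)}" using kk by simp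
          from an(2)[OF this] show "norm ((\<Sum>i\<le>n k. a k i * t ^ i) - t powr r) \<le> t / real (Suc k)"
            by (simp add: abs_minus_commute)
        qed
        show "(\<lambda>k. t / real (Suc k)) \<longlonglongrightarrow> 0" by (rule LIMSEQ_Suc[OF lim_const_over_n])
      qed
      then show ?thesis by (simp add: LIM_zero_iff)
    qed
  qed
qed

text \<open>The quantifier order is the point: the coefficients are chosen before U and d. On the
  diagonal the polynomials act on each eigenvalue separately, which reduces the claim to
  \<open>powr_polynomial_limit\<close>.\<close>

lemma mat_powr_polynomial_limit:
  fixes r :: real
  shows "\<exists>a (n::nat \<Rightarrow> nat). (\<forall>U d. unitary (U::complex^'m^'m) \<longrightarrow> (\<forall>i. 0 \<le> d i) \<longrightarrow>
    (\<lambda>k. \<Sum>i\<le>n k. a k i *\<^sub>R matrix_pow (U ** diag_matrix d ** conj_transpose U) i) \<longlonglongrightarrow>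
      U ** diag_matrix (\<lambda>i. d i powr r) ** conj_transpose U)"
proof -
  from powr_polynomial_limit[of r] obtain a and n :: "nat \<Rightarrow> nat"
    where an: "\<And>t. t \<ge> 0 \<Longrightarrow> (\<lambda>k. \<Sum>i\<le>n k. a k i * t ^ i) \<longlonglongrightarrow> t powr r" by blast
  show ?thesis
  proof (rule exI[of _ a], rule exI[of _ n], intro allI impI)
    fix U :: "complex^'m^'m" and d :: "'m \<Rightarrow> real"
    assume U: "unitary U" and d: "\<forall>i. 0 \<le> d i"
    have "(\<Sum>i\<le>n k. a k i *\<^sub>R matrix_pow (U ** diag_matrix d ** conj_transpose U) i) =
        U ** diag_matrix (\<lambda>l. \<Sum>i\<le>n k. a k i * d l ^ i) ** conj_transpose U" for k
    proof -
      have "(\<Sum>i\<le>n k. a k i *\<^sub>R matrix_pow (U ** diag_matrix d ** conj_transpose U) i) $ x $ y =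
        (U ** diag_matrix (\<lambda>l. \<Sum>i\<le>n k. a k i * d l ^ i) ** conj_transpose U) $ x $ y" for x y
        unfolding sandwich_diag_nth sum_component vector_scaleR_component matrix_pow_sandwich[OF U]
          scaleR_conv_of_real[where 'a=complex] sum_distrib_left of_real_sum sum_distrib_right
        by (subst sum.swap) (simp add: mult.assoc)
      then show ?thesis by (simp add: vec_eq_iff)
    qed
    then show "(\<lambda>k. \<Sum>i\<le>n k. a k i *\<^sub>R matrix_pow (U ** diag_matrix d ** conj_transpose U) i) \<longlonglongrightarrow>
      U ** diag_matrix (\<lambda>i. d i powr r) ** conj_transpose U"
      using d an by (simp add: sandwich_tendsto)
  qed
qed

text \<open>Uniqueness in the definite description: two diagonalizations of one matrix give limits
  of the same sequence of polynomials in that matrix.\<close>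

lemma mat_powr_eq:
  assumes U: "unitary U" and d: "\<forall>i. 0 \<le> d i"
  shows "mat_powr (U ** diag_matrix d ** conj_transpose U) r = U ** diag_matrix (\<lambda>i. d i powr r) ** conj_transpose U"
  unfolding mat_powr_def
proof (rule the_equality)
  show "\<exists>V e. unitary V \<and> (\<forall>i. 0 \<le> e i) \<and>
      U ** diag_matrix d ** conj_transpose U = V ** diag_matrix e ** conj_transpose V \<and>
      U ** diag_matrix (\<lambda>i. d i powr r) ** conj_transpose U = V ** diag_matrix (\<lambda>i. e i powr r) ** conj_transpose V"
    using assms by blast
next
  fix B assume "\<exists>V e. unitary V \<and> (\<forall>i. 0 \<le> e i) \<and>
      U ** diag_matrix d ** conj_transpose U = V ** diag_matrix e ** conj_transpose V \<and>
      B = V ** diag_matrix (\<lambda>i. e i powr r) ** conj_transpose V"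
  then obtain V e where V: "unitary V" "\<forall>i. 0 \<le> e i"
      "U ** diag_matrix d ** conj_transpose U = V ** diag_matrix e ** conj_transpose V"
      "B = V ** diag_matrix (\<lambda>i. e i powr r) ** conj_transpose V" by blast
  from mat_powr_polynomial_limit[of r, where 'm='a] obtain a and n :: "nat \<Rightarrow> nat" where
    an: "\<And>U d. unitary (U::complex^'a^'a) \<Longrightarrow> (\<forall>i. 0 \<le> d i) \<Longrightarrow>
    (\<lambda>k. \<Sum>i\<le>n k. a k i *\<^sub>R matrix_pow (U ** diag_matrix d ** conj_transpose U) i) \<longlonglongrightarrow>
      U ** diag_matrix (\<lambda>i. d i powr r) ** conj_transpose U" by blast
  show "B = U ** diag_matrix (\<lambda>i. d i powr r) ** conj_transpose U"
    unfolding V(4) by (rule LIMSEQ_unique[OF an[OF V(1,2), folded V(3)] an[OF assms]])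
qed

text \<open>Free of any diagonalization, which could not be chosen measurably without further work;
  in this form it yields the measurability of powers of the weight.\<close>

lemma mat_powr_limit:
  fixes r :: real
  shows "\<exists>a (n::nat \<Rightarrow> nat). \<forall>A::complex^'m^'m. nonneg_definite A \<longrightarrow>
    (\<lambda>k. \<Sum>i\<le>n k. a k i *\<^sub>R matrix_pow A i) \<longlonglongrightarrow> mat_powr A r"
proof -
  from mat_powr_polynomial_limit[of r, where 'm='m] obtain a and n :: "nat \<Rightarrow> nat" where
    an: "\<And>U d. unitary (U::complex^'m^'m) \<Longrightarrow> (\<forall>i. 0 \<le> d i) \<Longrightarrow>
    (\<lambda>k. \<Sum>i\<le>n k. a k i *\<^sub>R matrix_pow (U ** diag_matrix d ** conj_transpose U) i) \<longlonglongrightarrow>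
      U ** diag_matrix (\<lambda>i. d i powr r) ** conj_transpose U" by blast
  have "(\<lambda>k. \<Sum>i\<le>n k. a k i *\<^sub>R matrix_pow A i) \<longlonglongrightarrow> mat_powr A r" if A: "nonneg_definite A" for A :: "complex^'m^'m"
  proof -
    from nonneg_definite_diagonalization[OF A] obtain U d where
      *: "unitary U" "\<forall>i. 0 \<le> d i" and A': "A = U ** diag_matrix d ** conj_transpose U" by blast
    show ?thesis unfolding A' mat_powr_eq[OF *] by (rule an[OF *])
  qed
  then show ?thesis by blast
qed

lemma mat_powr_1:
  assumes "nonneg_definite A" shows "mat_powr A 1 = A"
proof -
  from nonneg_definite_diagonalization[OF assms] obtain U d where
    *: "unitary U" "\<forall>i. 0 \<le> d i" "A = U ** diag_matrix d ** conj_transpose U" by blast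
  then show ?thesis by (simp add: mat_powr_eq)
qed

lemma matrix_inv_left:
  fixes A :: "complex^'m^'m"
  assumes "invertible A" shows "matrix_inv A ** A = mat 1"
  using someI_ex[of "\<lambda>A'. A ** A' = mat 1 \<and> A' ** A = mat 1"] assms
  by (auto simp: matrix_inv_def invertible_def)

text \<open>Invertibility excludes the eigenvalue 0. There \<open>0 powr r = 0\<close> would make
  the product a projection instead of the identity.\<close>

lemma mat_powr_minus_mult:
  fixes A :: "complex^'m^'m"
  assumes "nonneg_definite A" "invertible A"
  shows "mat_powr A (- r) ** mat_powr A r = mat 1"
proof -
  from nonneg_definite_diagonalization[OF assms(1)] obtain U d where
    U: "unitary U" and d: "\<forall>i. 0 \<le> d i" and A: "A = U ** diag_matrix d ** conj_transpose U" by blast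
  have "d i \<noteq> 0" for i
  proof
    assume di: "d i = 0"
    have "A ** U = U ** diag_matrix d ** (conj_transpose U ** U)" unfolding A by (simp add: matrix_mul_assoc)
    also have "\<dots> = U ** diag_matrix d" using U by (simp add: unitary_def)
    finally have "A *v (U *v axis i 1) = U *v (diag_matrix d *v axis i 1)" by (simp add: matrix_vector_mul_assoc)
    moreover have "diag_matrix d *v axis i 1 = 0"
      by (simp add: vec_eq_iff matrix_vector_mult_def diag_matrix_def axis_def di if_distrib[of "\<lambda>x. _ * x"] cong: if_cong)
    ultimately have 0: "A *v (U *v axis i 1) = 0" by simp
    have "axis i 1 = conj_transpose U *v (matrix_inv A *v (A *v (U *v axis i 1)))"
      using U matrix_inv_left[OF assms(2)] by (simp add: matrix_vector_mul_assoc matrix_mul_assoc unitary_def)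
    then have "axis i (1::complex) = 0" unfolding 0 by simp
    then show False by simp
  qed
  then have "d i powr - r * d i powr r = 1" for i by (simp flip: powr_add)
  then show ?thesis unfolding A mat_powr_eq[OF U d] unitary_sandwich_mult[OF U]
    using U by (simp add: diag_matrix_1 unitary_def)
qed

section \<open>Inequalities of Hoelder and Minkowski\<close>

lemma sigma_finite_lebesgue: "sigma_finite_measure (lebesgue :: 'a::euclidean_space measure)"
proof
  show "\<exists>A::'a set set. countable A \<and> A \<subseteq> sets lebesgue \<and> \<Union> A = space lebesgue \<and> (\<forall>a\<in>A. emeasure lebesgue a \<noteq> \<infinity>)"
  proof (intro exI[of _ "range (\<lambda>n::nat. cball 0 (real n))"] conjI ballI)
    have "\<exists>n. norm x \<le> real n" for x :: 'a by (rule real_arch_simple)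
    then show "\<Union> (range (\<lambda>n::nat. cball 0 (real n))) = space (lebesgue :: 'a measure)" by auto
    fix a :: "'a set" assume "a \<in> range (\<lambda>n::nat. cball 0 (real n))"
    then show "emeasure lebesgue a \<noteq> \<infinity>" using emeasure_lborel_cball_finite by (auto simp: less_top)
  qed auto
qed

lemma pair_sigma_finite_lebesgue:
  "pair_sigma_finite (lebesgue :: 'a::euclidean_space measure) (lebesgue :: 'b::euclidean_space measure)"
  by (intro pair_sigma_finite.intro sigma_finite_lebesgue)

section \<open>Powers of extended nonnegative numbers\<close>

lemma enn_powr_ennreal: "0 \<le> x \<Longrightarrow> enn_powr (ennreal x) r = ennreal (x powr r)"
  by (simp add: enn_powr_def)

lemma enn_powr_top [simp]: "enn_powr \<top> r = \<top>"
  by (simp add: enn_powr_def)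

lemma enn_powr_0 [simp]: "enn_powr 0 r = 0"
  by (simp add: enn_powr_def)

lemma enn_powr_1 [simp]: "enn_powr a 1 = a"
  by (simp add: enn_powr_def less_top)

lemma enn_powr_mono: "a \<le> b \<Longrightarrow> 0 < r \<Longrightarrow> enn_powr a r \<le> enn_powr b r"
proof (cases "b = \<top>")
  case False
  assume ab: "a \<le> b" and r: "0 < r"
  with False have "a \<noteq> \<top>" by (auto simp: top_unique)
  with False ab have "enn2real a \<le> enn2real b" by (simp add: enn2real_mono less_top)
  with False \<open>a \<noteq> \<top>\<close> r show ?thesis by (simp add: enn_powr_def ennreal_leI powr_mono2)
qed simp

lemma enn_powr_powr: "0 < r \<Longrightarrow> 0 < s \<Longrightarrow> enn_powr (enn_powr a r) s = enn_powr a (r * s)"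
  by (cases a) (auto simp: enn_powr_ennreal powr_powr)

lemma enn_powr_inverse: "0 < r \<Longrightarrow> enn_powr (enn_powr a (1 / r)) r = a" "0 < r \<Longrightarrow> enn_powr (enn_powr a r) (1 / r) = a"
  by (simp_all add: enn_powr_powr)

lemma enn_powr_mult: "0 < r \<Longrightarrow> enn_powr (a * b) r = enn_powr a r * enn_powr b r"
  by (cases a; cases b) (auto simp: enn_powr_ennreal powr_mult ennreal_top_mult ennreal_mult_top ennreal_mult[symmetric])

lemma enn_powr_eq_0_iff [simp]: "enn_powr a r = 0 \<longleftrightarrow> a = 0"
  by (cases a) (auto simp: enn_powr_ennreal)

lemma enn_powr_le_iff: "0 < r \<Longrightarrow> enn_powr a r \<le> b \<longleftrightarrow> a \<le> enn_powr b (1 / r)"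
  using enn_powr_mono[of a "enn_powr b (1 / r)" r] enn_powr_mono[of "enn_powr a r" b "1 / r"]
  by (auto simp: enn_powr_inverse)

lemma borel_measurable_enn_powr [measurable]:
  assumes [measurable]: "f \<in> borel_measurable M"
  shows "(\<lambda>x. enn_powr (f x) r) \<in> borel_measurable M"
  unfolding enn_powr_def by measurable

text \<open>A positive power is an order isomorphism of the extended half line with inverse power 1
  / r, so it commutes with suprema. This carries monotone convergence through the power.\<close>

lemma enn_powr_SUP: "0 < r \<Longrightarrow> enn_powr (SUP j. f j) r = (SUP j. enn_powr (f j) r)"
proof (rule antisym)
  assume r: "0 < r"
  show "enn_powr (SUP j. f j) r \<le> (SUP j. enn_powr (f j) r)"
    unfolding enn_powr_le_iff[OF r]
  proof (rule SUP_least)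
    fix j show "f j \<le> enn_powr (SUP j. enn_powr (f j) r) (1 / r)"
      unfolding enn_powr_le_iff[OF r, symmetric] by (rule SUP_upper) simp
  qed
  show "(SUP j. enn_powr (f j) r) \<le> enn_powr (SUP j. f j) r"
    by (intro SUP_least enn_powr_mono SUP_upper r) simp
qed

text \<open>At the endpoint 0 convexity reduces to c^p \<le> c for 0 < c < 1; between positive
  points \<open>powr_convex\<close> applies.\<close>

lemma powr_convex_nonneg:
  assumes "1 \<le> (p::real)" shows "convex_on {0..} (\<lambda>x. x powr p)"
proof (rule convex_onI)
  fix t x y :: real
  assume t: "0 < t" "t < 1" and xy: "x \<in> {0..}" "y \<in> {0..}"
  have s: "(c * z) powr p \<le> c * z powr p" if "0 < c" "c < 1" "0 \<le> z" for c z :: real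
  proof -
    have "c powr p \<le> c powr 1" using that assms by (intro powr_mono') auto
    then show ?thesis using that by (simp add: powr_mult mult_right_mono)
  qed
  show "((1 - t) *\<^sub>R x + t *\<^sub>R y) powr p \<le> (1 - t) * x powr p + t * y powr p"
  proof (cases "x = 0 \<or> y = 0")
    case True
    then show ?thesis using s[of t y] s[of "1 - t" x] t xy by auto
  next
    case False
    then show ?thesis using convex_onD[OF powr_convex[OF assms], of t x y] t xy by auto
  qed
qed (rule convex_real_interval)

text \<open>Jensen's inequality with free weights. In the application \<open>b j\<close> is a bound
  for the norm of the j-th term, which balances the two factors on the right.\<close>

lemma powr_sum_le:
  fixes b g :: "nat \<Rightarrow> real"
  assumes p: "1 \<le> p" and b: "\<And>j. 0 < b j" and g: "\<And>j. 0 \<le> g j" and J: "finite J"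
  shows "(\<Sum>j\<in>J. g j) powr p \<le> (\<Sum>j\<in>J. b j) powr (p - 1) * (\<Sum>j\<in>J. b j powr (1 - p) * g j powr p)"
proof (cases "J = {}")
  case False
  define S where "S = (\<Sum>j\<in>J. b j)"
  have S: "S > 0" unfolding S_def using False J b by (intro sum_pos) auto
  have "(\<Sum>j\<in>J. (b j / S) *\<^sub>R (g j / b j)) powr p \<le> (\<Sum>j\<in>J. (b j / S) * (g j / b j) powr p)"
    using J False S b g by (intro convex_on_sum[OF _ _ powr_convex_nonneg[OF p]])
      (auto simp: sum_divide_distrib[symmetric] S_def[symmetric] less_imp_le)
  also have "(\<Sum>j\<in>J. (b j / S) *\<^sub>R (g j / b j)) = (\<Sum>j\<in>J. g j) / S"
    using b by (auto simp: sum_divide_distrib less_imp_neq[THEN not_sym] intro!: sum.cong)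
  also have "(\<Sum>j\<in>J. (b j / S) * (g j / b j) powr p) = (1 / S) * (\<Sum>j\<in>J. b j powr (1 - p) * g j powr p)"
  proof -
    have "(b j / S) * (g j / b j) powr p = (1 / S) * (b j powr (1 - p) * g j powr p)" for j
      using b[of j] g[of j] by (simp add: powr_divide powr_diff)
    then show ?thesis by (simp only: sum_distrib_left)
  qed
  finally have "(\<Sum>j\<in>J. g j) powr p \<le> S powr p * ((1 / S) * (\<Sum>j\<in>J. b j powr (1 - p) * g j powr p))"
    using S g by (simp add: powr_divide sum_nonneg divide_le_eq mult.commute)
  also have "\<dots> = S powr (p - 1) * (\<Sum>j\<in>J. b j powr (1 - p) * g j powr p)"
    using S by (simp add: powr_diff)
  finally show ?thesis by (simp add: S_def)
qed simp

lemma enn_powr_sum_le: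
  fixes b :: "nat \<Rightarrow> real" and g :: "nat \<Rightarrow> ennreal"
  assumes p: "1 \<le> p" and b: "\<And>j. 0 < b j" and J: "finite J"
  shows "enn_powr (\<Sum>j\<in>J. g j) p \<le>
    ennreal ((\<Sum>j\<in>J. b j) powr (p - 1)) * (\<Sum>j\<in>J. ennreal (b j powr (1 - p)) * enn_powr (g j) p)"
proof (cases "\<exists>j\<in>J. g j = \<top>")
  case True
  then obtain j where j: "j \<in> J" "g j = \<top>" by blast
  have "(\<Sum>j\<in>J. b j) > 0" using j J b by (intro sum_pos) auto
  then have "ennreal ((\<Sum>j\<in>J. b j) powr (p - 1)) \<noteq> 0" by simp
  moreover have "(\<Sum>j\<in>J. ennreal (b j powr (1 - p)) * enn_powr (g j) p) = \<top>"
    using j J b[of j] by (subst sum.remove[of J j]) (auto simp: ennreal_mult_top)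
  ultimately show ?thesis by (simp add: ennreal_mult_top)
next
  case False
  then have g: "g j = ennreal (enn2real (g j))" if "j \<in> J" for j using that by (simp add: less_top)
  have "(\<Sum>j\<in>J. g j) = ennreal (\<Sum>j\<in>J. enn2real (g j))" using sum_ennreal[of J "\<lambda>j. enn2real (g j)"] g by (simp cong: sum.cong)
  then have "enn_powr (\<Sum>j\<in>J. g j) p = ennreal ((\<Sum>j\<in>J. enn2real (g j)) powr p)" by (simp add: enn_powr_ennreal sum_nonneg)
  also have "\<dots> \<le> ennreal ((\<Sum>j\<in>J. b j) powr (p - 1) * (\<Sum>j\<in>J. b j powr (1 - p) * enn2real (g j) powr p))"
    by (intro ennreal_leI powr_sum_le p b J) simp
  also have "\<dots> = ennreal ((\<Sum>j\<in>J. b j) powr (p - 1)) * (\<Sum>j\<in>J. ennreal (b j powr (1 - p)) * ennreal (enn2real (g j) powr p))"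
    by (simp add: ennreal_mult sum_nonneg sum_ennreal[symmetric] del: sum_ennreal)
  also have "(\<Sum>j\<in>J. ennreal (b j powr (1 - p)) * ennreal (enn2real (g j) powr p)) = (\<Sum>j\<in>J. ennreal (b j powr (1 - p)) * enn_powr (g j) p)"
    using False by (intro sum.cong) (auto simp: enn_powr_def)
  finally show ?thesis .
qed

text \<open>With weights \<open>b j / suminf b\<close>, this is convexity of \<open>t powr p\<close> applied to \<open>g j / b j\<close>.\<close>
theorem nn_integral_Minkowski_suminf:
  fixes b :: "nat \<Rightarrow> real" and g :: "nat \<Rightarrow> 'a \<Rightarrow> ennreal"
  assumes p: "1 \<le> p" and b: "\<And>j. 0 < b j" "summable b"
    and [measurable]: "\<And>j. g j \<in> borel_measurable M"
    and g: "\<And>j. (\<integral>\<^sup>+x. enn_powr (g j x) p \<partial>M) \<le> ennreal (b j powr p)"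
  shows "(\<integral>\<^sup>+x. enn_powr (\<Sum>j. g j x) p \<partial>M) \<le> ennreal (suminf b powr p)"
proof -
  have partial: "(\<integral>\<^sup>+x. enn_powr (\<Sum>j<J. g j x) p \<partial>M) \<le> ennreal (suminf b powr p)" for J
  proof (cases "J = 0")
    case False
    define S where "S = (\<Sum>j<J. b j)"
    have S: "S > 0" unfolding S_def using False b by (intro sum_pos) auto
    have "(\<integral>\<^sup>+x. enn_powr (\<Sum>j<J. g j x) p \<partial>M) \<le>
        (\<integral>\<^sup>+x. ennreal (S powr (p - 1)) * (\<Sum>j<J. ennreal (b j powr (1 - p)) * enn_powr (g j x) p) \<partial>M)"
      unfolding S_def by (intro nn_integral_mono enn_powr_sum_le p b) auto
    also have "\<dots> = ennreal (S powr (p - 1)) * (\<Sum>j<J. ennreal (b j powr (1 - p)) * (\<integral>\<^sup>+x. enn_powr (g j x) p \<partial>M))"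
      by (simp add: nn_integral_cmult nn_integral_sum)
    also have "\<dots> \<le> ennreal (S powr (p - 1)) * (\<Sum>j<J. ennreal (b j powr (1 - p)) * ennreal (b j powr p))"
      by (intro mult_left_mono sum_mono g) auto
    \<comment> \<open>This is where the choice of weights pays off: b^(1-p) b^p = b, so the weighted
      sum collapses to S.\<close>
    also have "\<dots> = ennreal (S powr (p - 1)) * (\<Sum>j<J. ennreal (b j))"
      using b(1) by (simp add: ennreal_mult[symmetric] powr_add[symmetric] less_imp_le)
    also have "\<dots> = ennreal (S powr p)"
      using S b(1) by (simp add: S_def[symmetric] less_imp_le sum_ennreal ennreal_mult[symmetric] powr_diff)
    also have "\<dots> \<le> ennreal (suminf b powr p)"
      unfolding S_def using b p by (intro ennreal_leI powr_mono2 sum_le_suminf sum_nonneg) (auto simp: less_imp_le)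
    finally show ?thesis .
  qed simp
  have "(\<integral>\<^sup>+x. enn_powr (\<Sum>j. g j x) p \<partial>M) = (\<integral>\<^sup>+x. (SUP J. enn_powr (\<Sum>j<J. g j x) p) \<partial>M)"
    using p by (simp add: suminf_eq_SUP enn_powr_SUP)
  also have "\<dots> = (SUP J. \<integral>\<^sup>+x. enn_powr (\<Sum>j<J. g j x) p \<partial>M)"
    using p by (intro nn_integral_monotone_convergence_SUP)
      (auto simp: incseq_def le_fun_def intro!: enn_powr_mono sum_mono2)
  also have "\<dots> \<le> ennreal (suminf b powr p)" by (intro SUP_least partial)
  finally show ?thesis .
qed

text \<open>Young's inequality for u / \<alpha> and v / \<beta>. The scales stay free so that
  Hoelder's inequality can insert the two norms.\<close>

lemma ennreal_Young:
  fixes u v :: ennreal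
  assumes p: "1 < (p::real)" "1 < q" "1 / p + 1 / q = 1" and al: "0 < \<alpha>" and be: "0 < \<beta>"
  shows "u * v \<le> ennreal (\<alpha> * \<beta>) * (ennreal (1 / q / \<alpha> powr q) * enn_powr u q + ennreal (1 / p / \<beta> powr p) * enn_powr v p)"
proof (cases "u = \<top> \<or> v = \<top>")
  case True
  have "ennreal (1 / q / \<alpha> powr q) \<noteq> 0" "ennreal (1 / p / \<beta> powr p) \<noteq> 0" "ennreal (\<alpha> * \<beta>) \<noteq> 0" using p al be by auto
  then show ?thesis using True by (auto simp: ennreal_mult_top)
next
  case False
  then obtain a b where ab: "u = ennreal a" "v = ennreal b" "0 \<le> a" "0 \<le> b" by (cases u; cases v) auto
  have "(a / \<alpha>) * (b / \<beta>) \<le> (a / \<alpha>) powr q / q + (b / \<beta>) powr p / p"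
    using p ab al be by (intro Youngs_inequality) auto
  then have "a * b \<le> (\<alpha> * \<beta>) * ((1 / q / \<alpha> powr q) * a powr q + (1 / p / \<beta> powr p) * b powr p)"
    using al be ab p by (simp add: powr_divide field_simps)
  then have "ennreal (a * b) \<le> ennreal ((\<alpha> * \<beta>) * ((1 / q / \<alpha> powr q) * a powr q + (1 / p / \<beta> powr p) * b powr p))"
    by (rule ennreal_leI)
  also have "\<dots> = ennreal (\<alpha> * \<beta>) * (ennreal (1 / q / \<alpha> powr q) * ennreal (a powr q) + ennreal (1 / p / \<beta> powr p) * ennreal (b powr p))"
    using p al be by (simp only: ennreal_mult ennreal_plus mult_nonneg_nonneg add_nonneg_nonneg divide_nonneg_nonneg powr_ge_zero less_imp_le zero_le_one less_trans[OF zero_less_one])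
  finally show ?thesis using ab by (simp add: enn_powr_ennreal ennreal_mult)
qed

text \<open>Stated as an inequality of p-th powers because the exponent p / q then falls on the
  integral of u^q exactly as in the definition of \<open>in_Ap\<close>.\<close>

theorem nn_integral_Hoelder:
  fixes u v :: "'a \<Rightarrow> ennreal"
  assumes p: "1 < (p::real)" "1 < q" "1 / p + 1 / q = 1"
    and [measurable]: "u \<in> borel_measurable M" "v \<in> borel_measurable M"
  shows "enn_powr (\<integral>\<^sup>+x. u x * v x \<partial>M) p \<le>
    enn_powr (\<integral>\<^sup>+x. enn_powr (u x) q \<partial>M) (p / q) * (\<integral>\<^sup>+x. enn_powr (v x) p \<partial>M)"
proof -
  define A where "A = (\<integral>\<^sup>+x. enn_powr (u x) q \<partial>M)"
  define B where "B = (\<integral>\<^sup>+x. enn_powr (v x) p \<partial>M)"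
  consider "A = 0 \<or> B = 0" | "A \<noteq> 0" "B \<noteq> 0" "A = \<top> \<or> B = \<top>" | "A \<noteq> 0" "B \<noteq> 0" "A \<noteq> \<top>" "B \<noteq> \<top>" by blast
  then have "enn_powr (\<integral>\<^sup>+x. u x * v x \<partial>M) p \<le> enn_powr A (p / q) * B"
  proof cases
    case 1
    then have "(AE x in M. u x = 0) \<or> (AE x in M. v x = 0)"
      unfolding A_def B_def by (auto simp: nn_integral_0_iff_AE)
    then have "AE x in M. u x * v x = 0" by auto
    then show ?thesis by (simp add: nn_integral_0_iff_AE[THEN iffD2])
  next
    case 2
    then show ?thesis by (auto simp: ennreal_mult_top ennreal_top_mult)
  next
    case 3
    then obtain a b where ab: "A = ennreal a" "B = ennreal b" "0 < a" "0 < b"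
      by (cases A; cases B) (auto simp: less_le)
    \<comment> \<open>These are the norms of u and v. With them the integral of the right side of
      Young's inequality is \<alpha> \<beta> (1 / q + 1 / p) = \<alpha> \<beta>.\<close>
    define \<alpha> \<beta> where "\<alpha> = a powr (1 / q)" and "\<beta> = b powr (1 / p)"
    have pos: "\<alpha> > 0" "\<beta> > 0" using ab by (auto simp: \<alpha>_def \<beta>_def)
    have "(\<integral>\<^sup>+x. u x * v x \<partial>M) \<le> (\<integral>\<^sup>+x. ennreal (\<alpha> * \<beta>) *
        (ennreal (1 / q / \<alpha> powr q) * enn_powr (u x) q + ennreal (1 / p / \<beta> powr p) * enn_powr (v x) p) \<partial>M)"
      by (intro nn_integral_mono ennreal_Young p pos)
    also have "\<dots> = ennreal (\<alpha> * \<beta>) * (ennreal (1 / q / \<alpha> powr q) * A + ennreal (1 / p / \<beta> powr p) * B)"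
      by (simp add: nn_integral_cmult nn_integral_add A_def B_def)
    also have "\<dots> = ennreal (\<alpha> * \<beta>) * (ennreal (1 / q) + ennreal (1 / p))"
      using ab p by (simp add: \<alpha>_def \<beta>_def powr_powr ennreal_mult[symmetric])
    also have "\<dots> = ennreal (\<alpha> * \<beta>)" using p by (simp add: ennreal_plus[symmetric] add.commute del: ennreal_plus)
    finally have "enn_powr (\<integral>\<^sup>+x. u x * v x \<partial>M) p \<le> enn_powr (ennreal (\<alpha> * \<beta>)) p"
      using p by (intro enn_powr_mono) auto
    also have "\<dots> = enn_powr A (p / q) * B"
    proof -
      have "(\<alpha> * \<beta>) powr p = a powr (p / q) * b" using ab p by (simp add: powr_mult \<alpha>_def \<beta>_def powr_powr)
      then show ?thesis using ab pos by (simp add: enn_powr_ennreal ennreal_mult[symmetric])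
    qed
    finally show ?thesis .
  qed
  then show ?thesis by (simp add: A_def B_def)
qed

section \<open>Smooth and Schwartz functions\<close>

lemma finite_multi_indices: "finite {\<alpha>::'n::finite list. length \<alpha> \<le> n}"
  using finite_lists_length_le[of "UNIV::'n set" n] by simp

lemma pderivs_append: "pderivs (\<alpha> @ \<beta>) f = pderivs \<alpha> (pderivs \<beta> f)"
  by (induction \<alpha>) auto

lemma partial_deriv_eq:
  assumes "(f has_derivative f') (at x)" shows "partial_deriv i f x = f' (axis i 1)"
  using frechet_derivative_at[OF assms] by (simp add: partial_deriv_def)

lemma partial_deriv_const: "partial_deriv i (\<lambda>_. c) = (\<lambda>_. 0)"
  by (rule ext) (simp add: partial_deriv_eq[OF has_derivative_const])

lemma partial_deriv_add:
  assumes "\<And>x. f differentiable at x" "\<And>x. g differentiable at x"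
  shows "partial_deriv i (\<lambda>x. f x + g x) = (\<lambda>x. partial_deriv i f x + partial_deriv i g x)"
proof
  fix x
  from assms obtain f' g' where fg: "(f has_derivative f') (at x)" "(g has_derivative g') (at x)"
    unfolding differentiable_def by blast
  show "partial_deriv i (\<lambda>x. f x + g x) x = partial_deriv i f x + partial_deriv i g x"
    by (simp add: partial_deriv_eq[OF has_derivative_add[OF fg]] partial_deriv_eq[OF fg(1)] partial_deriv_eq[OF fg(2)])
qed

lemma partial_deriv_mult:
  fixes f g :: "real^'n \<Rightarrow> complex"
  assumes "\<And>x. f differentiable at x" "\<And>x. g differentiable at x"
  shows "partial_deriv i (\<lambda>x. f x * g x) = (\<lambda>x. partial_deriv i f x * g x + f x * partial_deriv i g x)"
proof
  fix x
  from assms obtain f' g' where fg: "(f has_derivative f') (at x)" "(g has_derivative g') (at x)"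
    unfolding differentiable_def by blast
  show "partial_deriv i (\<lambda>x. f x * g x) x = partial_deriv i f x * g x + f x * partial_deriv i g x"
    by (simp add: partial_deriv_eq[OF has_derivative_mult[OF fg]] partial_deriv_eq[OF fg(1)] partial_deriv_eq[OF fg(2)])
qed

text \<open>Counting the order turns closure of smoothness under sums and products into an
  induction: a derivative of a product is a sum of products of functions with one order less to
  spare.\<close>

definition differentiable_upto :: "nat \<Rightarrow> (real^'n \<Rightarrow> complex) \<Rightarrow> bool" where
  "differentiable_upto k f \<longleftrightarrow> (\<forall>\<alpha> x. length \<alpha> \<le> k \<longrightarrow> pderivs \<alpha> f differentiable at x)"

lemma smooth_iff_differentiable_upto: "smooth f \<longleftrightarrow> (\<forall>k. differentiable_upto k f)"
  by (auto simp: smooth_def differentiable_upto_def)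

lemma differentiable_upto_0: "differentiable_upto 0 f \<longleftrightarrow> (\<forall>x. f differentiable at x)"
  by (simp add: differentiable_upto_def)

text \<open>\<open>pderivs\<close> recurses on the derivative applied last, whereas this
  characterization removes the one applied first; hence the list is split at its end.\<close>

lemma differentiable_upto_Suc:
  "differentiable_upto (Suc k) f \<longleftrightarrow> (\<forall>x. f differentiable at x) \<and> (\<forall>i. differentiable_upto k (partial_deriv i f))"
proof
  assume L: "differentiable_upto (Suc k) f"
  have "pderivs \<alpha> (partial_deriv i f) differentiable at x" if "length \<alpha> \<le> k" for \<alpha> i x
    using L[unfolded differentiable_upto_def, rule_format, of "\<alpha> @ [i]" x] that by (simp add: pderivs_append)
  moreover have "f differentiable at x" for x
    using L[unfolded differentiable_upto_def, rule_format, of "[]" x] by simp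
  ultimately show "(\<forall>x. f differentiable at x) \<and> (\<forall>i. differentiable_upto k (partial_deriv i f))"
    by (auto simp: differentiable_upto_def)
next
  assume R: "(\<forall>x. f differentiable at x) \<and> (\<forall>i. differentiable_upto k (partial_deriv i f))"
  show "differentiable_upto (Suc k) f"
    unfolding differentiable_upto_def
  proof (intro allI impI)
    fix \<alpha> :: "'a list" and x assume "length \<alpha> \<le> Suc k"
    then show "pderivs \<alpha> f differentiable at x"
      using R by (cases \<alpha> rule: rev_cases) (auto simp: pderivs_append differentiable_upto_def)
  qed
qed

lemma differentiable_upto_mono: "differentiable_upto k f \<Longrightarrow> l \<le> k \<Longrightarrow> differentiable_upto l f"
  by (auto simp: differentiable_upto_def)

lemma differentiable_upto_add:
  "differentiable_upto k f \<Longrightarrow> differentiable_upto k g \<Longrightarrow> differentiable_upto k (\<lambda>x. f x + g x)"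
proof (induction k arbitrary: f g)
  case (Suc k)
  then show ?case by (auto simp: differentiable_upto_Suc partial_deriv_add)
qed (auto simp: differentiable_upto_0)

lemma differentiable_upto_mult:
  "differentiable_upto k f \<Longrightarrow> differentiable_upto k g \<Longrightarrow> differentiable_upto k (\<lambda>x. f x * g x)"
proof (induction k arbitrary: f g)
  case (Suc k)
  then have "differentiable_upto k f" "differentiable_upto k g" by (auto elim: differentiable_upto_mono)
  with Suc show ?case
    by (auto simp: differentiable_upto_Suc partial_deriv_mult intro!: differentiable_upto_add differentiable_mult)
qed (auto simp: differentiable_upto_0 intro!: differentiable_mult)

lemma smooth_differentiable: "smooth f \<Longrightarrow> f differentiable at x"
  using smooth_def[of f] pderivs.simps(1) by metis

lemma smooth_iff: "smooth f \<longleftrightarrow> (\<forall>x. f differentiable at x) \<and> (\<forall>i. smooth (partial_deriv i f))"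
proof -
  have "smooth f \<longleftrightarrow> (\<forall>k. differentiable_upto (Suc k) f)"
    unfolding smooth_iff_differentiable_upto using differentiable_upto_mono by (meson le_SucI order_refl)
  then show ?thesis by (auto simp: differentiable_upto_Suc smooth_iff_differentiable_upto)
qed

lemma smooth_partial_deriv: "smooth f \<Longrightarrow> smooth (partial_deriv i f)"
  using smooth_iff by blast

lemma smooth_pderivs: "smooth f \<Longrightarrow> smooth (pderivs \<alpha> f)"
  by (induction \<alpha>) (auto intro: smooth_partial_deriv)

lemma smooth_add: "smooth f \<Longrightarrow> smooth g \<Longrightarrow> smooth (\<lambda>x. f x + g x)"
  by (auto simp: smooth_iff_differentiable_upto differentiable_upto_add)

lemma smooth_mult: "smooth f \<Longrightarrow> smooth g \<Longrightarrow> smooth (\<lambda>x. f x * g x)"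
  by (auto simp: smooth_iff_differentiable_upto differentiable_upto_mult)

lemma smooth_const: "smooth (\<lambda>_::real^'n. c)"
proof -
  have "differentiable_upto k (\<lambda>_::real^'n. c)" for k c
    by (induction k arbitrary: c) (auto simp: differentiable_upto_0 differentiable_upto_Suc partial_deriv_const)
  then show ?thesis by (simp add: smooth_iff_differentiable_upto)
qed

lemma smooth_sum: "(\<And>k. k \<in> F \<Longrightarrow> smooth (f k)) \<Longrightarrow> smooth (\<lambda>x. \<Sum>k\<in>F. f k x)"
  by (induction F rule: infinite_finite_induct) (auto intro: smooth_const smooth_add)

lemma pderivs_add:
  "smooth f \<Longrightarrow> smooth g \<Longrightarrow> pderivs \<alpha> (\<lambda>x. f x + g x) = (\<lambda>x. pderivs \<alpha> f x + pderivs \<alpha> g x)"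
  by (induction \<alpha>) (auto simp: partial_deriv_add smooth_def)

lemma pderivs_const: "pderivs \<alpha> (\<lambda>_. c) = (\<lambda>_. if \<alpha> = [] then c else 0)"
proof (induction \<alpha>)
  case (Cons i \<alpha>)
  then show ?case by (simp add: partial_deriv_const)
qed simp

lemma pderivs_cmult: "smooth f \<Longrightarrow> pderivs \<alpha> (\<lambda>x. c * f x) = (\<lambda>x. c * pderivs \<alpha> f x)"
  by (induction \<alpha>) (auto simp: partial_deriv_mult partial_deriv_const smooth_def)

lemma pderivs_sum:
  "(\<And>k. k \<in> F \<Longrightarrow> smooth (f k)) \<Longrightarrow> pderivs \<alpha> (\<lambda>x. \<Sum>k\<in>F. f k x) = (\<lambda>x. \<Sum>k\<in>F. pderivs \<alpha> (f k) x)"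
  by (induction F rule: infinite_finite_induct) (auto simp: pderivs_const pderivs_add smooth_sum)

text \<open>A crude Leibniz rule: each differentiation doubles the number of terms, and every term
  is at most a * b. The induction removes the derivative applied first, so that the product rule
  acts on f and g themselves.\<close>

lemma norm_pderivs_mult_le:
  assumes "smooth f" "smooth g"
    and "\<And>\<beta>. length \<beta> \<le> n \<Longrightarrow> norm (pderivs \<beta> f x) \<le> a" "\<And>\<beta>. length \<beta> \<le> n \<Longrightarrow> norm (pderivs \<beta> g x) \<le> b"
    and "length \<alpha> \<le> n"
  shows "norm (pderivs \<alpha> (\<lambda>x. f x * g x) x) \<le> 2 ^ length \<alpha> * (a * b)"
  using assms
proof (induction \<alpha> arbitrary: f g n rule: rev_induct)
  case Nil
  have "0 \<le> a" using order_trans[OF norm_ge_zero Nil(3)[of "[]"]] by simp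
  then show ?case using Nil(3)[of "[]"] Nil(4)[of "[]"] by (auto simp: norm_mult intro!: mult_mono)
next
  case (snoc i \<alpha>)
  from snoc.prems(5) obtain m where n: "n = Suc m" "length \<alpha> \<le> m" by (cases n) auto
  note sf = snoc.prems(1) and sg = snoc.prems(2)
  have f1: "norm (pderivs \<beta> (partial_deriv i f) x) \<le> a" if "length \<beta> \<le> m" for \<beta>
    using snoc.prems(3)[of "\<beta> @ [i]"] that n by (simp add: pderivs_append)
  have g1: "norm (pderivs \<beta> (partial_deriv i g) x) \<le> b" if "length \<beta> \<le> m" for \<beta>
    using snoc.prems(4)[of "\<beta> @ [i]"] that n by (simp add: pderivs_append)
  have f0: "norm (pderivs \<beta> f x) \<le> a" if "length \<beta> \<le> m" for \<beta> using snoc.prems(3)[of \<beta>] that n by simp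
  have g0: "norm (pderivs \<beta> g x) \<le> b" if "length \<beta> \<le> m" for \<beta> using snoc.prems(4)[of \<beta>] that n by simp
  have "pderivs (\<alpha> @ [i]) (\<lambda>x. f x * g x) x =
      pderivs \<alpha> (\<lambda>x. partial_deriv i f x * g x) x + pderivs \<alpha> (\<lambda>x. f x * partial_deriv i g x) x"
    using sf sg by (simp add: pderivs_append partial_deriv_mult smooth_differentiable pderivs_add smooth_mult smooth_partial_deriv)
  also have "norm \<dots> \<le> 2 ^ length \<alpha> * (a * b) + 2 ^ length \<alpha> * (a * b)"
    by (intro norm_triangle_le add_mono snoc.IH[of _ _ m] sf sg smooth_partial_deriv f0 f1 g0 g1 n(2))
  finally show ?case by (simp add: mult_ac)
qed

text \<open>Derivatives are local. This passes from the support of a function to the supports of all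
  its derivatives.\<close>

lemma pderivs_eq_0_on_open:
  assumes "open U" "x \<in> U" "\<And>y. y \<in> U \<Longrightarrow> f y = 0"
  shows "pderivs \<alpha> f x = 0"
  using assms(2)
proof (induction \<alpha> arbitrary: x)
  case (Cons i \<alpha>)
  have "(pderivs \<alpha> f has_derivative (\<lambda>_. 0)) (at x)"
    by (rule has_derivative_transform_within_open[OF has_derivative_const assms(1) Cons.prems]) (simp add: Cons.IH)
  then show ?case by (simp add: partial_deriv_eq)
qed (use assms(3) in auto)

lemma smooth_continuous_on: "smooth f \<Longrightarrow> continuous_on S f"
  by (meson continuous_at_imp_continuous_on differentiable_imp_continuous_within smooth_differentiable)

lemma smooth_borel_measurable: "smooth f \<Longrightarrow> f \<in> borel_measurable borel"
  by (intro borel_measurable_continuous_onI smooth_continuous_on)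

lemma borel_imp_lebesgue_measurable: "f \<in> borel_measurable borel \<Longrightarrow> f \<in> borel_measurable lebesgue"
  by (rule measurable_completion) simp

section \<open>The Schwartz space and its multipliers\<close>

lemma schwartz_smooth: "f \<in> schwartz \<Longrightarrow> smooth f"
  by (simp add: schwartz_def)

lemma schwartz_bound:
  assumes "f \<in> schwartz" shows "\<exists>C\<ge>0. \<forall>x. (1 + norm x) ^ N * norm (pderivs \<alpha> f x) \<le> C"
proof -
  have "bounded (range (\<lambda>x. (1 + norm x) ^ N *\<^sub>R pderivs \<alpha> f x))" using assms by (simp add: schwartz_def)
  then obtain C where "\<And>x. norm ((1 + norm x) ^ N *\<^sub>R pderivs \<alpha> f x) \<le> C" by (auto simp: bounded_iff)
  then show ?thesis by (intro exI[of _ "max C 0"]) (auto simp: le_max_iff_disj)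
qed

lemma schwartzI:
  assumes "smooth f" "\<And>\<alpha> N. \<exists>C. \<forall>x. (1 + norm x) ^ N * norm (pderivs \<alpha> f x) \<le> C"
  shows "f \<in> schwartz"
  unfolding schwartz_def using assms by (auto simp: bounded_iff)

lemma schwartz_bound_upto:
  fixes f :: "real^'n \<Rightarrow> complex"
  assumes "f \<in> schwartz" shows "\<exists>C\<ge>0. \<forall>x \<alpha>. length \<alpha> \<le> n \<longrightarrow> (1 + norm x) ^ N * norm (pderivs \<alpha> f x) \<le> C"
proof -
  from schwartz_bound[OF assms] obtain C where C: "\<And>\<alpha>. C \<alpha> \<ge> 0" "\<And>\<alpha> x. (1 + norm x) ^ N * norm (pderivs \<alpha> f x) \<le> C \<alpha>" by metis
  have fin: "finite {\<alpha>::'n list. length \<alpha> \<le> n}" by (rule finite_multi_indices)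
  have "C \<alpha> \<le> (\<Sum>\<alpha>\<in>{\<alpha>. length \<alpha> \<le> n}. C \<alpha>)" if "length \<alpha> \<le> n" for \<alpha>
    using that C fin by (intro member_le_sum) auto
  then have "(1 + norm x) ^ N * norm (pderivs \<alpha> f x) \<le> (\<Sum>\<alpha>\<in>{\<alpha>. length \<alpha> \<le> n}. C \<alpha>)" if "length \<alpha> \<le> n" for x \<alpha>
    using C(2)[of x \<alpha>] that by (meson order_trans)
  then show ?thesis using C(1) by (intro exI[of _ "\<Sum>\<alpha>\<in>{\<alpha>. length \<alpha> \<le> n}. C \<alpha>"]) (auto intro: sum_nonneg)
qed

text \<open>A class of multipliers of the Schwartz space; the instances used are constants,
  coordinates, characters and smooth functions with all derivatives bounded.\<close>

definition slowly_increasing :: "(real^'n \<Rightarrow> complex) \<Rightarrow> bool" where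
  "slowly_increasing f \<longleftrightarrow> smooth f \<and> (\<forall>n. \<exists>C N. \<forall>\<alpha> x. length \<alpha> \<le> n \<longrightarrow> norm (pderivs \<alpha> f x) \<le> C * (1 + norm x) ^ N)"

lemma schwartz_mult:
  assumes f: "slowly_increasing f" and g: "g \<in> schwartz"
  shows "(\<lambda>x. f x * g x) \<in> schwartz"
proof (rule schwartzI)
  have sf: "smooth f" and sg: "smooth g" using f g by (auto simp: slowly_increasing_def schwartz_smooth)
  then show "smooth (\<lambda>x. f x * g x)" by (rule smooth_mult)
  fix \<alpha> :: "'a list" and N
  from f obtain C M where C: "\<And>\<beta> x. length \<beta> \<le> length \<alpha> \<Longrightarrow> norm (pderivs \<beta> f x) \<le> C * (1 + norm x) ^ M"
    unfolding slowly_increasing_def by blast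
  \<comment> \<open>The M additional powers of decay of g pay for the growth of the derivatives of
    f.\<close>
  from schwartz_bound_upto[OF g, of "length \<alpha>" "N + M"] obtain D where D:
    "\<And>x \<beta>. length \<beta> \<le> length \<alpha> \<Longrightarrow> (1 + norm x) ^ (N + M) * norm (pderivs \<beta> g x) \<le> D" by auto
  have "(1 + norm x) ^ N * norm (pderivs \<alpha> (\<lambda>x. f x * g x) x) \<le> 2 ^ length \<alpha> * (C * D)" for x
  proof -
    have pos: "1 + norm x > 0" by (simp add: add_pos_nonneg)
    have "norm (pderivs \<alpha> (\<lambda>x. f x * g x) x) \<le> 2 ^ length \<alpha> * ((C * (1 + norm x) ^ M) * (D / (1 + norm x) ^ (N + M)))"
      using C D pos by (intro norm_pderivs_mult_le[of f g "length \<alpha>"] sf sg) (auto simp: le_divide_eq mult.commute)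
    also have "\<dots> = 2 ^ length \<alpha> * (C * D) / (1 + norm x) ^ N"
      using pos by (simp add: power_add)
    finally show ?thesis using pos by (simp add: le_divide_eq mult.commute)
  qed
  then show "\<exists>C. \<forall>x. (1 + norm x) ^ N * norm (pderivs \<alpha> (\<lambda>x. f x * g x) x) \<le> C" by blast
qed

lemma schwartz_add: "f \<in> schwartz \<Longrightarrow> g \<in> schwartz \<Longrightarrow> (\<lambda>x. f x + g x) \<in> schwartz"
proof (rule schwartzI)
  assume f: "f \<in> schwartz" and g: "g \<in> schwartz"
  then show "smooth (\<lambda>x. f x + g x)" by (auto intro: smooth_add schwartz_smooth)
  fix \<alpha> :: "'a list" and N
  from schwartz_bound[OF f, of N \<alpha>] schwartz_bound[OF g, of N \<alpha>] obtain C D where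
    *: "\<And>x. (1 + norm x) ^ N * norm (pderivs \<alpha> f x) \<le> C" "\<And>x. (1 + norm x) ^ N * norm (pderivs \<alpha> g x) \<le> D" by auto
  have "(1 + norm x) ^ N * norm (pderivs \<alpha> (\<lambda>x. f x + g x) x) \<le> C + D" for x
  proof -
    have "(1 + norm x) ^ N * norm (pderivs \<alpha> (\<lambda>x. f x + g x) x) \<le> (1 + norm x) ^ N * (norm (pderivs \<alpha> f x) + norm (pderivs \<alpha> g x))"
      by (simp add: pderivs_add schwartz_smooth f g norm_triangle_ineq mult_left_mono)
    also have "\<dots> \<le> C + D" using *[of x] by (simp add: distrib_left)
    finally show ?thesis .
  qed
  then show "\<exists>C. \<forall>x. (1 + norm x) ^ N * norm (pderivs \<alpha> (\<lambda>x. f x + g x) x) \<le> C" by blast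
qed

lemma slowly_increasing_const: "slowly_increasing (\<lambda>_. c)"
  unfolding slowly_increasing_def
proof (intro conjI allI smooth_const exI)
  fix n \<alpha> and x :: "real^'a"
  show "length \<alpha> \<le> n \<longrightarrow> norm (pderivs \<alpha> (\<lambda>_. c) x) \<le> norm c * (1 + norm x) ^ 0"
    by (simp add: pderivs_const)
qed

lemma schwartz_cmult: "f \<in> schwartz \<Longrightarrow> (\<lambda>x. c * f x) \<in> schwartz"
  by (rule schwartz_mult[OF slowly_increasing_const])

lemma schwartz_partial_deriv: "f \<in> schwartz \<Longrightarrow> partial_deriv i f \<in> schwartz"
proof (rule schwartzI)
  assume f: "f \<in> schwartz"
  then show "smooth (partial_deriv i f)" by (intro smooth_partial_deriv schwartz_smooth)
  fix \<alpha> N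
  show "\<exists>C. \<forall>x. (1 + norm x) ^ N * norm (pderivs \<alpha> (partial_deriv i f) x) \<le> C"
    using schwartz_bound[OF f, of N "\<alpha> @ [i]"] by (auto simp: pderivs_append)
qed

lemma schwartz_pderivs: "f \<in> schwartz \<Longrightarrow> pderivs \<alpha> f \<in> schwartz"
  by (induction \<alpha>) (auto intro: schwartz_partial_deriv)

lemma schwartz_sum: "(\<And>k. k \<in> F \<Longrightarrow> f k \<in> schwartz) \<Longrightarrow> (\<lambda>x. \<Sum>k\<in>F. f k x) \<in> schwartz"
proof (induction F rule: infinite_finite_induct)
  have 0: "(\<lambda>_. 0) \<in> schwartz" by (rule schwartzI) (auto simp: smooth_const pderivs_const)
  case (infinite F) then show ?case using 0 by simp
next
  have 0: "(\<lambda>_. 0) \<in> schwartz" by (rule schwartzI) (auto simp: smooth_const pderivs_const)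
  case empty show ?case using 0 by simp
next
  case (insert x F)
  then show ?case by (auto intro: schwartz_add)
qed

lemma has_derivative_coordinate: "((\<lambda>x. complex_of_real (x $ i)) has_derivative (\<lambda>v. complex_of_real (v $ i))) (at x)"
  by (intro bounded_linear_imp_has_derivative bounded_linear_compose[OF bounded_linear_of_real bounded_linear_vec_nth])

lemma partial_deriv_coordinate: "partial_deriv j (\<lambda>x. complex_of_real (x $ i)) = (\<lambda>_. if i = j then 1 else 0)"
  by (rule ext) (simp add: partial_deriv_eq[OF has_derivative_coordinate] axis_def)

lemma pderivs_coordinate:
  "pderivs \<alpha> (\<lambda>x. complex_of_real (x $ i)) =
    (if \<alpha> = [] then (\<lambda>x. complex_of_real (x $ i)) else (\<lambda>_. if \<alpha> = [i] then 1 else 0))"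
proof (induction \<alpha>)
  case (Cons j \<alpha>)
  then show ?case by (simp add: partial_deriv_coordinate partial_deriv_const)
qed simp

lemma slowly_increasing_coordinate: "slowly_increasing (\<lambda>x. complex_of_real (x $ i))"
  unfolding slowly_increasing_def
proof (intro conjI allI exI)
  show "smooth (\<lambda>x. complex_of_real (x $ i))"
    unfolding smooth_def pderivs_coordinate using has_derivative_coordinate
    by (auto simp: differentiable_def intro: has_derivative_const)
  fix n \<alpha> and x :: "real^'a"
  have "\<bar>x $ i\<bar> \<le> 1 + norm x" using component_le_norm_cart[of x i] by simp
  then show "length \<alpha> \<le> n \<longrightarrow> norm (pderivs \<alpha> (\<lambda>x. complex_of_real (x $ i)) x) \<le> 1 * (1 + norm x) ^ 1"
    by (simp add: pderivs_coordinate)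
qed

lemma has_derivative_character:
  "((\<lambda>x. cis (s * (x \<bullet> \<xi>))) has_derivative (\<lambda>v. (\<i> * of_real s * of_real (v \<bullet> \<xi>)) * cis (s * (x \<bullet> \<xi>)))) (at x)"
proof -
  have "((\<lambda>x. exp (\<i> * of_real (s * (x \<bullet> \<xi>)))) has_derivative
      (\<lambda>v. (\<i> * of_real (s * (v \<bullet> \<xi>))) * exp (\<i> * of_real (s * (x \<bullet> \<xi>))))) (at x)"
  proof -
    have "((\<lambda>x. \<i> * of_real (s * (x \<bullet> \<xi>))) has_derivative (\<lambda>v. \<i> * of_real (s * (v \<bullet> \<xi>)))) (at x)"
      by (intro bounded_linear_imp_has_derivative bounded_linear_mult_right[THEN bounded_linear_compose]
          bounded_linear_of_real[THEN bounded_linear_compose] bounded_linear_inner_left)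
    from has_derivative_compose[OF this DERIV_exp[unfolded has_field_derivative_def]] show ?thesis
      by (simp add: mult.commute)
  qed
  then show ?thesis by (simp add: cis_conv_exp mult.assoc)
qed

lemma pderivs_character:
  fixes \<xi> :: "real^'n"
  shows "pderivs \<alpha> (\<lambda>x. cis (s * (x \<bullet> \<xi>))) = (\<lambda>x. (\<Prod>i\<leftarrow>\<alpha>. \<i> * of_real s * of_real (\<xi> $ i)) * cis (s * (x \<bullet> \<xi>)))"
proof (induction \<alpha>)
  case (Cons i \<alpha>)
  show ?case
  proof
    fix x
    show "pderivs (i # \<alpha>) (\<lambda>x. cis (s * (x \<bullet> \<xi>))) x = (\<Prod>i\<leftarrow>i # \<alpha>. \<i> * of_real s * of_real (\<xi> $ i)) * cis (s * (x \<bullet> \<xi>))"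
      unfolding pderivs.simps Cons.IH
      by (subst partial_deriv_eq[OF has_derivative_mult_right[OF has_derivative_character]])
        (simp add: inner_axis' mult_ac)
  qed
qed simp

lemma slowly_increasing_character:
  fixes \<xi> :: "real^'n"
  shows "slowly_increasing (\<lambda>x. cis (s * (x \<bullet> \<xi>)))"
  unfolding slowly_increasing_def
proof (intro conjI allI)
  have "(\<lambda>x. c * cis (s * (x \<bullet> \<xi>))) differentiable at x" for c x
    using has_derivative_mult_right[OF has_derivative_character] unfolding differentiable_def by blast
  then show "smooth (\<lambda>x. cis (s * (x \<bullet> \<xi>)))" unfolding smooth_def pderivs_character by auto
  fix n
  have fin: "finite {\<alpha>::'n list. length \<alpha> \<le> n}" by (rule finite_multi_indices)
  let ?C = "\<Sum>\<alpha>\<in>{\<alpha>::'n list. length \<alpha> \<le> n}. norm (\<Prod>i\<leftarrow>\<alpha>. \<i> * of_real s * of_real (\<xi> $ i))"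
  have "norm (pderivs \<alpha> (\<lambda>x. cis (s * (x \<bullet> \<xi>))) x) \<le> ?C * (1 + norm x) ^ 0" if "length \<alpha> \<le> n" for \<alpha> x
    unfolding pderivs_character using fin that
    by (auto simp: norm_mult intro!: member_le_sum[of \<alpha> _ "\<lambda>\<alpha>. norm (\<Prod>i\<leftarrow>\<alpha>. \<i> * of_real s * of_real (\<xi> $ i))"])
  then show "\<exists>C N. \<forall>\<alpha> x. length \<alpha> \<le> n \<longrightarrow> norm (pderivs \<alpha> (\<lambda>x. cis (s * (x \<bullet> \<xi>))) x) \<le> C * (1 + norm x) ^ N" by blast
qed

section \<open>Fourier integrals of Schwartz functions\<close>

lemma lebesgue_integral_lborel: "f \<in> borel_measurable borel \<Longrightarrow> integral\<^sup>L lebesgue f = integral\<^sup>L lborel f"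
  for f :: "'a::euclidean_space \<Rightarrow> 'b::{banach, second_countable_topology}"
  by (rule integral_completion) simp

lemma lebesgue_integrable_lborel: "f \<in> borel_measurable borel \<Longrightarrow> integrable lebesgue f \<longleftrightarrow> integrable lborel f"
  for f :: "'a::euclidean_space \<Rightarrow> 'b::{banach, second_countable_topology}"
  by (rule integrable_completion) simp

text \<open>(1 + |x|)^2 dominates 1 + x_b^2 for each of the n coordinates x_b, so (1 + |x|)^(2n)
  dominates their product, and the integral factors into one-dimensional integrals of 1 / (1 + t^2).
  This is the origin of the exponent 2n.\<close>

lemma integrable_inverse_power_norm:
  "integrable lebesgue (\<lambda>x::real^'n. 1 / (1 + norm x) ^ (2 * CARD('n)))"
proof -
  have "set_integrable lborel UNIV (\<lambda>x::real. inverse (1 + x\<^sup>2))"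
    using integrable_inverse_1_plus_square by (simp add: einterval_eq_UNIV)
  then have I: "integrable lborel (\<lambda>x::real. inverse (1 + x\<^sup>2))" by (simp add: set_integrable_def)
  have "(\<integral>\<^sup>+x. ennreal (1 / (1 + norm x) ^ (2 * CARD('n))) \<partial>(lborel :: (real^'n) measure)) \<le>
      (\<integral>\<^sup>+x. (\<Prod>b\<in>Basis. ennreal (inverse (1 + (x \<bullet> b)\<^sup>2))) \<partial>(lborel :: (real^'n) measure))"
  proof (rule nn_integral_mono)
    fix x :: "real^'n"
    have "(\<Prod>b\<in>Basis. 1 + (x \<bullet> b)\<^sup>2) \<le> (\<Prod>b\<in>(Basis :: (real^'n) set). (1 + norm x)\<^sup>2)"
    proof (rule prod_mono, safe)
      fix b :: "real^'n" assume "b \<in> Basis"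
      then have "\<bar>x \<bullet> b\<bar> \<le> norm x" by (rule Basis_le_norm)
      then have "(x \<bullet> b)\<^sup>2 \<le> (norm x)\<^sup>2" by (metis abs_le_square_iff abs_norm_cancel)
      then show "1 + (x \<bullet> b)\<^sup>2 \<le> (1 + norm x)\<^sup>2" by (simp add: power2_sum add_increasing2)
    qed auto
    also have "\<dots> = (1 + norm x) ^ (2 * CARD('n))" by (simp add: power_mult)
    finally have le: "(\<Prod>b\<in>Basis. 1 + (x \<bullet> b)\<^sup>2) \<le> (1 + norm x) ^ (2 * CARD('n))" .
    have pos: "0 < (\<Prod>b\<in>(Basis :: (real^'n) set). 1 + (x \<bullet> b)\<^sup>2)" by (intro prod_pos) (simp add: add_pos_nonneg)
    have "1 / (1 + norm x) ^ (2 * CARD('n)) \<le> 1 / (\<Prod>b\<in>Basis. 1 + (x \<bullet> b)\<^sup>2)"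
      using le pos by (intro divide_left_mono) (auto intro!: mult_pos_pos zero_less_power add_pos_nonneg)
    also have "\<dots> = (\<Prod>b\<in>Basis. inverse (1 + (x \<bullet> b)\<^sup>2))" by (simp add: prod_inversef[symmetric] divide_inverse comp_def)
    finally show "ennreal (1 / (1 + norm x) ^ (2 * CARD('n))) \<le> (\<Prod>b\<in>Basis. ennreal (inverse (1 + (x \<bullet> b)\<^sup>2)))"
      by (simp add: prod_ennreal ennreal_leI)
  qed
  also have "\<dots> = (\<Prod>b\<in>(Basis :: (real^'n) set). (\<integral>\<^sup>+t. ennreal (inverse (1 + t\<^sup>2)) \<partial>lborel))"
    by (rule nn_integral_lborel_prod) auto
  also have "\<dots> < \<infinity>"
  proof -
    have "(\<integral>\<^sup>+(t::real). ennreal (inverse (1 + t\<^sup>2)) \<partial>lborel) < \<infinity>"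
      using integrableD(2)[OF I] by (simp add: less_top)
    then show ?thesis by (simp add: power_less_top_ennreal)
  qed
  finally have "integrable lborel (\<lambda>x::real^'n. 1 / (1 + norm x) ^ (2 * CARD('n)))"
    by (intro integrableI_bounded) auto
  then show ?thesis by (subst lebesgue_integrable_lborel) auto
qed

lemma schwartz_integrable_power:
  fixes f :: "real^'n \<Rightarrow> complex"
  assumes f: "f \<in> schwartz"
  shows "integrable lebesgue (\<lambda>x. (1 + norm x) ^ N * norm (f x))"
proof -
  from schwartz_bound[OF f, of "N + 2 * CARD('n)" "[]"] obtain C where C:
    "C \<ge> 0" "\<And>x. (1 + norm x) ^ (N + 2 * CARD('n)) * norm (f x) \<le> C" by auto
  have [measurable]: "f \<in> borel_measurable borel" by (rule smooth_borel_measurable[OF schwartz_smooth[OF f]])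
  have m: "(\<lambda>x. (1 + norm x) ^ N * norm (f x)) \<in> borel_measurable lebesgue"
    by (rule borel_imp_lebesgue_measurable) measurable
  show ?thesis
  proof (rule Bochner_Integration.integrable_bound[OF integrable_mult_right[OF integrable_inverse_power_norm, of C] m], rule AE_I2)
    fix x :: "real^'n"
    have pos: "1 + norm x > 0" by (simp add: add_pos_nonneg)
    then have "(1 + norm x) ^ N * norm (f x) \<le> C * (1 / (1 + norm x) ^ (2 * CARD('n)))"
      using C(2)[of x] by (simp add: le_divide_eq power_add mult_ac)
    then show "norm ((1 + norm x) ^ N * norm (f x)) \<le> norm (C * (1 / (1 + norm x) ^ (2 * CARD('n))))"
      using C(1) by (simp add: abs_mult)
  qed
qed

lemma schwartz_borel_measurable: "f \<in> schwartz \<Longrightarrow> f \<in> borel_measurable borel"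
  by (rule smooth_borel_measurable[OF schwartz_smooth])

lemma schwartz_integrable: "f \<in> schwartz \<Longrightarrow> integrable lebesgue f"
  using schwartz_integrable_power[of f 0]
  by (subst integrable_norm_iff[symmetric]) (auto intro: borel_imp_lebesgue_measurable schwartz_borel_measurable)

lemma integral_translate:
  fixes f :: "'a::euclidean_space \<Rightarrow> 'b::{banach, second_countable_topology}"
  assumes [measurable]: "f \<in> borel_measurable borel"
  shows "(LINT x|lebesgue. f (x + v)) = (LINT x|lebesgue. f x)"
    and "integrable lebesgue (\<lambda>x. f (x + v)) \<longleftrightarrow> integrable lebesgue f"
proof -
  have "(LINT x|lborel. f x) = (LINT x|distr lborel borel ((+) v). f x)" by (simp add: lborel_distr_plus)
  also have "\<dots> = (LINT x|lborel. f (v + x))" by (rule integral_distr) auto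
  finally show "(LINT x|lebesgue. f (x + v)) = (LINT x|lebesgue. f x)"
    by (simp add: lebesgue_integral_lborel add.commute)
  have "integrable lborel f \<longleftrightarrow> integrable (distr lborel borel ((+) v)) f" by (simp add: lborel_distr_plus)
  also have "\<dots> \<longleftrightarrow> integrable lborel (\<lambda>x. f (v + x))" by (rule integrable_distr_eq) auto
  finally show "integrable lebesgue (\<lambda>x. f (x + v)) \<longleftrightarrow> integrable lebesgue f"
    by (simp add: lebesgue_integrable_lborel add.commute)
qed

lemma norm_difference_partial_deriv_le:
  fixes h :: "real^'n \<Rightarrow> complex"
  assumes h: "\<And>x. h differentiable at x" and t: "0 \<le> t"
    and B: "\<And>s. 0 \<le> s \<Longrightarrow> s \<le> t \<Longrightarrow> norm (partial_deriv i h (x + s *\<^sub>R axis i 1)) \<le> B"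
  shows "norm (h (x + t *\<^sub>R axis i 1) - h x) \<le> B * t"
proof -
  define g where "g s = h (x + s *\<^sub>R axis i 1)" for s
  have g: "(g has_derivative (\<lambda>v. v *\<^sub>R partial_deriv i h (x + s *\<^sub>R axis i 1))) (at s within {0..t})" for s
  proof -
    obtain D where D: "(h has_derivative D) (at (x + s *\<^sub>R axis i 1))" using h unfolding differentiable_def by blast
    have 1: "((\<lambda>s. x + s *\<^sub>R axis i (1::real)) has_derivative (\<lambda>v. v *\<^sub>R axis i 1)) (at s within {0..t})"
      by (auto intro!: derivative_eq_intros)
    have "(g has_derivative (\<lambda>v. D (v *\<^sub>R axis i 1))) (at s within {0..t})"
      unfolding g_def by (rule has_derivative_compose[OF 1 D])
    then show ?thesis
      using linear_scale[OF bounded_linear.linear[OF has_derivative_bounded_linear[OF D]]]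
      by (simp add: partial_deriv_eq[OF D])
  qed
  have "norm (g t - g 0) \<le> B * norm (t - 0)"
  proof (rule differentiable_bound[OF _ g])
    fix s assume "s \<in> {0..t}"
    then show "onorm (\<lambda>v. v *\<^sub>R partial_deriv i h (x + s *\<^sub>R axis i 1)) \<le> B"
      using B[of s] by (intro onorm_le) (simp add: mult.commute[of B] mult_left_mono)
  qed (use t in auto)
  then show ?thesis using t by (simp add: g_def)
qed

lemma partial_deriv_quotient_tendsto:
  fixes h :: "real^'n \<Rightarrow> complex"
  assumes h: "h differentiable at x" and X: "X \<longlonglongrightarrow> 0" "\<And>k. X k > 0"
  shows "(\<lambda>k. (h (x + X k *\<^sub>R axis i 1) - h x) / of_real (X k)) \<longlonglongrightarrow> partial_deriv i h x"
proof -
  obtain D where D: "(h has_derivative D) (at x)" using h unfolding differentiable_def by blast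
  let ?e = "axis i (1::real) :: real^'n"
  have Dl: "D (r *\<^sub>R v) = r *\<^sub>R D v" for r v
    using linear_scale[OF bounded_linear.linear[OF has_derivative_bounded_linear[OF D]]] .
  have "((\<lambda>k. norm (h (x + X k *\<^sub>R ?e) - h x - D (X k *\<^sub>R ?e)) / norm (X k *\<^sub>R ?e)) \<longlongrightarrow> 0) sequentially"
  proof -
    have A: "((\<lambda>v. norm (h (x + v) - h x - D v) / norm v) \<longlongrightarrow> 0) (at 0)" using D by (simp add: has_derivative_at)
    have "(\<lambda>k. X k *\<^sub>R ?e) \<longlonglongrightarrow> 0 *\<^sub>R ?e" by (intro tendsto_intros X)
    then have "filterlim (\<lambda>k. X k *\<^sub>R ?e) (at 0) sequentially"
      using X(2) by (auto simp: filterlim_at less_imp_neq[THEN not_sym] axis_eq_0_iff)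
    from filterlim_compose[OF A this] show ?thesis .
  qed
  moreover have "norm (h (x + X k *\<^sub>R ?e) - h x - D (X k *\<^sub>R ?e)) / norm (X k *\<^sub>R ?e) =
      norm ((h (x + X k *\<^sub>R ?e) - h x) / of_real (X k) - D ?e)" for k
  proof -
    have "(h (x + X k *\<^sub>R ?e) - h x) / of_real (X k) - D ?e = (h (x + X k *\<^sub>R ?e) - h x - D (X k *\<^sub>R ?e)) / of_real (X k)"
      using X(2)[of k] by (simp add: Dl diff_divide_distrib scaleR_conv_of_real[where 'a=complex])
    then show ?thesis using X(2)[of k] by (simp add: norm_divide)
  qed
  ultimately have "(\<lambda>k. (h (x + X k *\<^sub>R ?e) - h x) / of_real (X k) - D ?e) \<longlonglongrightarrow> 0"
    by (simp add: tendsto_norm_zero_iff)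
  then show ?thesis by (simp add: LIM_zero_iff partial_deriv_eq[OF D])
qed

text \<open>The integrals of the difference quotients vanish by translation invariance.\<close>
lemma integral_partial_deriv_eq_0:
  fixes h :: "real^'n \<Rightarrow> complex"
  assumes h: "h \<in> schwartz"
  shows "(LINT x|lebesgue. partial_deriv i h x) = 0"
proof -
  let ?e = "axis i (1::real) :: real^'n"
  define X where "X k = 1 / real (Suc k)" for k
  have X: "X \<longlonglongrightarrow> 0" "\<And>k. X k > 0" "\<And>k. X k \<le> 1"
    unfolding X_def using LIMSEQ_inverse_real_of_nat by (auto simp: inverse_eq_divide)
  let ?d = "\<lambda>k x. (h (x + X k *\<^sub>R ?e) - h x) / of_real (X k)"
  let ?N = "2 * CARD('n)"
  from schwartz_bound[OF h, of ?N "[i]"] obtain C where C: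
    "C \<ge> 0" "\<And>x. (1 + norm x) ^ ?N * norm (partial_deriv i h x) \<le> C" by auto
  note hm = schwartz_borel_measurable[OF h]
  have [measurable]: "h \<in> borel_measurable borel" by (rule hm)
  have int: "integrable lebesgue (\<lambda>x. h (x + v))" for v using schwartz_integrable[OF h] by (simp add: integral_translate(2)[OF hm])
  have 0: "(LINT x|lebesgue. ?d k x) = 0" for k
    using int[of 0] int[of "X k *\<^sub>R ?e"] by (simp add: integral_translate(1)[OF hm])
  have "(\<lambda>k. LINT x|lebesgue. ?d k x) \<longlonglongrightarrow> (LINT x|lebesgue. partial_deriv i h x)"
  \<comment> \<open>The steps have length at most 1, and along such a segment 1 + |x| changes by at
    most a factor 2. The decay of the derivative at the nearby points thus gives, with the constant
    \<open>2 ^ ?N\<close>, a majorant independent of k.\<close>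
  proof (rule integral_dominated_convergence[where w = "\<lambda>x. C * 2 ^ ?N * (1 / (1 + norm x) ^ ?N)"])
    show "partial_deriv i h \<in> borel_measurable lebesgue"
      by (intro borel_imp_lebesgue_measurable schwartz_borel_measurable schwartz_partial_deriv h)
    show "?d k \<in> borel_measurable lebesgue" for k
      by (rule borel_imp_lebesgue_measurable) measurable
    show "integrable lebesgue (\<lambda>x::real^'n. C * 2 ^ ?N * (1 / (1 + norm x) ^ ?N))"
      by (intro integrable_mult_right integrable_inverse_power_norm)
    show "AE x in lebesgue. (\<lambda>k. ?d k x) \<longlonglongrightarrow> partial_deriv i h x"
      using X h by (intro AE_I2 partial_deriv_quotient_tendsto smooth_differentiable schwartz_smooth)
    fix k
    have "norm (?d k x) \<le> C * 2 ^ ?N * (1 / (1 + norm x) ^ ?N)" for x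
    proof -
      have "norm (h (x + X k *\<^sub>R ?e) - h x) \<le> (C * 2 ^ ?N * (1 / (1 + norm x) ^ ?N)) * X k"
      proof (rule norm_difference_partial_deriv_le)
        fix s assume s: "0 \<le> s" "s \<le> X k"
        let ?y = "x + s *\<^sub>R ?e"
        have "norm x \<le> norm ?y + norm (s *\<^sub>R ?e)" using norm_triangle_ineq4[of ?y "s *\<^sub>R ?e"] by simp
        also have "\<dots> \<le> norm ?y + 1" using s X(3)[of k] by simp
        also have "\<dots> \<le> 1 + 2 * norm ?y" by simp
        finally have "1 + norm x \<le> 2 * (1 + norm ?y)" by simp
        then have "(1 + norm x) ^ ?N \<le> (2 * (1 + norm ?y)) ^ ?N" by (intro power_mono) auto
        then have "(1 + norm x) ^ ?N * norm (partial_deriv i h ?y) \<le> (2 * (1 + norm ?y)) ^ ?N * norm (partial_deriv i h ?y)"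
          by (intro mult_right_mono) auto
        also have "\<dots> = 2 ^ ?N * ((1 + norm ?y) ^ ?N * norm (partial_deriv i h ?y))"
          unfolding power_mult_distrib by simp
        also have "\<dots> \<le> 2 ^ ?N * C" by (intro mult_left_mono C) auto
        finally show "norm (partial_deriv i h ?y) \<le> C * 2 ^ ?N * (1 / (1 + norm x) ^ ?N)"
          by (simp add: le_divide_eq mult_ac add_pos_nonneg zero_less_power)
      qed (use X h in \<open>auto simp: less_imp_le intro: smooth_differentiable schwartz_smooth\<close>)
      then show ?thesis using X(2)[of k] by (simp add: norm_divide divide_le_eq)
    qed
    then show "AE x in lebesgue. norm (?d k x) \<le> C * 2 ^ ?N * (1 / (1 + norm x) ^ ?N)" by (rule AE_I2)
  qed
  then show ?thesis unfolding 0 by (simp add: LIMSEQ_const_iff)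
qed

text \<open>A common form of both transforms, with s = -1 and s = 1 and without the normalizing
  factor, so that decay and smoothness are proved once.\<close>

definition osc_integral :: "real \<Rightarrow> (real^'n \<Rightarrow> complex) \<Rightarrow> real^'n \<Rightarrow> complex" where
  "osc_integral s f \<xi> = (LINT x|lebesgue. f x * cis (s * (x \<bullet> \<xi>)))"

lemma fourier_eq_osc_integral:
  fixes f :: "real^'n \<Rightarrow> complex"
  shows "fourier f = (\<lambda>\<xi>. complex_of_real ((2 * pi) powr (- real CARD('n) / 2)) * osc_integral (- 1) f \<xi>)"
  by (rule ext) (simp add: fourier_def osc_integral_def)

lemma inv_fourier_eq_osc_integral:
  fixes f :: "real^'n \<Rightarrow> complex"
  shows "inv_fourier f = (\<lambda>\<xi>. complex_of_real ((2 * pi) powr (- real CARD('n) / 2)) * osc_integral 1 f \<xi>)"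
  by (rule ext) (simp add: inv_fourier_def osc_integral_def inner_commute)

lemma schwartz_mult_cis: "f \<in> schwartz \<Longrightarrow> (\<lambda>x. f x * cis (s * (x \<bullet> \<xi>))) \<in> schwartz"
  using schwartz_mult[OF slowly_increasing_character[of s \<xi>], of f] by (simp add: mult.commute)

lemma integrable_mult_cis: "integrable lebesgue f \<Longrightarrow> integrable lebesgue (\<lambda>x. f x * cis (s * (x \<bullet> \<xi>)))"
  for f :: "real^'n \<Rightarrow> complex"
proof (rule Bochner_Integration.integrable_bound)
  assume f: "integrable lebesgue f"
  then show "integrable lebesgue f" .
  from f have [measurable]: "f \<in> borel_measurable lebesgue" by auto
  have "(\<lambda>x. cis (s * (x \<bullet> \<xi>))) \<in> borel_measurable borel"
    by (intro borel_measurable_continuous_onI continuous_intros)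
  then have [measurable]: "(\<lambda>x. cis (s * (x \<bullet> \<xi>))) \<in> borel_measurable lebesgue" by (rule borel_imp_lebesgue_measurable)
  show "(\<lambda>x. f x * cis (s * (x \<bullet> \<xi>))) \<in> borel_measurable lebesgue" by measurable
qed (auto simp: norm_mult)

lemma norm_osc_integral_le: "norm (osc_integral s f \<xi>) \<le> (LINT x|lebesgue. norm (f x))"
  unfolding osc_integral_def by (rule order_trans[OF integral_norm_bound]) (simp add: norm_mult)

lemma osc_integral_add:
  "integrable lebesgue f \<Longrightarrow> integrable lebesgue g \<Longrightarrow> osc_integral s (\<lambda>x. f x + g x) \<xi> = osc_integral s f \<xi> + osc_integral s g \<xi>"
  unfolding osc_integral_def by (simp add: distrib_right integrable_mult_cis)

lemma osc_integral_cmult: "osc_integral s (\<lambda>x. c * f x) \<xi> = c * osc_integral s f \<xi>"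
  unfolding osc_integral_def by (simp add: mult.assoc)

lemma osc_integral_sum:
  "(\<And>k. k \<in> F \<Longrightarrow> integrable lebesgue (f k)) \<Longrightarrow> osc_integral s (\<lambda>x. \<Sum>k\<in>F. f k x) \<xi> = (\<Sum>k\<in>F. osc_integral s (f k) \<xi>)"
  unfolding osc_integral_def by (simp add: sum_distrib_right integrable_mult_cis)

text \<open>Integration by parts: the derivative of the product of h with a character has integral
  0.\<close>

lemma osc_integral_partial_deriv:
  assumes h: "h \<in> schwartz"
  shows "osc_integral s (partial_deriv i h) \<xi> = - (\<i> * of_real s * of_real (\<xi> $ i)) * osc_integral s h \<xi>"
proof -
  have "partial_deriv i (\<lambda>x. cis (s * (x \<bullet> \<xi>))) = (\<lambda>x. (\<i> * of_real s * of_real (\<xi> $ i)) * cis (s * (x \<bullet> \<xi>)))"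
    using pderivs_character[of "[i]" s \<xi>] by simp
  moreover have "smooth (\<lambda>x. cis (s * (x \<bullet> \<xi>)))" using slowly_increasing_character unfolding slowly_increasing_def by blast
  ultimately have "partial_deriv i (\<lambda>x. h x * cis (s * (x \<bullet> \<xi>))) =
      (\<lambda>x. partial_deriv i h x * cis (s * (x \<bullet> \<xi>)) + (\<i> * of_real s * of_real (\<xi> $ i)) * (h x * cis (s * (x \<bullet> \<xi>))))"
    using schwartz_smooth[OF h] by (simp add: partial_deriv_mult smooth_differentiable mult_ac)
  with integral_partial_deriv_eq_0[OF schwartz_mult_cis[OF h, of s \<xi>], of i]
  have "0 = (LINT x|lebesgue. partial_deriv i h x * cis (s * (x \<bullet> \<xi>)) + (\<i> * of_real s * of_real (\<xi> $ i)) * (h x * cis (s * (x \<bullet> \<xi>))))"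
    by simp
  also have "\<dots> = osc_integral s (partial_deriv i h) \<xi> + (\<i> * of_real s * of_real (\<xi> $ i)) * osc_integral s h \<xi>"
    unfolding osc_integral_def
    by (subst Bochner_Integration.integral_add)
      (auto intro!: schwartz_cmult schwartz_mult_cis schwartz_integrable h schwartz_partial_deriv)
  finally show ?thesis by (simp add: eq_neg_iff_add_eq_0)
qed

lemma osc_integral_partial_deriv_power:
  assumes h: "h \<in> schwartz"
  shows "osc_integral s (pderivs (replicate N i) h) \<xi> = (- (\<i> * of_real s * of_real (\<xi> $ i))) ^ N * osc_integral s h \<xi>"
proof (induction N)
  case (Suc N)
  then show ?case by (simp add: osc_integral_partial_deriv schwartz_pderivs h)
qed simp

text \<open>Integration by parts yields powers of single coordinates; this combines them into a
  power of 1 + |\<xi>|. If M is the largest modulus of a coordinate, then 1 + |\<xi>| is at most (n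
  + 1) times the maximum of 1 and M.\<close>

lemma one_plus_norm_power_le:
  fixes \<xi> :: "real^'n"
  shows "(1 + norm \<xi>) ^ N \<le> (real CARD('n) + 1) ^ N * (1 + (\<Sum>i\<in>UNIV. \<bar>\<xi> $ i\<bar> ^ N))"
proof -
  define M where "M = Max (range (\<lambda>i. \<bar>\<xi> $ i\<bar>))"
  have le: "\<bar>\<xi> $ i\<bar> \<le> M" for i unfolding M_def by (rule Max_ge) auto
  have "M \<in> range (\<lambda>i. \<bar>\<xi> $ i\<bar>)" unfolding M_def by (rule Max_in) auto
  then obtain j where j: "M = \<bar>\<xi> $ j\<bar>" by blast
  have "norm \<xi> \<le> (\<Sum>i\<in>UNIV. \<bar>\<xi> $ i\<bar>)" by (rule norm_le_l1_cart)
  also have "\<dots> \<le> real CARD('n) * M" using sum_bounded_above[of UNIV "\<lambda>i. \<bar>\<xi> $ i\<bar>" M] le by simp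
  finally have "1 + norm \<xi> \<le> 1 + real CARD('n) * M" by simp
  also have "\<dots> \<le> max 1 M + real CARD('n) * max 1 M" by (intro add_mono mult_left_mono) auto
  also have "\<dots> = (real CARD('n) + 1) * max 1 M" by (simp add: algebra_simps)
  finally have "(1 + norm \<xi>) ^ N \<le> ((real CARD('n) + 1) * max 1 M) ^ N" by (intro power_mono) auto
  also have "\<dots> = (real CARD('n) + 1) ^ N * max 1 M ^ N" by (rule power_mult_distrib)
  also have "max 1 M ^ N \<le> 1 + M ^ N" using j by (auto simp: max_def)
  also have "M ^ N \<le> (\<Sum>i\<in>UNIV. \<bar>\<xi> $ i\<bar> ^ N)" unfolding j by (rule member_le_sum) auto
  finally show ?thesis by (simp add: mult_left_mono)
qed

text \<open>The constant is kept explicit, as a sum of L^1 norms of h and its derivatives: it will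
  have to tend to 0 along a sequence of functions, and to be bounded uniformly over a whole
  \<open>Y_family\<close>.\<close>

lemma osc_integral_decay:
  fixes h :: "real^'n \<Rightarrow> complex"
  assumes h: "h \<in> schwartz" and s: "\<bar>s\<bar> = 1"
  shows "(1 + norm \<xi>) ^ N * norm (osc_integral s h \<xi>) \<le> (real CARD('n) + 1) ^ N *
    ((LINT x|lebesgue. norm (h x)) + (\<Sum>i\<in>UNIV. LINT x|lebesgue. norm (pderivs (replicate N i) h x)))"
proof -
  have i: "\<bar>\<xi> $ i\<bar> ^ N * norm (osc_integral s h \<xi>) \<le> (LINT x|lebesgue. norm (pderivs (replicate N i) h x))" for i
  proof -
    have "\<bar>\<xi> $ i\<bar> ^ N * norm (osc_integral s h \<xi>) = norm (osc_integral s (pderivs (replicate N i) h) \<xi>)"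
      unfolding osc_integral_partial_deriv_power[OF h] using s by (simp add: norm_mult norm_power)
    also have "\<dots> \<le> (LINT x|lebesgue. norm (pderivs (replicate N i) h x))" by (rule norm_osc_integral_le)
    finally show ?thesis .
  qed
  have "(1 + norm \<xi>) ^ N * norm (osc_integral s h \<xi>) \<le>
      ((real CARD('n) + 1) ^ N * (1 + (\<Sum>i\<in>UNIV. \<bar>\<xi> $ i\<bar> ^ N))) * norm (osc_integral s h \<xi>)"
    by (intro mult_right_mono one_plus_norm_power_le) auto
  also have "\<dots> = (real CARD('n) + 1) ^ N * (norm (osc_integral s h \<xi>) + (\<Sum>i\<in>UNIV. \<bar>\<xi> $ i\<bar> ^ N * norm (osc_integral s h \<xi>)))"
    by (simp add: distrib_left distrib_right sum_distrib_right mult.assoc)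
  also have "\<dots> \<le> (real CARD('n) + 1) ^ N *
    ((LINT x|lebesgue. norm (h x)) + (\<Sum>i\<in>UNIV. LINT x|lebesgue. norm (pderivs (replicate N i) h x)))"
    by (intro mult_left_mono add_mono sum_mono i norm_osc_integral_le) auto
  finally show ?thesis .
qed

text \<open>Under \<open>osc_integral s\<close>, multiplication by the monomial of \<i> s x is the
  counterpart of differentiation of the transform.\<close>

fun monomial_mult :: "real \<Rightarrow> 'n list \<Rightarrow> (real^'n \<Rightarrow> complex) \<Rightarrow> real^'n \<Rightarrow> complex" where
  "monomial_mult s [] h = h"
| "monomial_mult s (i # \<alpha>) h = (\<lambda>x. (\<i> * of_real s) * (of_real (x $ i) * monomial_mult s \<alpha> h x))"

lemma schwartz_monomial_mult: "h \<in> schwartz \<Longrightarrow> monomial_mult s \<alpha> h \<in> schwartz"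
  by (induction \<alpha>) (auto intro!: schwartz_cmult schwartz_mult[OF slowly_increasing_coordinate])

lemma monomial_mult_mult: "monomial_mult s \<alpha> (\<lambda>x. f x * h x) = (\<lambda>x. f x * monomial_mult s \<alpha> h x)"
  by (induction \<alpha>) (auto simp: mult_ac)

text \<open>The first-order Taylor remainder of the character is at most s^2 / 2 * |x|^2 |y -
  \<xi>|^2. Since h absorbs the factor |x|^2, the remainder of the integral is quadratic in |y -
  \<xi>|.\<close>

lemma osc_integral_has_derivative:
  fixes h :: "real^'n \<Rightarrow> complex"
  assumes h: "h \<in> schwartz"
  shows "(osc_integral s h has_derivative (\<lambda>v. \<Sum>i\<in>UNIV. of_real (v $ i) * osc_integral s (monomial_mult s [i] h) \<xi>)) (at \<xi>)"
proof (rule has_derivativeI_sandwich[of 1])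
  let ?D = "\<lambda>v. \<Sum>i\<in>UNIV. of_real (v $ i) * osc_integral s (monomial_mult s [i] h) \<xi>"
  show "bounded_linear ?D"
    by (intro bounded_linear_sum bounded_linear_mult_left[THEN bounded_linear_compose]
        bounded_linear_of_real[THEN bounded_linear_compose] bounded_linear_vec_nth)
  define C where "C = s\<^sup>2 / 2 * (LINT x|lebesgue. (1 + norm x) ^ 2 * norm (h x))"
  fix y assume "y \<noteq> \<xi>"
  have hi: "integrable lebesgue h" by (rule schwartz_integrable[OF h])
  define R where "R x = cis (s * (x \<bullet> y)) - cis (s * (x \<bullet> \<xi>)) - \<i> * of_real s * of_real (x \<bullet> (y - \<xi>)) * cis (s * (x \<bullet> \<xi>))" for x
  have R: "norm (R x) \<le> s\<^sup>2 / 2 * (1 + norm x)\<^sup>2 * (norm (y - \<xi>))\<^sup>2" for x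
  proof -
    let ?t = "s * (x \<bullet> (y - \<xi>))"
    have "R x = cis (s * (x \<bullet> \<xi>)) * (cis ?t - 1 - \<i> * of_real ?t)"
      by (simp add: R_def algebra_simps cis_mult inner_diff_right)
    then have "norm (R x) = norm (cis ?t - 1 - \<i> * of_real ?t)" by (simp add: norm_mult)
    also have "\<dots> \<le> \<bar>?t\<bar>\<^sup>2 / 2"
      using iexp_approx1[of ?t 1] by (simp add: cis_conv_exp numeral_2_eq_2 algebra_simps)
    also have "\<dots> = s\<^sup>2 / 2 * \<bar>x \<bullet> (y - \<xi>)\<bar>\<^sup>2" by (simp add: power_mult_distrib)
    also have "\<dots> \<le> s\<^sup>2 / 2 * (norm x * norm (y - \<xi>))\<^sup>2"
      by (intro mult_left_mono power_mono Cauchy_Schwarz_ineq2) auto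
    also have "\<dots> \<le> s\<^sup>2 / 2 * ((1 + norm x) * norm (y - \<xi>))\<^sup>2"
      by (intro mult_left_mono power_mono mult_right_mono) auto
    finally show ?thesis by (simp add: power_mult_distrib mult.assoc)
  qed
  have "?D (y - \<xi>) = (\<Sum>i\<in>UNIV. LINT x|lebesgue. of_real ((y - \<xi>) $ i) * (monomial_mult s [i] h x * cis (s * (x \<bullet> \<xi>))))"
    unfolding osc_integral_def by simp
  also have "\<dots> = (LINT x|lebesgue. (\<Sum>i\<in>UNIV. of_real ((y - \<xi>) $ i) * (monomial_mult s [i] h x * cis (s * (x \<bullet> \<xi>)))))"
    by (intro Bochner_Integration.integral_sum[symmetric] integrable_mult_right integrable_mult_cis schwartz_integrable schwartz_monomial_mult h)
  also have "\<dots> = (LINT x|lebesgue. h x * (\<i> * of_real s * of_real (x \<bullet> (y - \<xi>)) * cis (s * (x \<bullet> \<xi>))))"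
    by (intro Bochner_Integration.integral_cong refl) (simp add: inner_vec_def sum_distrib_left sum_distrib_right mult_ac)
  finally have D: "?D (y - \<xi>) = (LINT x|lebesgue. h x * (\<i> * of_real s * of_real (x \<bullet> (y - \<xi>)) * cis (s * (x \<bullet> \<xi>))))" .
  have Dint: "integrable lebesgue (\<lambda>x. h x * (\<i> * of_real s * of_real (x \<bullet> (y - \<xi>)) * cis (s * (x \<bullet> \<xi>))))"
  proof -
    have "integrable lebesgue (\<lambda>x. (\<Sum>i\<in>UNIV. of_real ((y - \<xi>) $ i) * (monomial_mult s [i] h x * cis (s * (x \<bullet> \<xi>)))))"
      by (intro Bochner_Integration.integrable_sum integrable_mult_right integrable_mult_cis schwartz_integrable schwartz_monomial_mult h)
    also have "(\<lambda>x. (\<Sum>i\<in>UNIV. of_real ((y - \<xi>) $ i) * (monomial_mult s [i] h x * cis (s * (x \<bullet> \<xi>))))) =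
        (\<lambda>x. h x * (\<i> * of_real s * of_real (x \<bullet> (y - \<xi>)) * cis (s * (x \<bullet> \<xi>))))"
      by (rule ext) (simp add: inner_vec_def sum_distrib_left sum_distrib_right mult_ac)
    finally show ?thesis .
  qed
  have eq: "osc_integral s h y - osc_integral s h \<xi> - ?D (y - \<xi>) = (LINT x|lebesgue. h x * R x)"
    unfolding D unfolding osc_integral_def R_def
    using integrable_mult_cis[OF hi, of s y] integrable_mult_cis[OF hi, of s \<xi>] Dint
    by (simp add: right_diff_distrib)
  have Rint: "integrable lebesgue (\<lambda>x. h x * R x)"
    unfolding R_def using integrable_mult_cis[OF hi, of s y] integrable_mult_cis[OF hi, of s \<xi>] Dint
    by (simp add: right_diff_distrib)
  have "norm (LINT x|lebesgue. h x * R x) \<le> (LINT x|lebesgue. norm (h x * R x))" by (rule integral_norm_bound)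
  also have "\<dots> \<le> (LINT x|lebesgue. (s\<^sup>2 / 2 * (norm (y - \<xi>))\<^sup>2) * ((1 + norm x)\<^sup>2 * norm (h x)))"
  proof (rule integral_mono)
    show "integrable lebesgue (\<lambda>x. norm (h x * R x))" using Rint by (rule integrable_norm)
    show "integrable lebesgue (\<lambda>x. (s\<^sup>2 / 2 * (norm (y - \<xi>))\<^sup>2) * ((1 + norm x)\<^sup>2 * norm (h x)))"
      by (intro integrable_mult_right schwartz_integrable_power h)
    show "norm (h x * R x) \<le> (s\<^sup>2 / 2 * (norm (y - \<xi>))\<^sup>2) * ((1 + norm x)\<^sup>2 * norm (h x))" for x
      using mult_left_mono[OF R[of x], of "norm (h x)"] by (simp add: norm_mult mult_ac)
  qed
  also have "\<dots> = C * (norm (y - \<xi>))\<^sup>2" by (simp add: C_def)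
  finally show "norm (osc_integral s h y - osc_integral s h \<xi> - ?D (y - \<xi>)) / norm (y - \<xi>) \<le> C * norm (y - \<xi>)"
    unfolding eq using \<open>y \<noteq> \<xi>\<close> by (simp add: divide_le_eq power2_eq_square mult.assoc)
next
  show "((\<lambda>y. s\<^sup>2 / 2 * (LINT x|lebesgue. (1 + norm x) ^ 2 * norm (h x)) * norm (y - \<xi>)) \<longlongrightarrow> 0) (at \<xi>)"
    by (intro tendsto_eq_intros refl) auto
qed simp

lemma partial_deriv_osc_integral:
  assumes h: "h \<in> schwartz"
  shows "partial_deriv i (osc_integral s h) = osc_integral s (monomial_mult s [i] h)"
proof
  fix \<xi>
  have "partial_deriv i (osc_integral s h) \<xi> = (\<Sum>j\<in>UNIV. if j = i then osc_integral s (monomial_mult s [j] h) \<xi> else 0)"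
    unfolding partial_deriv_eq[OF osc_integral_has_derivative[OF h]] by (intro sum.cong) (auto simp: axis_def)
  then show "partial_deriv i (osc_integral s h) \<xi> = osc_integral s (monomial_mult s [i] h) \<xi>" by simp
qed

lemma pderivs_osc_integral: "h \<in> schwartz \<Longrightarrow> pderivs \<alpha> (osc_integral s h) = osc_integral s (monomial_mult s \<alpha> h)"
  by (induction \<alpha>) (simp_all add: partial_deriv_osc_integral schwartz_monomial_mult)

lemma schwartz_osc_integral:
  assumes h: "h \<in> schwartz" and s: "\<bar>s\<bar> = 1"
  shows "osc_integral s h \<in> schwartz"
proof (rule schwartzI)
  show "smooth (osc_integral s h)"
    unfolding smooth_def pderivs_osc_integral[OF h] using osc_integral_has_derivative[OF schwartz_monomial_mult[OF h]]
    unfolding differentiable_def by blast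
  show "\<exists>C. \<forall>x. (1 + norm x) ^ N * norm (pderivs \<alpha> (osc_integral s h) x) \<le> C" for \<alpha> N
    unfolding pderivs_osc_integral[OF h] using osc_integral_decay[OF schwartz_monomial_mult[OF h] s] by blast
qed

lemma schwartz_fourier: "h \<in> schwartz \<Longrightarrow> fourier h \<in> schwartz"
  unfolding fourier_eq_osc_integral by (intro schwartz_cmult schwartz_osc_integral) auto

lemma schwartz_inv_fourier: "h \<in> schwartz \<Longrightarrow> inv_fourier h \<in> schwartz"
  unfolding inv_fourier_eq_osc_integral by (intro schwartz_cmult schwartz_osc_integral) auto

section \<open>Fourier inversion\<close>

text \<open>Fubini's theorem is applied to Bochner integrals of kernels dominated by a product.
  Oscillating factors have modulus 1, and for convolutions \<open>peetre_inverse_power\<close>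
  separates the variables.\<close>

lemma (in pair_sigma_finite) integrable_pair_bound:
  fixes h :: "'a \<times> 'b \<Rightarrow> 'c::{banach, second_countable_topology}"
  assumes [measurable]: "h \<in> borel_measurable (M1 \<Otimes>\<^sub>M M2)" and f: "integrable M1 f" and g: "integrable M2 g"
    and le: "\<And>x y. norm (h (x, y)) \<le> f x * g y" and nonneg: "\<And>x. 0 \<le> f x" "\<And>y. 0 \<le> (g y :: real)"
  shows "integrable (M1 \<Otimes>\<^sub>M M2) h"
proof (rule integrableI_bounded)
  note [measurable] = borel_measurable_integrable[OF f] borel_measurable_integrable[OF g]
  have "(\<integral>\<^sup>+z. ennreal (norm (h z)) \<partial>(M1 \<Otimes>\<^sub>M M2)) = (\<integral>\<^sup>+x. \<integral>\<^sup>+y. ennreal (norm (h (x, y))) \<partial>M2 \<partial>M1)"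
    by (rule M2.nn_integral_fst[symmetric]) measurable
  also have "\<dots> \<le> (\<integral>\<^sup>+x. \<integral>\<^sup>+y. ennreal (f x) * ennreal (g y) \<partial>M2 \<partial>M1)"
    using le nonneg by (intro nn_integral_mono) (simp add: ennreal_mult[symmetric] ennreal_leI)
  also have "\<dots> = (\<integral>\<^sup>+x. ennreal (f x) \<partial>M1) * (\<integral>\<^sup>+y. ennreal (g y) \<partial>M2)"
    by (simp add: nn_integral_cmult nn_integral_multc)
  also have "\<dots> < \<infinity>"
    using integrableD(2)[OF f] integrableD(2)[OF g] nonneg by (simp add: ennreal_mult_less_top less_top)
  finally show "(\<integral>\<^sup>+z. ennreal (norm (h z)) \<partial>(M1 \<Otimes>\<^sub>M M2)) < \<infinity>" .
qed simp

text \<open>The product of the two Lebesgue \<sigma>-algebras contains the Borel sets of the product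
  space. Kernels depending on x - y become measurable in the pair in this way.\<close>

lemma lebesgue_pair_borel_measurable:
  fixes f :: "'a::euclidean_space \<times> 'b::euclidean_space \<Rightarrow> 'c::topological_space"
  assumes "f \<in> borel_measurable borel"
  shows "f \<in> borel_measurable (lebesgue \<Otimes>\<^sub>M lebesgue)"
proof -
  have id: "(\<lambda>x::'d::euclidean_space. x) \<in> measurable lebesgue borel" by (rule measurable_completion) simp
  have "(\<lambda>z::'a \<times> 'b. (fst z, snd z)) \<in> measurable (lebesgue \<Otimes>\<^sub>M lebesgue) (borel \<Otimes>\<^sub>M borel)"
    by (intro measurable_Pair measurable_compose[OF measurable_fst id] measurable_compose[OF measurable_snd id])
  then have "(\<lambda>z::'a \<times> 'b. z) \<in> measurable (lebesgue \<Otimes>\<^sub>M lebesgue) borel" by (simp add: borel_prod)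
  from measurable_compose[OF this assms] show ?thesis .
qed

lemma integral_affine:
  fixes f :: "real^'n \<Rightarrow> 'b::{banach, second_countable_topology}"
  assumes [measurable]: "f \<in> borel_measurable borel" and c: "0 < c"
  shows "(LINT x|lebesgue. f (t + c *\<^sub>R x)) = (1 / c ^ CARD('n)) *\<^sub>R (LINT x|lebesgue. f x)"
    and "integrable lebesgue f \<Longrightarrow> integrable lebesgue (\<lambda>x. f (t + c *\<^sub>R x))"
proof -
  have eq: "lborel = density (distr lborel borel (\<lambda>x::real^'n. t + c *\<^sub>R x)) (\<lambda>_. ennreal (c ^ CARD('n)))"
    using lborel_affine[of c t] c by (simp add: ennreal_power)
  have "(LINT x|lborel. f x) = (LINT x|distr lborel borel (\<lambda>x::real^'n. t + c *\<^sub>R x). (c ^ CARD('n)) *\<^sub>R f x)"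
    using c by (subst eq, subst integral_density) auto
  also have "\<dots> = (LINT x|lborel. (c ^ CARD('n)) *\<^sub>R f (t + c *\<^sub>R x))" by (rule integral_distr) auto
  also have "\<dots> = (c ^ CARD('n)) *\<^sub>R (LINT x|lborel. f (t + c *\<^sub>R x))" by simp
  finally show "(LINT x|lebesgue. f (t + c *\<^sub>R x)) = (1 / c ^ CARD('n)) *\<^sub>R (LINT x|lebesgue. f x)"
    using c by (simp add: lebesgue_integral_lborel)
  have "integrable lborel f \<longleftrightarrow> integrable (distr lborel borel (\<lambda>x::real^'n. t + c *\<^sub>R x)) (\<lambda>x. (c ^ CARD('n)) *\<^sub>R f x)"
    using c by (subst eq, subst integrable_density) auto
  also have "\<dots> \<longleftrightarrow> integrable lborel (\<lambda>x. (c ^ CARD('n)) *\<^sub>R f (t + c *\<^sub>R x))" by (rule integrable_distr_eq) auto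
  finally have iff: "integrable lborel f \<longleftrightarrow> integrable lborel (\<lambda>x. (c ^ CARD('n)) *\<^sub>R f (t + c *\<^sub>R x))" .
  show "integrable lebesgue (\<lambda>x. f (t + c *\<^sub>R x))" if "integrable lebesgue f"
  proof -
    from that have "integrable lborel (\<lambda>x. (c ^ CARD('n)) *\<^sub>R f (t + c *\<^sub>R x))"
      unfolding iff[symmetric] by (simp add: lebesgue_integrable_lborel)
    from integrable_scaleR_right[OF this, of "1 / c ^ CARD('n)"] show ?thesis
      using c by (simp add: lebesgue_integrable_lborel)
  qed
qed

lemma integral_lborel_prod:
  fixes g :: "'a::euclidean_space \<Rightarrow> real \<Rightarrow> complex"
  assumes "\<And>b. b \<in> Basis \<Longrightarrow> integrable lborel (g b)"
  shows "(LINT x|lborel. (\<Prod>b\<in>Basis. g b (x \<bullet> b))) = (\<Prod>b\<in>Basis. LINT t|lborel. g b t)"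
    and "integrable lborel (\<lambda>x. \<Prod>b\<in>Basis. g b (x \<bullet> b))"
proof -
  interpret product_sigma_finite "\<lambda>_::'a. lborel :: real measure" ..
  have [measurable]: "g b \<in> borel_measurable borel" if "b \<in> Basis" for b
    using borel_measurable_integrable[OF assms[OF that]] by simp
  have m: "(\<lambda>f. \<Sum>b\<in>Basis. f b *\<^sub>R b) \<in> measurable (\<Pi>\<^sub>M b\<in>Basis. lborel) (borel :: 'a measure)" by measurable
  have p: "(\<lambda>x::'a. \<Prod>b\<in>Basis. g b (x \<bullet> b)) \<in> borel_measurable borel" by measurable
  have "(LINT x|lborel. (\<Prod>b\<in>Basis. g b (x \<bullet> b))) =
      (LINT f|(\<Pi>\<^sub>M b\<in>Basis. lborel). (\<Prod>b\<in>Basis. g b ((\<Sum>b\<in>Basis. f b *\<^sub>R b) \<bullet> b)))"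
    by (subst lborel_eq, subst integral_distr[OF m p]) simp
  also have "\<dots> = (LINT f|(\<Pi>\<^sub>M b\<in>Basis. lborel). (\<Prod>b\<in>Basis. g b (f b)))" by simp
  also have "\<dots> = (\<Prod>b\<in>Basis. LINT t|lborel. g b t)" by (rule product_integral_prod) (auto intro: assms)
  finally show "(LINT x|lborel. (\<Prod>b\<in>Basis. g b (x \<bullet> b))) = (\<Prod>b\<in>Basis. LINT t|lborel. g b t)" .
  have "integrable (\<Pi>\<^sub>M b\<in>Basis. lborel) (\<lambda>f. \<Prod>b\<in>Basis. g b (f b))" by (rule product_integrable_prod) (auto intro: assms)
  then show "integrable lborel (\<lambda>x. \<Prod>b\<in>Basis. g b (x \<bullet> b))"
    by (subst lborel_eq, subst integrable_distr_eq[OF m p]) simp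
qed

text \<open>The characteristic function of the standard normal distribution, multiplied by sqrt (2
  \<pi>).\<close>

lemma gaussian_char_real:
  "integrable lborel (\<lambda>x. exp (- of_real (x\<^sup>2 / 2)) * cis (t * x))"
  "(LINT x|lborel. exp (- of_real (x\<^sup>2 / 2)) * cis (t * x)) = of_real (sqrt (2 * pi) * exp (- t\<^sup>2 / 2))"
proof -
  have e: "std_normal_density x *\<^sub>R iexp (t * x) = (1 / sqrt (2 * pi)) *\<^sub>R (exp (- of_real (x\<^sup>2 / 2)) * cis (t * x))" for x
    by (simp add: std_normal_density_def cis_conv_exp scaleR_conv_of_real exp_of_real[symmetric] exp_minus)
  have N: "integrable lborel std_normal_density" by simp
  have I: "integrable lborel (\<lambda>x. std_normal_density x *\<^sub>R iexp (t * x))"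
  proof (rule Bochner_Integration.integrable_bound[OF N])
    show "(\<lambda>x. std_normal_density x *\<^sub>R iexp (t * x)) \<in> borel_measurable lborel" by measurable
  qed simp
  then have I': "integrable lborel (\<lambda>x. (1 / sqrt (2 * pi)) *\<^sub>R (exp (- of_real (x\<^sup>2 / 2)) * cis (t * x)))" unfolding e .
  from integrable_scaleR_right[OF this, of "sqrt (2 * pi)"]
  show int: "integrable lborel (\<lambda>x. exp (- of_real (x\<^sup>2 / 2)) * cis (t * x))" by simp
  have "complex_of_real (exp (- t\<^sup>2 / 2)) = (LINT x|std_normal_distribution. iexp (t * x))"
    using fun_cong[OF char_std_normal_distribution, of t] by (simp add: char_def)
  also have "\<dots> = (LINT x|lborel. std_normal_density x *\<^sub>R iexp (t * x))"
    by (rule integral_density) (auto simp: normal_density_nonneg)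
  also have "\<dots> = (1 / sqrt (2 * pi)) *\<^sub>R (LINT x|lborel. exp (- of_real (x\<^sup>2 / 2)) * cis (t * x))" unfolding e by simp
  finally show "(LINT x|lborel. exp (- of_real (x\<^sup>2 / 2)) * cis (t * x)) = of_real (sqrt (2 * pi) * exp (- t\<^sup>2 / 2))"
    by (simp add: scaleR_conv_of_real field_simps)
qed

text \<open>The Gaussian and the character both factor over the coordinates.\<close>

lemma gaussian_char:
  fixes z :: "real^'n"
  shows "integrable lebesgue (\<lambda>x. complex_of_real (exp (- (norm x)\<^sup>2 / 2)) * cis (x \<bullet> z))"
    and "(LINT x|lebesgue. complex_of_real (exp (- (norm x)\<^sup>2 / 2)) * cis (x \<bullet> z)) =
      of_real ((2 * pi) powr (real CARD('n) / 2) * exp (- (norm z)\<^sup>2 / 2))"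
proof -
  let ?g = "\<lambda>b::real^'n. \<lambda>t. exp (- complex_of_real (t\<^sup>2 / 2)) * cis ((z \<bullet> b) * t)"
  have norm_sum: "(norm x)\<^sup>2 = (\<Sum>b\<in>Basis. (x \<bullet> b)\<^sup>2)" for x :: "real^'n"
    unfolding power2_norm_eq_inner by (subst euclidean_inner) (simp add: power2_eq_square)
  have e: "complex_of_real (exp (- (norm x)\<^sup>2 / 2)) * cis (x \<bullet> z) = (\<Prod>b\<in>Basis. ?g b (x \<bullet> b))" for x
  proof -
    have "(\<Prod>b\<in>Basis. ?g b (x \<bullet> b)) = (\<Prod>b\<in>Basis. exp (- complex_of_real ((x \<bullet> b)\<^sup>2 / 2) + \<i> * of_real ((z \<bullet> b) * (x \<bullet> b))))"
      by (simp only: cis_conv_exp exp_add)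
    also have "\<dots> = exp (\<Sum>b\<in>Basis. - complex_of_real ((x \<bullet> b)\<^sup>2 / 2) + \<i> * of_real ((z \<bullet> b) * (x \<bullet> b)))"
      by (simp add: exp_sum)
    also have "(\<Sum>b\<in>Basis. - complex_of_real ((x \<bullet> b)\<^sup>2 / 2) + \<i> * of_real ((z \<bullet> b) * (x \<bullet> b))) =
        of_real (- (norm x)\<^sup>2 / 2) + \<i> * of_real (x \<bullet> z)"
      unfolding norm_sum euclidean_inner[of x z]
      by (simp add: sum.distrib sum_subtractf sum_negf sum_distrib_left sum_divide_distrib mult.commute)
    also have "exp (of_real (- (norm x)\<^sup>2 / 2) + \<i> * of_real (x \<bullet> z)) =
        complex_of_real (exp (- (norm x)\<^sup>2 / 2)) * cis (x \<bullet> z)"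
      by (simp only: exp_add cis_conv_exp exp_of_real)
    finally show ?thesis by (rule sym)
  qed
  have b: "(\<lambda>x. complex_of_real (exp (- (norm x)\<^sup>2 / 2)) * cis (x \<bullet> z)) \<in> borel_measurable borel"
    by (intro borel_measurable_continuous_onI continuous_intros) auto
  show "integrable lebesgue (\<lambda>x. complex_of_real (exp (- (norm x)\<^sup>2 / 2)) * cis (x \<bullet> z))"
    unfolding lebesgue_integrable_lborel[OF b] unfolding e by (rule integral_lborel_prod(2)[OF gaussian_char_real(1)])
  have "(LINT x|lebesgue. complex_of_real (exp (- (norm x)\<^sup>2 / 2)) * cis (x \<bullet> z)) =
      (\<Prod>b\<in>Basis. of_real (sqrt (2 * pi) * exp (- (z \<bullet> b)\<^sup>2 / 2)))"
    unfolding lebesgue_integral_lborel[OF b] unfolding e integral_lborel_prod(1)[OF gaussian_char_real(1)] gaussian_char_real(2) ..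
  also have "\<dots> = of_real (sqrt (2 * pi) ^ CARD('n) * exp (- (norm z)\<^sup>2 / 2))"
    unfolding norm_sum by (simp add: prod.distrib exp_sum[symmetric] of_real_prod[symmetric] sum_negf sum_divide_distrib del: of_real_prod)
  also have "sqrt (2 * pi) ^ CARD('n) = (2 * pi) powr (real CARD('n) / 2)"
    by (simp add: powr_half_sqrt[symmetric] powr_realpow[symmetric] powr_powr)
  finally show "(LINT x|lebesgue. complex_of_real (exp (- (norm x)\<^sup>2 / 2)) * cis (x \<bullet> z)) =
      of_real ((2 * pi) powr (real CARD('n) / 2) * exp (- (norm z)\<^sup>2 / 2))" .
qed

text \<open>The Gaussian cutoff makes the double integral absolutely convergent, so the order can be
  exchanged. The frequency integral is then itself a Gaussian, of width \<epsilon> around y, and an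
  affine substitution normalizes it.\<close>

lemma gaussian_smoothing:
  fixes \<psi> :: "real^'n \<Rightarrow> complex"
  assumes \<psi>: "\<psi> \<in> schwartz" and \<epsilon>: "0 < \<epsilon>"
  shows "(LINT \<xi>|lebesgue. inv_fourier \<psi> \<xi> * cis (- (\<xi> \<bullet> y)) * of_real (exp (- (norm (\<epsilon> *\<^sub>R \<xi>))\<^sup>2 / 2))) =
    (LINT z|lebesgue. \<psi> (y + \<epsilon> *\<^sub>R z) * of_real (exp (- (norm z)\<^sup>2 / 2)))"
proof -
  interpret pair_sigma_finite "lebesgue :: (real^'n) measure" "lebesgue :: (real^'n) measure"
    by (rule pair_sigma_finite_lebesgue)
  let ?c = "complex_of_real ((2 * pi) powr (- real CARD('n) / 2))"
  let ?G = "\<lambda>z::real^'n. complex_of_real (exp (- (norm z)\<^sup>2 / 2))"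
  have Gm: "?G \<in> borel_measurable borel" by (intro borel_measurable_continuous_onI continuous_intros) auto
  have Gint: "integrable lebesgue ?G" using gaussian_char(1)[of 0] by simp
  have G\<epsilon>: "integrable lebesgue (\<lambda>\<xi>::real^'n. exp (- (norm (\<epsilon> *\<^sub>R \<xi>))\<^sup>2 / 2))"
    using integrable_norm[OF integral_affine(2)[OF Gm \<epsilon> Gint, of 0]] by simp
  have inner: "(LINT \<xi>|lebesgue. cis (\<xi> \<bullet> w) * ?G (\<epsilon> *\<^sub>R \<xi>)) =
      (1 / \<epsilon> ^ CARD('n)) *\<^sub>R of_real ((2 * pi) powr (real CARD('n) / 2) * exp (- (norm (w /\<^sub>R \<epsilon>))\<^sup>2 / 2))" for w
  proof -
    have "(LINT \<xi>|lebesgue. cis (\<xi> \<bullet> w) * ?G (\<epsilon> *\<^sub>R \<xi>)) =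
        (LINT \<xi>|lebesgue. (\<lambda>\<eta>. ?G \<eta> * cis (\<eta> \<bullet> (w /\<^sub>R \<epsilon>))) (0 + \<epsilon> *\<^sub>R \<xi>))"
    proof -
      have "(0 + \<epsilon> *\<^sub>R \<xi>) \<bullet> (w /\<^sub>R \<epsilon>) = \<xi> \<bullet> w" for \<xi> using \<epsilon> by (simp add: field_simps)
      then show ?thesis by (simp only: mult.commute add_0)
    qed
    also have "\<dots> = (1 / \<epsilon> ^ CARD('n)) *\<^sub>R (LINT \<eta>|lebesgue. ?G \<eta> * cis (\<eta> \<bullet> (w /\<^sub>R \<epsilon>)))"
      by (rule integral_affine(1)[OF _ \<epsilon>]) (intro borel_measurable_continuous_onI continuous_intros, auto)
    finally show ?thesis by (simp only: gaussian_char(2))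
  qed
  let ?h = "\<lambda>x \<xi>. \<psi> x * cis (\<xi> \<bullet> (x - y)) * ?G (\<epsilon> *\<^sub>R \<xi>)"
  have "integrable (lebesgue \<Otimes>\<^sub>M lebesgue) (\<lambda>(x, \<xi>). ?h x \<xi>)"
  proof (rule integrable_pair_bound[OF _ integrable_norm[OF schwartz_integrable[OF \<psi>]] G\<epsilon>])
    show "(\<lambda>(x, \<xi>). ?h x \<xi>) \<in> borel_measurable (lebesgue \<Otimes>\<^sub>M lebesgue)"
    proof (rule lebesgue_pair_borel_measurable, rule borel_measurable_continuous_onI)
      have "continuous_on UNIV (\<lambda>z::(real^'n) \<times> (real^'n). \<psi> (fst z))"
        using continuous_on_compose2[OF smooth_continuous_on[OF schwartz_smooth[OF \<psi>], of UNIV] continuous_on_fst[OF continuous_on_id]] by simp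
      then show "continuous_on UNIV (\<lambda>(x, \<xi>). ?h x \<xi>)"
        unfolding split_beta by (intro continuous_intros) auto
    qed
  qed (auto simp: norm_mult)
  note Fub = Fubini_integral[OF this]
  have "(LINT \<xi>|lebesgue. inv_fourier \<psi> \<xi> * cis (- (\<xi> \<bullet> y)) * ?G (\<epsilon> *\<^sub>R \<xi>)) = (LINT \<xi>|lebesgue. ?c * (LINT x|lebesgue. ?h x \<xi>))"
  proof (intro Bochner_Integration.integral_cong refl)
    fix \<xi>
    have "inv_fourier \<psi> \<xi> * cis (- (\<xi> \<bullet> y)) * ?G (\<epsilon> *\<^sub>R \<xi>) =
        ?c * (LINT x|lebesgue. \<psi> x * cis (\<xi> \<bullet> x)) * (cis (- (\<xi> \<bullet> y)) * ?G (\<epsilon> *\<^sub>R \<xi>))"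
      unfolding inv_fourier_def by (simp only: mult.assoc)
    also have "\<dots> = ?c * (LINT x|lebesgue. (\<psi> x * cis (\<xi> \<bullet> x)) * (cis (- (\<xi> \<bullet> y)) * ?G (\<epsilon> *\<^sub>R \<xi>)))"
      by simp
    also have "(LINT x|lebesgue. (\<psi> x * cis (\<xi> \<bullet> x)) * (cis (- (\<xi> \<bullet> y)) * ?G (\<epsilon> *\<^sub>R \<xi>))) = (LINT x|lebesgue. ?h x \<xi>)"
    proof (intro Bochner_Integration.integral_cong refl)
      fix x
      have "cis (\<xi> \<bullet> (x - y)) = cis (\<xi> \<bullet> x) * cis (- (\<xi> \<bullet> y))" by (simp add: cis_mult inner_diff_right)
      then show "(\<psi> x * cis (\<xi> \<bullet> x)) * (cis (- (\<xi> \<bullet> y)) * ?G (\<epsilon> *\<^sub>R \<xi>)) = ?h x \<xi>" by (simp only: mult.assoc)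
    qed
    finally show "inv_fourier \<psi> \<xi> * cis (- (\<xi> \<bullet> y)) * ?G (\<epsilon> *\<^sub>R \<xi>) = ?c * (LINT x|lebesgue. ?h x \<xi>)" .
  qed
  also have "\<dots> = ?c * (LINT x|lebesgue. LINT \<xi>|lebesgue. ?h x \<xi>)" using Fub by simp
  also have "(LINT x|lebesgue. LINT \<xi>|lebesgue. ?h x \<xi>) =
      (LINT x|lebesgue. \<psi> x * ((1 / \<epsilon> ^ CARD('n)) *\<^sub>R of_real ((2 * pi) powr (real CARD('n) / 2) * exp (- (norm ((x - y) /\<^sub>R \<epsilon>))\<^sup>2 / 2))))"
    by (simp only: mult.assoc integral_mult_right_zero inner)
  also have "?c * \<dots> = (LINT x|lebesgue. (1 / \<epsilon> ^ CARD('n)) *\<^sub>R (\<psi> x * ?G ((x - y) /\<^sub>R \<epsilon>)))"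
  proof -
    have cc: "?c * of_real ((2 * pi) powr (real CARD('n) / 2)) = 1"
      by (simp flip: of_real_mult powr_add)
    have "?c * (LINT x|lebesgue. \<psi> x * ((1 / \<epsilon> ^ CARD('n)) *\<^sub>R of_real ((2 * pi) powr (real CARD('n) / 2) * exp (- (norm ((x - y) /\<^sub>R \<epsilon>))\<^sup>2 / 2)))) =
        (LINT x|lebesgue. ?c * (\<psi> x * ((1 / \<epsilon> ^ CARD('n)) *\<^sub>R of_real ((2 * pi) powr (real CARD('n) / 2) * exp (- (norm ((x - y) /\<^sub>R \<epsilon>))\<^sup>2 / 2)))))"
      by (rule integral_mult_right_zero[symmetric])
    also have "\<dots> = (LINT x|lebesgue. (1 / \<epsilon> ^ CARD('n)) *\<^sub>R (\<psi> x * ?G ((x - y) /\<^sub>R \<epsilon>)))"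
    proof (intro Bochner_Integration.integral_cong refl)
      fix x
      have "?c * (\<psi> x * ((1 / \<epsilon> ^ CARD('n)) *\<^sub>R of_real ((2 * pi) powr (real CARD('n) / 2) * exp (- (norm ((x - y) /\<^sub>R \<epsilon>))\<^sup>2 / 2)))) =
        (?c * of_real ((2 * pi) powr (real CARD('n) / 2))) * ((1 / \<epsilon> ^ CARD('n)) *\<^sub>R (\<psi> x * ?G ((x - y) /\<^sub>R \<epsilon>)))"
        by (simp only: scaleR_conv_of_real of_real_mult mult_ac)
      then show "?c * (\<psi> x * ((1 / \<epsilon> ^ CARD('n)) *\<^sub>R of_real ((2 * pi) powr (real CARD('n) / 2) * exp (- (norm ((x - y) /\<^sub>R \<epsilon>))\<^sup>2 / 2)))) =
        (1 / \<epsilon> ^ CARD('n)) *\<^sub>R (\<psi> x * ?G ((x - y) /\<^sub>R \<epsilon>))" unfolding cc by simp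
    qed
    finally show ?thesis .
  qed
  also have "\<dots> = (1 / \<epsilon> ^ CARD('n)) *\<^sub>R (LINT x|lebesgue. \<psi> x * ?G ((x - y) /\<^sub>R \<epsilon>))" by simp
  also have "\<dots> = (LINT z|lebesgue. (\<lambda>x. \<psi> x * ?G ((x - y) /\<^sub>R \<epsilon>)) (y + \<epsilon> *\<^sub>R z))"
    by (rule integral_affine(1)[OF _ \<epsilon>, symmetric])
      (intro borel_measurable_continuous_onI continuous_intros smooth_continuous_on schwartz_smooth \<psi>, auto)
  also have "\<dots> = (LINT z|lebesgue. \<psi> (y + \<epsilon> *\<^sub>R z) * ?G z)" using \<epsilon> by simp
  finally show ?thesis .
qed

text \<open>Let \<epsilon> tend to 0 in \<open>gaussian_smoothing\<close>. The cutoff on the left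
  tends to 1; on the right \<psi> is evaluated ever closer to y, leaving \<psi>(y) times the mass (2
  \<pi>)^(n/2) of the Gaussian, which the two normalizing factors cancel.\<close>

theorem fourier_inv_fourier:
  fixes \<psi> :: "real^'n \<Rightarrow> complex"
  assumes \<psi>: "\<psi> \<in> schwartz"
  shows "fourier (inv_fourier \<psi>) = \<psi>"
proof
  fix y :: "real^'n"
  let ?c = "complex_of_real ((2 * pi) powr (- real CARD('n) / 2))"
  let ?G = "\<lambda>z::real^'n. complex_of_real (exp (- (norm z)\<^sup>2 / 2))"
  define X where "X k = 1 / real (Suc k)" for k
  have X: "X \<longlonglongrightarrow> 0" "\<And>k. X k > 0"
    unfolding X_def using LIMSEQ_inverse_real_of_nat by (auto simp: inverse_eq_divide)
  note [measurable] = schwartz_borel_measurable[OF \<psi>] schwartz_borel_measurable[OF schwartz_inv_fourier[OF \<psi>]]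
  have Gint: "integrable lebesgue ?G" using gaussian_char(1)[of 0] by simp
  have "(\<lambda>k. LINT \<xi>|lebesgue. inv_fourier \<psi> \<xi> * cis (- (\<xi> \<bullet> y)) * ?G (X k *\<^sub>R \<xi>)) \<longlonglongrightarrow>
      (LINT \<xi>|lebesgue. inv_fourier \<psi> \<xi> * cis (- (\<xi> \<bullet> y)))"
  proof (rule integral_dominated_convergence[where w = "\<lambda>\<xi>. norm (inv_fourier \<psi> \<xi>)"])
    show "integrable lebesgue (\<lambda>\<xi>. norm (inv_fourier \<psi> \<xi>))"
      by (intro integrable_norm schwartz_integrable schwartz_inv_fourier \<psi>)
    have "(\<lambda>k. inv_fourier \<psi> \<xi> * cis (- (\<xi> \<bullet> y)) * ?G (X k *\<^sub>R \<xi>)) \<longlonglongrightarrow>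
        inv_fourier \<psi> \<xi> * cis (- (\<xi> \<bullet> y)) * of_real (exp (- (norm (0 *\<^sub>R \<xi>))\<^sup>2 / 2))" for \<xi>
      by (intro tendsto_intros X) auto
    then show "AE \<xi> in lebesgue. (\<lambda>k. inv_fourier \<psi> \<xi> * cis (- (\<xi> \<bullet> y)) * ?G (X k *\<^sub>R \<xi>)) \<longlonglongrightarrow> inv_fourier \<psi> \<xi> * cis (- (\<xi> \<bullet> y))"
      by simp
    fix k
    have "norm (inv_fourier \<psi> \<xi> * cis (- (\<xi> \<bullet> y)) * ?G (X k *\<^sub>R \<xi>)) \<le> norm (inv_fourier \<psi> \<xi>)" for \<xi>
      by (simp add: norm_mult mult_left_le)
    then show "AE \<xi> in lebesgue. norm (inv_fourier \<psi> \<xi> * cis (- (\<xi> \<bullet> y)) * ?G (X k *\<^sub>R \<xi>)) \<le> norm (inv_fourier \<psi> \<xi>)" by simp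
    show "(\<lambda>\<xi>. inv_fourier \<psi> \<xi> * cis (- (\<xi> \<bullet> y)) * ?G (X k *\<^sub>R \<xi>)) \<in> borel_measurable lebesgue"
      by (intro borel_imp_lebesgue_measurable borel_measurable_continuous_onI continuous_intros smooth_continuous_on schwartz_smooth schwartz_inv_fourier \<psi>) auto
  qed (intro borel_imp_lebesgue_measurable borel_measurable_continuous_onI continuous_intros smooth_continuous_on schwartz_smooth schwartz_inv_fourier \<psi>)
  then have L1: "(\<lambda>k. LINT z|lebesgue. \<psi> (y + X k *\<^sub>R z) * ?G z) \<longlonglongrightarrow>
      (LINT \<xi>|lebesgue. inv_fourier \<psi> \<xi> * cis (- (\<xi> \<bullet> y)))"
    unfolding gaussian_smoothing[OF \<psi> X(2)] .
  from schwartz_bound[OF \<psi>, of 0 "[]"] obtain C where C: "\<And>x. norm (\<psi> x) \<le> C" by auto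
  have L2: "(\<lambda>k. LINT z|lebesgue. \<psi> (y + X k *\<^sub>R z) * ?G z) \<longlonglongrightarrow> (LINT z|lebesgue. \<psi> y * ?G z)"
  proof (rule integral_dominated_convergence[where w = "\<lambda>z. C * norm (?G z)"])
    show "integrable lebesgue (\<lambda>z. C * norm (?G z))" by (intro integrable_mult_right integrable_norm Gint)
    have "isCont \<psi> y"
      using smooth_differentiable[OF schwartz_smooth[OF \<psi>], of y] by (rule differentiable_imp_continuous_within)
    then have "(\<lambda>k. \<psi> (y + X k *\<^sub>R z)) \<longlonglongrightarrow> \<psi> y" for z
      by (rule isCont_tendsto_compose) (use tendsto_add[OF tendsto_const tendsto_scaleR[OF X(1) tendsto_const], of y z] in simp)
    then show "AE z in lebesgue. (\<lambda>k. \<psi> (y + X k *\<^sub>R z) * ?G z) \<longlonglongrightarrow> \<psi> y * ?G z"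
      by (intro AE_I2 tendsto_intros)
    fix k
    show "AE z in lebesgue. norm (\<psi> (y + X k *\<^sub>R z) * ?G z) \<le> C * norm (?G z)"
      using C by (intro AE_I2) (auto simp: norm_mult intro: mult_right_mono)
    show "(\<lambda>z. \<psi> (y + X k *\<^sub>R z) * ?G z) \<in> borel_measurable lebesgue"
      by (rule borel_imp_lebesgue_measurable) measurable
    show "(\<lambda>z. \<psi> y * ?G z) \<in> borel_measurable lebesgue"
      by (rule borel_imp_lebesgue_measurable) measurable
  qed
  have "(LINT \<xi>|lebesgue. inv_fourier \<psi> \<xi> * cis (- (\<xi> \<bullet> y))) = (LINT z|lebesgue. \<psi> y * ?G z)"
    by (rule LIMSEQ_unique[OF L1 L2])
  also have "\<dots> = \<psi> y * of_real ((2 * pi) powr (real CARD('n) / 2))" using gaussian_char(2)[of "0::real^'n"] by simp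
  finally have "fourier (inv_fourier \<psi>) y = ?c * (\<psi> y * of_real ((2 * pi) powr (real CARD('n) / 2)))"
    unfolding fourier_def by simp
  also have "\<dots> = \<psi> y" by (simp flip: of_real_mult powr_add add: mult.left_commute)
  finally show "fourier (inv_fourier \<psi>) y = \<psi> y" .
qed

section \<open>The frequency-uniform decomposition of a Schwartz function\<close>

lemma schwartz_norm_leI:
  assumes "\<And>\<alpha> x. length \<alpha> \<le> N \<Longrightarrow> (1 + norm x) ^ N * norm (pderivs \<alpha> f x) \<le> B"
  shows "schwartz_norm N f \<le> B"
  unfolding schwartz_norm_def
proof (rule cSUP_least)
  show "{\<alpha>::'a list. length \<alpha> \<le> N} \<times> (UNIV :: (real^'a) set) \<noteq> {}" by (auto intro: exI[of _ "[]"])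
qed (use assms in auto)

lemma schwartz_norm_upper:
  assumes "f \<in> schwartz" "length \<alpha> \<le> N"
  shows "(1 + norm x) ^ N * norm (pderivs \<alpha> f x) \<le> schwartz_norm N f"
proof -
  from schwartz_bound_upto[OF assms(1), of N N] obtain C where
    "\<And>x \<alpha>. length \<alpha> \<le> N \<Longrightarrow> (1 + norm x) ^ N * norm (pderivs \<alpha> f x) \<le> C" by auto
  then have "bdd_above ((\<lambda>(\<alpha>, x). (1 + norm x) ^ N * norm (pderivs \<alpha> f x)) ` ({\<alpha>. length \<alpha> \<le> N} \<times> UNIV))"
    by (intro bdd_aboveI[of _ C]) auto
  from cSUP_upper[OF _ this, of "(\<alpha>, x)"] assms(2) show ?thesis by (simp add: schwartz_norm_def)
qed

lemma schwartz_norm_nonneg: "f \<in> schwartz \<Longrightarrow> 0 \<le> schwartz_norm N f"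
  by (rule order_trans[OF _ schwartz_norm_upper[of f "[]" N 0]]) auto

lemma schwartz_norm_mono:
  assumes "f \<in> schwartz" "M \<le> N" shows "schwartz_norm M f \<le> schwartz_norm N f"
proof (rule schwartz_norm_leI)
  fix \<alpha> :: "'a list" and x :: "real^'a" assume "length \<alpha> \<le> M"
  have "(1 + norm x) ^ M * norm (pderivs \<alpha> f x) \<le> (1 + norm x) ^ N * norm (pderivs \<alpha> f x)"
    using assms(2) by (intro mult_right_mono power_increasing) auto
  also have "\<dots> \<le> schwartz_norm N f" using \<open>length \<alpha> \<le> M\<close> assms by (intro schwartz_norm_upper) auto
  finally show "(1 + norm x) ^ M * norm (pderivs \<alpha> f x) \<le> schwartz_norm N f" .
qed

lemma slowly_increasing_if_bounded:
  fixes f :: "real^'n \<Rightarrow> complex"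
  assumes "smooth f" "\<And>\<alpha> x. norm (pderivs \<alpha> f x) \<le> C \<alpha>"
  shows "slowly_increasing f"
  unfolding slowly_increasing_def
proof (intro conjI allI assms(1))
  fix n
  have nonneg: "0 \<le> C \<alpha>" for \<alpha> using order_trans[OF norm_ge_zero assms(2)] .
  have "C \<alpha> \<le> (\<Sum>\<alpha>\<in>{\<alpha>. length \<alpha> \<le> n}. C \<alpha>)" if "length \<alpha> \<le> n" for \<alpha>
    using that nonneg by (intro member_le_sum finite_multi_indices) auto
  then have "norm (pderivs \<alpha> f x) \<le> (\<Sum>\<alpha>\<in>{\<alpha>. length \<alpha> \<le> n}. C \<alpha>) * (1 + norm x) ^ 0" if "length \<alpha> \<le> n" for \<alpha> x
    using that assms(2)[of \<alpha> x] by (simp add: order_trans)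
  then show "\<exists>C N. \<forall>\<alpha> x. length \<alpha> \<le> n \<longrightarrow> norm (pderivs \<alpha> f x) \<le> C * (1 + norm x) ^ N" by blast
qed

text \<open>Dominated convergence: the Leibniz bound gives pointwise convergence to 0, and since the
  bounds on \<eta> do not depend on j, the derivatives of g supply an integrable majorant.\<close>

lemma integral_norm_pderivs_mult_tendsto_0:
  fixes \<eta> :: "nat \<Rightarrow> real^'n \<Rightarrow> complex"
  assumes g: "g \<in> schwartz" and sm: "\<And>j. smooth (\<eta> j)"
    and bd: "\<And>\<alpha> j x. norm (pderivs \<alpha> (\<eta> j) x) \<le> C \<alpha>"
    and lim: "\<And>\<alpha> x. (\<lambda>j. pderivs \<alpha> (\<eta> j) x) \<longlonglongrightarrow> 0"
  shows "(\<lambda>j. LINT x|lebesgue. norm (pderivs \<beta> (\<lambda>x. \<eta> j x * g x) x)) \<longlonglongrightarrow> 0"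
proof -
  define A where "A = {\<gamma>::'n list. length \<gamma> \<le> length \<beta>}"
  have fin: "finite A" unfolding A_def by (rule finite_multi_indices)
  have C: "0 \<le> C \<alpha>" for \<alpha> using order_trans[OF norm_ge_zero bd] .
  have le: "norm (pderivs \<beta> (\<lambda>x. \<eta> j x * g x) x) \<le>
      2 ^ length \<beta> * ((\<Sum>\<gamma>\<in>A. norm (pderivs \<gamma> (\<eta> j) x)) * (\<Sum>\<gamma>\<in>A. norm (pderivs \<gamma> g x)))" for j x
  proof (rule norm_pderivs_mult_le[OF sm schwartz_smooth[OF g] _ _ order_refl])
    fix \<gamma> :: "'n list" assume "length \<gamma> \<le> length \<beta>"
    then have "\<gamma> \<in> A" by (simp add: A_def)
    then show "norm (pderivs \<gamma> (\<eta> j) x) \<le> (\<Sum>\<gamma>\<in>A. norm (pderivs \<gamma> (\<eta> j) x))"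
      "norm (pderivs \<gamma> g x) \<le> (\<Sum>\<gamma>\<in>A. norm (pderivs \<gamma> g x))"
      using fin by (auto intro: member_le_sum[of \<gamma> A "\<lambda>\<gamma>. norm (pderivs \<gamma> (\<eta> j) x)"] member_le_sum[of \<gamma> A "\<lambda>\<gamma>. norm (pderivs \<gamma> g x)"])
  qed
  have meas: "(\<lambda>x. norm (pderivs \<beta> (\<lambda>x. \<eta> j x * g x) x)) \<in> borel_measurable lebesgue" for j
  proof -
    have [measurable]: "pderivs \<beta> (\<lambda>x. \<eta> j x * g x) \<in> borel_measurable borel"
      by (intro smooth_borel_measurable smooth_pderivs smooth_mult sm schwartz_smooth g)
    show ?thesis by (rule borel_imp_lebesgue_measurable) measurable
  qed
  have "(\<lambda>j. LINT x|lebesgue. norm (pderivs \<beta> (\<lambda>x. \<eta> j x * g x) x)) \<longlonglongrightarrow> (LINT x|(lebesgue :: (real^'n) measure). 0)"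
  proof (rule integral_dominated_convergence[where w = "\<lambda>x. 2 ^ length \<beta> * ((\<Sum>\<gamma>\<in>A. C \<gamma>) * (\<Sum>\<gamma>\<in>A. norm (pderivs \<gamma> g x)))"])
    show "integrable lebesgue (\<lambda>x. 2 ^ length \<beta> * ((\<Sum>\<gamma>\<in>A. C \<gamma>) * (\<Sum>\<gamma>\<in>A. norm (pderivs \<gamma> g x))))"
      by (intro integrable_mult_right Bochner_Integration.integrable_sum integrable_norm schwartz_integrable schwartz_pderivs g)
    have "(\<lambda>j. norm (pderivs \<beta> (\<lambda>x. \<eta> j x * g x) x)) \<longlonglongrightarrow> 0" for x
    proof (rule Lim_null_comparison)
      show "\<forall>\<^sub>F j in sequentially. norm (norm (pderivs \<beta> (\<lambda>x. \<eta> j x * g x) x)) \<le>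
        2 ^ length \<beta> * ((\<Sum>\<gamma>\<in>A. norm (pderivs \<gamma> (\<eta> j) x)) * (\<Sum>\<gamma>\<in>A. norm (pderivs \<gamma> g x)))"
        using le by simp
      show "(\<lambda>j. 2 ^ length \<beta> * ((\<Sum>\<gamma>\<in>A. norm (pderivs \<gamma> (\<eta> j) x)) * (\<Sum>\<gamma>\<in>A. norm (pderivs \<gamma> g x)))) \<longlonglongrightarrow> 0"
        by (intro tendsto_mult_right_zero tendsto_mult_left_zero tendsto_null_sum tendsto_norm_zero lim)
    qed
    then show "AE x in lebesgue. (\<lambda>j. norm (pderivs \<beta> (\<lambda>x. \<eta> j x * g x) x)) \<longlonglongrightarrow> 0" by simp
    fix j
    have "2 ^ length \<beta> * ((\<Sum>\<gamma>\<in>A. norm (pderivs \<gamma> (\<eta> j) x)) * (\<Sum>\<gamma>\<in>A. norm (pderivs \<gamma> g x))) \<le>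
      2 ^ length \<beta> * ((\<Sum>\<gamma>\<in>A. C \<gamma>) * (\<Sum>\<gamma>\<in>A. norm (pderivs \<gamma> g x)))" for x
      by (intro mult_left_mono mult_right_mono sum_mono bd sum_nonneg) auto
    from order_trans[OF le this]
    show "AE x in lebesgue. norm (norm (pderivs \<beta> (\<lambda>x. \<eta> j x * g x) x)) \<le> 2 ^ length \<beta> * ((\<Sum>\<gamma>\<in>A. C \<gamma>) * (\<Sum>\<gamma>\<in>A. norm (pderivs \<gamma> g x)))"
      by simp
  qed (auto intro: meas)
  then show ?thesis by simp
qed

text \<open>Derivatives of the transform become monomials, which commute with multiplication by
  \<eta> and are absorbed into \<theta>; polynomial weights become derivatives. Each Schwartz norm
  is thereby bounded by finitely many integrals that tend to 0.\<close>

lemma schwartz_norm_fourier_mult_tendsto_0: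
  fixes \<eta> :: "nat \<Rightarrow> real^'n \<Rightarrow> complex"
  assumes \<theta>: "\<theta> \<in> schwartz" and sm: "\<And>j. smooth (\<eta> j)"
    and bd: "\<And>\<alpha> j x. norm (pderivs \<alpha> (\<eta> j) x) \<le> C \<alpha>"
    and lim: "\<And>\<alpha> x. (\<lambda>j. pderivs \<alpha> (\<eta> j) x) \<longlonglongrightarrow> 0"
  shows "(\<lambda>j. schwartz_norm N (fourier (\<lambda>x. \<eta> j x * \<theta> x))) \<longlonglongrightarrow> 0"
proof -
  let ?c = "(2 * pi) powr (- real CARD('n) / 2)"
  define A where "A = {\<alpha>::'n list. length \<alpha> \<le> N}"
  have fin: "finite A" unfolding A_def by (rule finite_multi_indices)
  define g where "g \<alpha> = monomial_mult (-1) \<alpha> \<theta>" for \<alpha>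
  have g: "g \<alpha> \<in> schwartz" for \<alpha> unfolding g_def by (rule schwartz_monomial_mult[OF \<theta>])
  define B where "B j \<alpha> = (LINT x|lebesgue. norm (\<eta> j x * g \<alpha> x)) +
      (\<Sum>i\<in>UNIV. LINT x|lebesgue. norm (pderivs (replicate N i) (\<lambda>x. \<eta> j x * g \<alpha> x) x))" for j \<alpha>
  have B_nonneg: "0 \<le> B j \<alpha>" for j \<alpha> unfolding B_def by (intro add_nonneg_nonneg sum_nonneg Bochner_Integration.integral_nonneg) auto
  have S: "(\<lambda>x. \<eta> j x * h x) \<in> schwartz" if "h \<in> schwartz" for j h
    by (rule schwartz_mult[OF slowly_increasing_if_bounded[OF sm bd] that])
  have le: "schwartz_norm N (fourier (\<lambda>x. \<eta> j x * \<theta> x)) \<le> ?c * ((real CARD('n) + 1) ^ N * (\<Sum>\<alpha>\<in>A. B j \<alpha>))" for j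
  proof (rule schwartz_norm_leI)
    fix \<alpha> :: "'n list" and x assume "length \<alpha> \<le> N"
    then have \<alpha>: "\<alpha> \<in> A" by (simp add: A_def)
    have "pderivs \<alpha> (fourier (\<lambda>x. \<eta> j x * \<theta> x)) x = of_real ?c * osc_integral (-1) (\<lambda>x. \<eta> j x * g \<alpha> x) x"
      unfolding fourier_eq_osc_integral
      by (subst pderivs_cmult[OF schwartz_smooth[OF schwartz_osc_integral[OF S[OF \<theta>]]]])
        (auto simp: pderivs_osc_integral[OF S[OF \<theta>]] monomial_mult_mult g_def)
    then have "(1 + norm x) ^ N * norm (pderivs \<alpha> (fourier (\<lambda>x. \<eta> j x * \<theta> x)) x) =
        ?c * ((1 + norm x) ^ N * norm (osc_integral (-1) (\<lambda>x. \<eta> j x * g \<alpha> x) x))"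
      by (simp add: norm_mult mult.left_commute)
    also have "\<dots> \<le> ?c * ((real CARD('n) + 1) ^ N * B j \<alpha>)"
      unfolding B_def by (intro mult_left_mono osc_integral_decay S g) auto
    also have "\<dots> \<le> ?c * ((real CARD('n) + 1) ^ N * (\<Sum>\<alpha>\<in>A. B j \<alpha>))"
      using \<alpha> fin B_nonneg by (intro mult_left_mono member_le_sum) auto
    finally show "(1 + norm x) ^ N * norm (pderivs \<alpha> (fourier (\<lambda>x. \<eta> j x * \<theta> x)) x) \<le>
        ?c * ((real CARD('n) + 1) ^ N * (\<Sum>\<alpha>\<in>A. B j \<alpha>))" .
  qed
  have "(\<lambda>j. B j \<alpha>) \<longlonglongrightarrow> 0" for \<alpha>
    unfolding B_def using integral_norm_pderivs_mult_tendsto_0[OF g sm bd lim, of "[]" \<alpha>]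
    by (intro tendsto_add_zero tendsto_null_sum integral_norm_pderivs_mult_tendsto_0[OF g sm bd lim]) auto
  then have "(\<lambda>j. ?c * ((real CARD('n) + 1) ^ N * (\<Sum>\<alpha>\<in>A. B j \<alpha>))) \<longlonglongrightarrow> 0"
    by (intro tendsto_mult_right_zero tendsto_null_sum)
  then show ?thesis
  proof (rule Lim_null_comparison[rotated])
    show "\<forall>\<^sub>F j in sequentially. norm (schwartz_norm N (fourier (\<lambda>x. \<eta> j x * \<theta> x))) \<le>
        ?c * ((real CARD('n) + 1) ^ N * (\<Sum>\<alpha>\<in>A. B j \<alpha>))"
      using le schwartz_norm_nonneg[OF schwartz_fourier[OF S[OF \<theta>]]] by simp
  qed
qed

lemma Y_familyD:
  assumes "\<phi> \<in> Y_family"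
  shows "smooth (\<phi> k)" "norm (lattice_pt k - x) > sqrt (real CARD('n)) \<Longrightarrow> pderivs \<alpha> (\<phi> k) (x::real^'n) = 0"
    "((\<lambda>k. \<phi> k x) has_sum 1) UNIV" "\<exists>C. \<forall>k x. norm (pderivs \<alpha> (\<phi> k) x) \<le> C"
proof -
  note C1 = assms[unfolded Y_family_def mem_Collect_eq]
  note C3 = C1[THEN conjunct2, THEN conjunct2]
  note Y = C1[THEN conjunct1] C3[THEN conjunct1] C3[THEN conjunct2, THEN conjunct1] C3[THEN conjunct2, THEN conjunct2]
  show "smooth (\<phi> k)" "((\<lambda>k. \<phi> k x) has_sum 1) UNIV" using Y(1,3) by simp_all
  from Y(4) obtain C where "\<forall>k \<xi> \<beta>. length \<beta> \<le> length \<alpha> \<longrightarrow> norm (pderivs \<beta> (\<phi> k) \<xi>) \<le> C" by meson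
  then show "\<exists>C. \<forall>k x. norm (pderivs \<alpha> (\<phi> k) x) \<le> C" by (intro exI[of _ C]) simp
  assume "norm (lattice_pt k - x) > sqrt (real CARD('n))"
  then have "x \<notin> cball (lattice_pt k) (sqrt (real CARD('n)))" by (simp add: dist_norm)
  with Y(2) have x: "x \<in> - closure {\<xi>. \<phi> k \<xi> \<noteq> 0}" by blast
  show "pderivs \<alpha> (\<phi> k) x = 0"
    by (rule pderivs_eq_0_on_open[OF _ x]) (use closure_subset[of "{\<xi>. \<phi> k \<xi> \<noteq> 0}"] in auto)
qed

text \<open>Uniformity in \<xi>: subtracting the integer part of \<xi> moves all these points into
  one fixed box. The added 1 in M allows for the rounding.\<close>

lemma lattice_points_near:
  "\<exists>C. \<forall>\<xi>::real^'n. finite {k. norm (lattice_pt k - \<xi>) \<le> r} \<and> card {k. norm (lattice_pt k - \<xi>) \<le> r} \<le> C"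
proof -
  define M where "M = \<lceil>r\<rceil> + 1"
  let ?T = "{k::int^'n. \<forall>i. \<bar>k $ i\<bar> \<le> M}"
  have T: "finite ?T"
  proof (rule finite_imageD)
    have "finite {f::'n \<Rightarrow> int. \<forall>i. f i \<in> {-M..M}}"
      using finite_PiE[of "UNIV::'n set" "\<lambda>_. {-M..M}"] by (simp add: PiE_def Pi_def extensional_def)
    then show "finite (vec_nth ` ?T)" by (rule finite_subset[rotated]) (auto simp: abs_le_iff minus_le_iff[of M])
    show "inj_on vec_nth ?T" by (auto simp: inj_on_def vec_eq_iff)
  qed
  have "finite {k. norm (lattice_pt k - \<xi>) \<le> r} \<and> card {k. norm (lattice_pt k - \<xi>) \<le> r} \<le> card ?T" for \<xi> :: "real^'n"
  proof -
    define l :: "int^'n" where "l = (\<chi> i. \<lfloor>\<xi> $ i\<rfloor>)"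
    have inj: "inj_on (\<lambda>k. k - l) {k. norm (lattice_pt k - \<xi>) \<le> r}" by (auto simp: inj_on_def)
    have sub: "(\<lambda>k. k - l) ` {k. norm (lattice_pt k - \<xi>) \<le> r} \<subseteq> ?T"
    proof safe
      fix k i assume "norm (lattice_pt k - \<xi>) \<le> r"
      then have "\<bar>(lattice_pt k - \<xi>) $ i\<bar> \<le> r" using component_le_norm_cart[of "lattice_pt k - \<xi>" i] by simp
      then have "\<bar>real_of_int (k $ i) - \<xi> $ i\<bar> \<le> r" by (simp add: lattice_pt_def)
      then show "\<bar>(k - l) $ i\<bar> \<le> M" unfolding M_def l_def by simp linarith
    qed
    show ?thesis using finite_imageD[OF finite_subset[OF sub T] inj] card_inj_on_le[OF inj sub T] by blast
  qed
  then show ?thesis by blast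
qed

lemma Y_family_schwartz:
  fixes \<phi> :: "int^'n \<Rightarrow> real^'n \<Rightarrow> complex"
  assumes \<phi>: "\<phi> \<in> Y_family" shows "\<phi> k \<in> schwartz"
proof (rule schwartzI)
  show "smooth (\<phi> k)" by (rule Y_familyD[OF \<phi>])
  fix \<alpha> :: "'n list" and N
  from Y_familyD(4)[OF \<phi>, of \<alpha>] obtain C where C: "\<And>x. norm (pderivs \<alpha> (\<phi> k) x) \<le> C" by blast
  then have C0: "0 \<le> C" using order_trans[OF norm_ge_zero] by blast
  let ?R = "1 + norm (lattice_pt k :: real^'n) + sqrt (real CARD('n))"
  have "(1 + norm x) ^ N * norm (pderivs \<alpha> (\<phi> k) x) \<le> ?R ^ N * C" for x
  proof (cases "norm (lattice_pt k - x) > sqrt (real CARD('n))")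
    case True
    then show ?thesis using C0 by (simp add: Y_familyD(2)[OF \<phi>])
  next
    case False
    moreover have "norm x \<le> norm (lattice_pt k :: real^'n) + norm (lattice_pt k - x)"
      using norm_triangle_ineq4[of "lattice_pt k" "lattice_pt k - x"] by simp
    ultimately have "1 + norm x \<le> ?R" by linarith
    then show ?thesis using C C0 by (intro mult_mono power_mono) auto
  qed
  then show "\<exists>C. \<forall>x. (1 + norm x) ^ N * norm (pderivs \<alpha> (\<phi> k) x) \<le> C" by blast
qed

lemma Y_family_mult_schwartz:
  assumes \<phi>: "\<phi> \<in> Y_family" and g: "g \<in> schwartz" shows "(\<lambda>x. \<phi> k x * g x) \<in> schwartz"
proof -
  from Y_familyD(4)[OF \<phi>] obtain C where C: "\<And>\<alpha> k x. norm (pderivs \<alpha> (\<phi> k) x) \<le> C \<alpha>" by metis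
  show ?thesis by (rule schwartz_mult[OF slowly_increasing_if_bounded[OF Y_familyD(1)[OF \<phi>] C] g])
qed

text \<open>The remainder is the transform of \<open>\<eta> J\<close> times
  \<open>inv_fourier \<psi>\<close>, where \<open>\<eta> J\<close> is what the first J members leave
  of the partition of unity. Boundedly many supports overlap at a point, which bounds the
  derivatives of \<open>\<eta> J\<close> uniformly in J; and near a given point
  \<open>\<eta> J\<close> vanishes once J is large.\<close>

lemma Y_family_decomposition:
  fixes \<phi> :: "int^'n \<Rightarrow> real^'n \<Rightarrow> complex" and e :: "nat \<Rightarrow> int^'n"
  assumes \<phi>: "\<phi> \<in> Y_family" and e: "bij e" and \<psi>: "\<psi> \<in> schwartz"
  shows "(\<lambda>J. schwartz_norm N (\<lambda>x. \<psi> x + (-1) * (\<Sum>j<J. fourier (\<lambda>\<xi>. \<phi> (e j) \<xi> * inv_fourier \<psi> \<xi>) x))) \<longlonglongrightarrow> 0"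
proof -
  let ?s = "sqrt (real CARD('n))"
  define \<eta> where "\<eta> J = (\<lambda>x. 1 + (-1) * (\<Sum>j<J. \<phi> (e j) x))" for J
  note sm\<phi> = Y_familyD(1)[OF \<phi>]
  have sm_sum: "smooth (\<lambda>x. \<Sum>j<J. \<phi> (e j) x)" for J by (rule smooth_sum[OF sm\<phi>])
  have sm: "smooth (\<eta> J)" for J unfolding \<eta>_def by (intro smooth_add smooth_mult smooth_const sm_sum)
  have pd: "pderivs \<alpha> (\<eta> J) x = (if \<alpha> = [] then 1 else 0) + (-1) * (\<Sum>j<J. pderivs \<alpha> (\<phi> (e j)) x)" for \<alpha> J x
    unfolding \<eta>_def pderivs_add[OF smooth_const smooth_mult[OF smooth_const sm_sum]] pderivs_cmult[OF sm_sum]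
      pderivs_sum[OF sm\<phi>] pderivs_const by (cases \<alpha>) simp_all
  from Y_familyD(4)[OF \<phi>] obtain C where C: "\<And>\<alpha> k x. norm (pderivs \<alpha> (\<phi> k) x) \<le> C \<alpha>" by metis
  have C0: "0 \<le> C \<alpha>" for \<alpha> using order_trans[OF norm_ge_zero C] .
  from lattice_points_near[of ?s, where 'n='n] obtain K where
    K: "\<And>\<xi>::real^'n. finite {k. norm (lattice_pt k - \<xi>) \<le> ?s}" "\<And>\<xi>::real^'n. card {k. norm (lattice_pt k - \<xi>) \<le> ?s} \<le> K" by blast
  have reindex: "(\<Sum>j<J. f (e j)) = sum f (e ` {..<J})" for f :: "int^'n \<Rightarrow> complex" and J
    using e by (subst sum.reindex) (auto simp: bij_def inj_on_def)
  have bd: "norm (pderivs \<alpha> (\<eta> J) x) \<le> 1 + real K * C \<alpha>" for \<alpha> J x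
  proof -
    let ?A = "{k. norm (lattice_pt k - x) \<le> ?s}"
    have "(\<Sum>j<J. pderivs \<alpha> (\<phi> (e j)) x) = (\<Sum>k\<in>e ` {..<J} \<inter> ?A. pderivs \<alpha> (\<phi> k) x)"
      unfolding reindex[of "\<lambda>k. pderivs \<alpha> (\<phi> k) x"]
      by (rule sum.mono_neutral_right) (auto simp: not_le intro: Y_familyD(2)[OF \<phi>])
    also have "norm \<dots> \<le> real (card (e ` {..<J} \<inter> ?A)) * C \<alpha>"
      by (rule sum_norm_bound) (rule C)
    also have "\<dots> \<le> real K * C \<alpha>"
      using K[of x] card_mono[of ?A "e ` {..<J} \<inter> ?A"] C0 by (intro mult_right_mono) auto
    finally have *: "norm (\<Sum>j<J. pderivs \<alpha> (\<phi> (e j)) x) \<le> real K * C \<alpha>" .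
    have "norm (pderivs \<alpha> (\<eta> J) x) \<le> norm (if \<alpha> = [] then 1 else 0 :: complex) + norm (- 1 * (\<Sum>j<J. pderivs \<alpha> (\<phi> (e j)) x))"
      unfolding pd by (rule norm_triangle_ineq)
    also have "\<dots> \<le> 1 + real K * C \<alpha>" using * by auto
    finally show ?thesis .
  qed
  have lim: "(\<lambda>J. pderivs \<alpha> (\<eta> J) x) \<longlonglongrightarrow> 0" for \<alpha> x
  proof -
    \<comment> \<open>The additional 1 collects every k for which \<open>\<phi> k\<close> is nonzero
      somewhere on the unit ball about x. Thus \<open>\<eta> J\<close> vanishes on a neighbourhood
      of x and not only at x, and so do its derivatives.\<close>
    let ?A = "{k. norm (lattice_pt k - x) \<le> ?s + 1}"
    have finA: "finite ?A" using lattice_points_near[of "?s + 1", where 'n='n] by blast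
    obtain J0 where J0: "?A \<subseteq> e ` {..<J0}"
    proof -
      have "finite (inv e ` ?A)" using finA by simp
      then obtain J0 where "inv e ` ?A \<subseteq> {..<J0}" by (auto simp: finite_nat_iff_bounded)
      then have "?A \<subseteq> e ` {..<J0}" using e by (force simp: bij_def surj_f_inv_f image_iff)
      then show ?thesis by (rule that)
    qed
    have "pderivs \<alpha> (\<eta> J) x = 0" if "J0 \<le> J" for J
    proof (rule pderivs_eq_0_on_open[of "ball x 1"])
      fix y assume "y \<in> ball x 1"
      then have yx: "norm (y - x) < 1" by (simp add: dist_norm norm_minus_commute)
      have 0: "\<phi> k y = 0" if "k \<notin> ?A" for k
      proof -
        have "norm (lattice_pt k - x) \<le> norm (lattice_pt k - y) + norm (y - x)"
          using norm_triangle_ineq[of "lattice_pt k - y" "y - x"] by simp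
        then have "norm (lattice_pt k - y) > ?s" using that yx by simp
        from Y_familyD(2)[OF \<phi> this, of "[]"] show ?thesis by simp
      qed
      have "((\<lambda>k. \<phi> k y) has_sum sum (\<lambda>k. \<phi> k y) ?A) UNIV"
        using has_sum_finite[OF finA, of "\<lambda>k. \<phi> k y"] 0 by (subst has_sum_cong_neutral[of ?A UNIV]) auto
      then have "sum (\<lambda>k. \<phi> k y) ?A = 1" using Y_familyD(3)[OF \<phi>, of y] has_sum_unique by blast
      moreover have "(\<Sum>j<J. \<phi> (e j) y) = sum (\<lambda>k. \<phi> k y) ?A"
        unfolding reindex[of "\<lambda>k. \<phi> k y"]
      proof (rule sum.mono_neutral_right)
        show "?A \<subseteq> e ` {..<J}" using that by (intro order_trans[OF J0] image_mono) auto
      qed (use 0 in auto)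
      ultimately show "\<eta> J y = 0" by (simp add: \<eta>_def)
    qed auto
    then show ?thesis by (intro tendsto_eventually eventually_sequentiallyI[of J0])
  qed
  note \<theta> = schwartz_inv_fourier[OF \<psi>]
  have int: "integrable lebesgue (\<lambda>\<xi>. \<phi> k \<xi> * inv_fourier \<psi> \<xi>)" for k
    by (intro schwartz_integrable Y_family_mult_schwartz \<phi> \<theta>)
  have "fourier (\<lambda>x. \<eta> J x * inv_fourier \<psi> x) = (\<lambda>x. \<psi> x + (-1) * (\<Sum>j<J. fourier (\<lambda>\<xi>. \<phi> (e j) \<xi> * inv_fourier \<psi> \<xi>) x))" for J
  proof
    fix x
    have "(\<lambda>x. \<eta> J x * inv_fourier \<psi> x) = (\<lambda>x. inv_fourier \<psi> x + (-1) * (\<Sum>j<J. \<phi> (e j) x * inv_fourier \<psi> x))"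
      by (simp add: \<eta>_def fun_eq_iff algebra_simps sum_distrib_left)
    moreover have "osc_integral (-1) (\<lambda>x. inv_fourier \<psi> x + (-1) * (\<Sum>j<J. \<phi> (e j) x * inv_fourier \<psi> x)) x =
        osc_integral (-1) (inv_fourier \<psi>) x + (-1) * (\<Sum>j<J. osc_integral (-1) (\<lambda>\<xi>. \<phi> (e j) \<xi> * inv_fourier \<psi> \<xi>) x)"
    proof -
      have sum_int: "integrable lebesgue (\<lambda>x. \<Sum>j<J. \<phi> (e j) x * inv_fourier \<psi> x)"
        by (rule Bochner_Integration.integrable_sum) (rule int)
      show ?thesis
        unfolding osc_integral_add[OF schwartz_integrable[OF \<theta>] integrable_mult_right[OF sum_int]] osc_integral_cmult
          osc_integral_sum[OF int] ..
    qed
    ultimately have "fourier (\<lambda>x. \<eta> J x * inv_fourier \<psi> x) x =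
        fourier (inv_fourier \<psi>) x + (-1) * (\<Sum>j<J. fourier (\<lambda>\<xi>. \<phi> (e j) \<xi> * inv_fourier \<psi> \<xi>) x)"
      unfolding fourier_eq_osc_integral by (simp only: distrib_left sum_distrib_left mult.left_commute)
    then show "fourier (\<lambda>x. \<eta> J x * inv_fourier \<psi> x) x = \<psi> x + (-1) * (\<Sum>j<J. fourier (\<lambda>\<xi>. \<phi> (e j) \<xi> * inv_fourier \<psi> \<xi>) x)"
      by (simp add: fourier_inv_fourier[OF \<psi>])
  qed
  with schwartz_norm_fourier_mult_tendsto_0[OF \<theta> sm bd lim, of N] show ?thesis by simp
qed

text \<open>Uniformity in k: the L^1 norms in \<open>osc_integral_decay\<close> do not see where a
  support lies, only the common volume V of the balls and the common derivative bounds.\<close>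

lemma Y_family_kernel_bound:
  fixes \<phi> :: "int^'n \<Rightarrow> real^'n \<Rightarrow> complex"
  assumes \<phi>: "\<phi> \<in> Y_family"
  shows "\<exists>C\<ge>0. \<forall>k z. (1 + norm z) ^ N * norm (inv_fourier (\<phi> k) z) \<le> C"
proof -
  let ?c = "(2 * pi) powr (- real CARD('n) / 2)" and ?s = "sqrt (real CARD('n))"
  define V where "V = unit_ball_vol (real CARD('n)) * ?s ^ CARD('n)"
  have V: "measure lebesgue (cball (c::real^'n) ?s) = V" for c
    by (simp add: content_cball V_def)
  from Y_familyD(4)[OF \<phi>] obtain C where C: "\<And>\<alpha> k x. norm (pderivs \<alpha> (\<phi> k) x) \<le> C \<alpha>" by metis
  have C0: "0 \<le> C \<alpha>" for \<alpha> using order_trans[OF norm_ge_zero C] .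
  have int: "(LINT x|lebesgue. norm (pderivs \<alpha> (\<phi> k) x)) \<le> C \<alpha> * V" for \<alpha> k
  proof -
    have fin: "cball (lattice_pt k :: real^'n) ?s \<in> lmeasurable" by (rule lmeasurable_cball)
    have "(LINT x|lebesgue. norm (pderivs \<alpha> (\<phi> k) x)) \<le> (LINT x|lebesgue. C \<alpha> * indicator (cball (lattice_pt k) ?s) x)"
    proof (rule integral_mono)
      show "integrable lebesgue (\<lambda>x. norm (pderivs \<alpha> (\<phi> k) x))"
        by (intro integrable_norm schwartz_integrable schwartz_pderivs Y_family_schwartz \<phi>)
      show "integrable lebesgue (\<lambda>x. C \<alpha> * indicator (cball (lattice_pt k) ?s) x :: real)"
        using fin by (intro integrable_mult_right) (auto simp: fmeasurable_def)
      show "norm (pderivs \<alpha> (\<phi> k) x) \<le> C \<alpha> * indicator (cball (lattice_pt k) ?s) x" for x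
      proof (cases "x \<in> cball (lattice_pt k) ?s")
        case False
        then have "norm (lattice_pt k - x) > ?s" by (simp add: dist_norm)
        then show ?thesis using False by (simp add: Y_familyD(2)[OF \<phi>])
      qed (use C in auto)
    qed
    then show ?thesis by (simp add: V)
  qed
  let ?B = "?c * ((real CARD('n) + 1) ^ N * (C [] * V + (\<Sum>i\<in>(UNIV::'n set). C (replicate N i) * V)))"
  have "(1 + norm z) ^ N * norm (inv_fourier (\<phi> k) z) \<le> ?B" for k z
  proof -
    have "(1 + norm z) ^ N * norm (inv_fourier (\<phi> k) z) = ?c * ((1 + norm z) ^ N * norm (osc_integral 1 (\<phi> k) z))"
      unfolding inv_fourier_eq_osc_integral by (simp add: norm_mult mult.left_commute)
    also have "\<dots> \<le> ?c * ((real CARD('n) + 1) ^ N * ((LINT x|lebesgue. norm (\<phi> k x)) +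
        (\<Sum>i\<in>UNIV. LINT x|lebesgue. norm (pderivs (replicate N i) (\<phi> k) x))))"
      by (intro mult_left_mono osc_integral_decay Y_family_schwartz \<phi>) auto
    also have "\<dots> \<le> ?B"
      using int[of "[]" k] by (intro mult_left_mono add_mono sum_mono int) auto
    finally show ?thesis .
  qed
  moreover have "0 \<le> V" unfolding V[of 0, symmetric] by simp
  then have "0 \<le> ?B" using C0 by (intro mult_nonneg_nonneg add_nonneg_nonneg sum_nonneg) auto
  ultimately show ?thesis by blast
qed

section \<open>Measurability of matrix-valued functions\<close>

lemma borel_measurable_vec_nth' [measurable (raw)]:
  fixes f :: "'a \<Rightarrow> ('b::euclidean_space)^'n"
  shows "f \<in> borel_measurable M \<Longrightarrow> (\<lambda>x. f x $ i) \<in> borel_measurable M"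
  by (rule measurable_compose[OF _ borel_measurable_continuous_onI]) (auto intro!: continuous_intros)

lemma borel_measurable_vecI:
  fixes f :: "'a \<Rightarrow> ('b::euclidean_space)^'n"
  assumes [measurable]: "\<And>i. (\<lambda>x. f x $ i) \<in> borel_measurable M"
  shows "f \<in> borel_measurable M"
  unfolding borel_measurable_euclidean_space[of f]
proof
  fix b :: "'b^'n" assume "b \<in> Basis"
  then obtain i u where "b = axis i u" unfolding Basis_vec_def by blast
  then show "(\<lambda>x. f x \<bullet> b) \<in> borel_measurable M" by (simp add: inner_axis)
qed

lemma borel_measurable_matrix_mult [measurable (raw)]:
  fixes f :: "'a \<Rightarrow> complex^'n^'m" and g :: "'a \<Rightarrow> complex^'k^'n"
  assumes [measurable]: "f \<in> borel_measurable M" "g \<in> borel_measurable M"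
  shows "(\<lambda>x. f x ** g x) \<in> borel_measurable M"
  by (intro borel_measurable_vecI) (simp add: matrix_matrix_mult_def)

lemma borel_measurable_matrix_vector_mult [measurable (raw)]:
  fixes f :: "'a \<Rightarrow> complex^'n^'m" and g :: "'a \<Rightarrow> complex^'n"
  assumes [measurable]: "f \<in> borel_measurable M" "g \<in> borel_measurable M"
  shows "(\<lambda>x. f x *v g x) \<in> borel_measurable M"
  by (intro borel_measurable_vecI) (simp add: matrix_vector_mult_def)

lemma norm_matrix_vector_le: "norm (A *v v) \<le> op_norm A * norm v" for A :: "complex^'m^'m"
  unfolding op_norm_def by (rule onorm[OF matrix_vector_mul_bounded_linear])

lemma op_norm_nonneg: "0 \<le> op_norm A" for A :: "complex^'m^'m"
  unfolding op_norm_def by (rule onorm_pos_le[OF matrix_vector_mul_bounded_linear])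

lemma norm_vector_scalar_mult: "norm (c *s v) = norm c * norm (v :: complex^'m)"
  by (simp add: norm_vec_def norm_mult L2_set_right_distrib)

lemma op_norm_le_sum: "op_norm A \<le> (\<Sum>i\<in>UNIV. norm (A *v axis i 1))" for A :: "complex^'m^'m"
  unfolding op_norm_def
proof (rule onorm_le)
  fix v
  have "A *v v = (\<Sum>i\<in>UNIV. v $ i *s (A *v axis i 1))"
    by (simp add: vec_eq_iff matrix_vector_mult_def axis_def if_distrib[of "\<lambda>x. _ * x"] mult.commute cong: if_cong)
  also have "norm \<dots> \<le> (\<Sum>i\<in>UNIV. norm v * norm (A *v axis i 1))"
  proof (rule sum_norm_le)
    fix i
    show "norm (v $ i *s (A *v axis i 1)) \<le> norm v * norm (A *v axis i 1)"
      by (simp add: norm_vector_scalar_mult mult_right_mono Finite_Cartesian_Product.norm_nth_le)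
  qed
  finally show "norm (A *v v) \<le> (\<Sum>i\<in>UNIV. norm (A *v axis i 1)) * norm v"
    by (simp add: sum_distrib_left mult.commute)
qed

text \<open>By the triangle inequality the norms of A and B differ by at most the norm of A - B,
  which is dominated by a continuous function of A vanishing at B. Hence the operator norm is
  continuous.\<close>

lemma borel_measurable_op_norm' : "(op_norm :: complex^'m^'m \<Rightarrow> real) \<in> borel_measurable borel"
proof (rule borel_measurable_continuous_onI)
  have tri: "op_norm A \<le> op_norm B + op_norm (A - B)" for A B :: "complex^'m^'m"
  proof -
    have "(\<lambda>v. B *v v + (A - B) *v v) = (*v) A" by (simp add: fun_eq_iff matrix_vector_mult_diff_rdistrib)
    then show ?thesis
      using onorm_triangle[OF matrix_vector_mul_bounded_linear matrix_vector_mul_bounded_linear, of B "A - B"]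
      unfolding op_norm_def by simp
  qed
  have sym: "op_norm (A - B) = op_norm (B - A)" for A B :: "complex^'m^'m"
  proof -
    have "(\<lambda>v. - ((A - B) *v v)) = (*v) (B - A)" by (simp add: fun_eq_iff matrix_vector_mult_diff_rdistrib)
    then show ?thesis using onorm_neg[of "(*v) (A - B)"] unfolding op_norm_def by simp
  qed
  have le: "\<bar>op_norm A - op_norm B\<bar> \<le> (\<Sum>i\<in>UNIV. norm ((A - B) *v axis i 1))" for A B :: "complex^'m^'m"
    using tri[of A B] tri[of B A] sym[of A B] op_norm_le_sum[of "A - B"] by linarith
  have cont: "continuous_on UNIV (\<lambda>A::complex^'m^'m. \<Sum>i\<in>UNIV. norm ((A - B) *v axis i 1))" for B
    unfolding matrix_vector_mult_def by (intro continuous_intros)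
  show "continuous_on UNIV (op_norm :: complex^'m^'m \<Rightarrow> real)"
    unfolding continuous_on_def
  proof
    fix B :: "complex^'m^'m"
    have "((\<lambda>A. \<Sum>i\<in>UNIV. norm ((A - B) *v axis i 1)) \<longlongrightarrow> (\<Sum>i\<in>UNIV. norm ((B - B) *v axis i 1))) (at B)"
      using cont[of B] unfolding continuous_on_def by blast
    then have "((\<lambda>A. \<Sum>i\<in>UNIV. norm ((A - B) *v axis i 1)) \<longlongrightarrow> 0) (at B)" by simp
    then have "((\<lambda>A. op_norm A - op_norm B) \<longlongrightarrow> 0) (at B)"
      by (rule Lim_null_comparison[rotated]) (simp add: le)
    then show "(op_norm \<longlongrightarrow> op_norm B) (at B)" by (simp add: LIM_zero_iff)
  qed
qed

lemmas borel_measurable_op_norm [measurable (raw)] = measurable_compose[OF _ borel_measurable_op_norm']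

text \<open>Local integrability gives measurability after restriction to a compact set; balls of
  integer radius exhaust the space.\<close>

lemma matrix_weight_measurable:
  fixes W :: "real^'n \<Rightarrow> complex^'m^'m"
  assumes "matrix_weight W" shows "W \<in> borel_measurable lebesgue"
proof (intro borel_measurable_vecI)
  fix i j
  have "(\<lambda>x. indicator (cball 0 (real k)) x *\<^sub>R W x $ i $ j) \<in> borel_measurable lebesgue" for k :: nat
  proof -
    have "set_integrable lebesgue (cball 0 (real k)) (\<lambda>x. W x $ i $ j)"
      using assms unfolding matrix_weight_def by simp
    then show ?thesis unfolding set_integrable_def by (rule borel_measurable_integrable)
  qed
  moreover have "(\<lambda>k. indicator (cball 0 (real k)) x *\<^sub>R W x $ i $ j) \<longlonglongrightarrow> W x $ i $ j" for x
  proof (rule tendsto_eventually)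
    obtain K :: nat where "norm x \<le> real K" using real_arch_simple by blast
    then show "\<forall>\<^sub>F k in sequentially. indicator (cball 0 (real k)) x *\<^sub>R W x $ i $ j = W x $ i $ j"
      by (intro eventually_sequentiallyI[of K]) (auto simp: indicator_def)
  qed
  ultimately show "(\<lambda>x. W x $ i $ j) \<in> borel_measurable lebesgue" by (rule borel_measurable_LIMSEQ_metric) 
qed

lemma borel_measurable_mat_powr:
  fixes W :: "'a \<Rightarrow> complex^'m^'m"
  assumes [measurable]: "W \<in> borel_measurable M" and nn: "\<And>x. nonneg_definite (W x)"
  shows "(\<lambda>x. mat_powr (W x) r) \<in> borel_measurable M"
proof -
  from mat_powr_limit[of r, where 'm='m] obtain a and n :: "nat \<Rightarrow> nat"
    where an: "\<And>A::complex^'m^'m. nonneg_definite A \<Longrightarrow> (\<lambda>k. \<Sum>i\<le>n k. a k i *\<^sub>R matrix_pow A i) \<longlonglongrightarrow> mat_powr A r" by blast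
  have [measurable]: "(\<lambda>x. matrix_pow (W x) i) \<in> borel_measurable M" for i by (induction i) auto
  show ?thesis by (rule borel_measurable_LIMSEQ_metric[OF _ an[OF nn]]) measurable
qed

section \<open>Weighted averages over balls\<close>

lemma enn_powr_indicator: "0 < r \<Longrightarrow> enn_powr (a * indicator B x) r = enn_powr a r * indicator B x"
  by (auto simp: indicator_def)

lemma emeasure_lebesgue_ball:
  fixes c :: "real^'n"
  assumes "0 \<le> r"
  shows "emeasure lebesgue (ball c r) = ennreal (unit_ball_vol (real CARD('n)) * r ^ CARD('n))"
  using assms by (simp add: emeasure_ball)

lemma ennreal_divide_mult_cancel: "(b::ennreal) \<noteq> 0 \<Longrightarrow> b \<noteq> \<top> \<Longrightarrow> a / b * b = a"
  by (simp add: ennreal_divide_times ennreal_divide_self less_top)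

text \<open>Both cases of \<open>in_Ap\<close> lead to the same inequality. Its power |B|^p comes
  from undoing the averages: for p > 1 the inner one contributes |B|^(p/p') and the outer one |B|,
  with 1 + p/p' = p; for p = 1 there is a single average.\<close>

lemma Ap_kernel_bound:
  fixes W :: "real^'n \<Rightarrow> complex^'m^'m"
  assumes p: "1 \<le> p" and W: "matrix_weight W" and Ap: "in_Ap p W"
  shows "\<exists>S\<ge>0. \<forall>c r g. 0 < r \<longrightarrow> g \<in> borel_measurable lebesgue \<longrightarrow>
    (\<integral>\<^sup>+x\<in>ball c r. enn_powr (\<integral>\<^sup>+y\<in>ball c r. ennreal (op_norm (mat_powr (W x) (1 / p) ** mat_powr (W y) (- 1 / p))) * g y \<partial>lebesgue) p \<partial>lebesgue) \<le>
    ennreal S * enn_powr (emeasure lebesgue (ball c r)) p * (\<integral>\<^sup>+y\<in>ball c r. enn_powr (g y) p \<partial>lebesgue)"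
proof -
  interpret pair_sigma_finite "lebesgue :: (real^'n) measure" "lebesgue :: (real^'n) measure"
    by (rule pair_sigma_finite_lebesgue)
  have nn: "nonneg_definite (W x)" for x using W by (simp add: matrix_weight_def)
  have inv: "AE x in lebesgue. invertible (W x)" using W by (simp add: matrix_weight_def)
  note Wm [measurable] = matrix_weight_measurable[OF W]
  have [measurable]: "(\<lambda>x. mat_powr (W x) s) \<in> borel_measurable lebesgue" for s by (rule borel_measurable_mat_powr[OF Wm nn])
  let ?k = "\<lambda>x y. op_norm (mat_powr (W x) (1 / p) ** mat_powr (W y) (- 1 / p))"
  note [simp] = op_norm_nonneg
  have ub: "unit_ball_vol (real CARD('n)) \<noteq> 0" by (rule less_imp_neq[THEN not_sym]) simp
  show ?thesis
  proof (cases "p = 1")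
    case True
    define S where "S = (SUP B\<in>balls. esssup (restrict_space lebesgue B)
           (\<lambda>y. avg B (\<lambda>t. ennreal (op_norm (W t ** matrix_inv (W y))))))"
    have "S < \<top>" using Ap True by (simp add: in_Ap_def S_def)
    then obtain s where s: "S = ennreal s" "0 \<le> s" by (cases S) auto
    show ?thesis
    proof (intro exI[of _ s] conjI s(2) allI impI)
      fix c :: "real^'n" and r :: real and g :: "real^'n \<Rightarrow> ennreal"
      assume r: "0 < r" and [measurable]: "g \<in> borel_measurable lebesgue"
      let ?B = "ball c r"
      let ?b = "emeasure lebesgue ?B"
      have [measurable]: "?B \<in> sets lebesgue" by simp
      have b: "?b \<noteq> 0" "?b \<noteq> \<top>" using r unfolding emeasure_lebesgue_ball[OF less_imp_le[OF r]] using ub by auto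
      have "?B \<in> balls" using r by (auto simp: balls_def)
      then have "esssup (restrict_space lebesgue ?B) (\<lambda>y. avg ?B (\<lambda>t. ennreal (op_norm (W t ** matrix_inv (W y))))) \<le> S"
        unfolding S_def by (rule SUP_upper)
      moreover have "AE y in restrict_space lebesgue ?B. avg ?B (\<lambda>t. ennreal (op_norm (W t ** matrix_inv (W y)))) \<le>
          esssup (restrict_space lebesgue ?B) (\<lambda>y. avg ?B (\<lambda>t. ennreal (op_norm (W t ** matrix_inv (W y)))))"
        by (rule esssup_AE)
      ultimately have "AE y in restrict_space lebesgue ?B. avg ?B (\<lambda>t. ennreal (op_norm (W t ** matrix_inv (W y)))) \<le> S"
        by (auto elim: eventually_mono)
      then have "AE y in lebesgue. y \<in> ?B \<longrightarrow> avg ?B (\<lambda>t. ennreal (op_norm (W t ** matrix_inv (W y)))) \<le> S"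
        by (simp add: AE_restrict_space_iff)
      with inv have AEy: "AE y in lebesgue. (\<integral>\<^sup>+x. ennreal (?k x y) * indicator ?B x \<partial>lebesgue) * indicator ?B y \<le> S * ?b * indicator ?B y"
      proof eventually_elim
        fix y assume i: "invertible (W y)" and le: "y \<in> ?B \<longrightarrow> avg ?B (\<lambda>t. ennreal (op_norm (W t ** matrix_inv (W y)))) \<le> S"
        \<comment> \<open>For p = 1 the condition is phrased with the inverse matrix and the kernel
          with the power -1. The two agree where W is invertible, that is almost everywhere.\<close>
        have "mat_powr (W y) (- 1) = matrix_inv (W y)"
        proof -
          have 1: "mat_powr (W y) (- 1) ** W y = mat 1" using mat_powr_minus_mult[OF nn i, of 1] by (simp add: mat_powr_1[OF nn])
          have 2: "W y ** matrix_inv (W y) = mat 1" using matrix_inv_left[OF i] by (simp add: matrix_left_right_inverse)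
          have "mat_powr (W y) (- 1) = mat_powr (W y) (- 1) ** (W y ** matrix_inv (W y))" by (simp add: 2)
          also have "\<dots> = matrix_inv (W y)" unfolding matrix_mul_assoc 1 by simp
          finally show ?thesis .
        qed
        then have k: "?k x y = op_norm (W x ** matrix_inv (W y))" for x using True by (simp add: mat_powr_1[OF nn])
        show "(\<integral>\<^sup>+x. ennreal (?k x y) * indicator ?B x \<partial>lebesgue) * indicator ?B y \<le> S * ?b * indicator ?B y"
        proof (cases "y \<in> ?B")
          case True
          then have "(\<integral>\<^sup>+x. ennreal (?k x y) * indicator ?B x \<partial>lebesgue) / ?b \<le> S" using le unfolding avg_def k by blast
          then have "(\<integral>\<^sup>+x. ennreal (?k x y) * indicator ?B x \<partial>lebesgue) / ?b * ?b \<le> S * ?b" by (rule mult_right_mono) simp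
          moreover have "(\<integral>\<^sup>+x. ennreal (?k x y) * indicator ?B x \<partial>lebesgue) / ?b * ?b = (\<integral>\<^sup>+x. ennreal (?k x y) * indicator ?B x \<partial>lebesgue)"
            by (rule ennreal_divide_mult_cancel[OF b])
          ultimately show ?thesis using True by simp
        qed simp
      qed
      have "(\<integral>\<^sup>+x\<in>?B. enn_powr (\<integral>\<^sup>+y\<in>?B. ennreal (?k x y) * g y \<partial>lebesgue) p \<partial>lebesgue) =
          (\<integral>\<^sup>+x. (\<integral>\<^sup>+y. ennreal (?k x y) * g y * indicator ?B y * indicator ?B x \<partial>lebesgue) \<partial>lebesgue)"
        unfolding True unfolding enn_powr_1 by (intro nn_integral_cong nn_integral_multc[symmetric]) measurable
      also have "\<dots> = (\<integral>\<^sup>+y. (\<integral>\<^sup>+x. ennreal (?k x y) * g y * indicator ?B y * indicator ?B x \<partial>lebesgue) \<partial>lebesgue)"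
        by (rule Fubini') measurable
      also have "\<dots> = (\<integral>\<^sup>+y. g y * ((\<integral>\<^sup>+x. ennreal (?k x y) * indicator ?B x \<partial>lebesgue) * indicator ?B y) \<partial>lebesgue)"
      proof (intro nn_integral_cong)
        fix y
        have "(\<integral>\<^sup>+x. ennreal (?k x y) * g y * indicator ?B y * indicator ?B x \<partial>lebesgue) =
            (\<integral>\<^sup>+x. (g y * indicator ?B y) * (ennreal (?k x y) * indicator ?B x) \<partial>lebesgue)"
          by (intro nn_integral_cong) (simp add: mult_ac)
        also have "\<dots> = (g y * indicator ?B y) * (\<integral>\<^sup>+x. ennreal (?k x y) * indicator ?B x \<partial>lebesgue)"
          by (rule nn_integral_cmult) measurable
        finally show "(\<integral>\<^sup>+x. ennreal (?k x y) * g y * indicator ?B y * indicator ?B x \<partial>lebesgue) =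
            g y * ((\<integral>\<^sup>+x. ennreal (?k x y) * indicator ?B x \<partial>lebesgue) * indicator ?B y)" by (simp add: mult_ac)
      qed
      also have "\<dots> \<le> (\<integral>\<^sup>+y. g y * (S * ?b * indicator ?B y) \<partial>lebesgue)"
        using AEy by (intro nn_integral_mono_AE) (auto elim!: eventually_mono intro: mult_left_mono)
      also have "\<dots> = (\<integral>\<^sup>+y. (S * ?b) * (g y * indicator ?B y) \<partial>lebesgue)" by (intro nn_integral_cong) (simp add: mult_ac)
      also have "\<dots> = S * ?b * (\<integral>\<^sup>+y\<in>?B. g y \<partial>lebesgue)" by (rule nn_integral_cmult) measurable
      finally show "(\<integral>\<^sup>+x\<in>?B. enn_powr (\<integral>\<^sup>+y\<in>?B. ennreal (?k x y) * g y \<partial>lebesgue) p \<partial>lebesgue) \<le>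
          ennreal s * enn_powr ?b p * (\<integral>\<^sup>+y\<in>?B. enn_powr (g y) p \<partial>lebesgue)"
        unfolding True s(1) by simp
    qed
  next
    case False
    with p have p1: "1 < p" by simp
    define q where "q = p / (p - 1)"
    have q: "1 < q" "1 / p + 1 / q = 1" using p1 by (auto simp: q_def field_simps)
    have pq: "0 < p / q" "1 + p / q = p" using p1 q(1) by (auto simp: q_def field_simps)
    define S where "S = (SUP B\<in>balls. avg B (\<lambda>x. enn_powr (avg B (\<lambda>y. ennreal (?k x y powr q))) (p / q)))"
    have "S < \<top>" using Ap False by (simp add: in_Ap_def S_def q_def Let_def)
    then obtain s where s: "S = ennreal s" "0 \<le> s" by (cases S) auto
    show ?thesis
    proof (intro exI[of _ s] conjI s(2) allI impI)
      fix c :: "real^'n" and r :: real and g :: "real^'n \<Rightarrow> ennreal"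
      assume r: "0 < r" and [measurable]: "g \<in> borel_measurable lebesgue"
      let ?B = "ball c r"
      let ?b = "emeasure lebesgue ?B"
      have [measurable]: "?B \<in> sets lebesgue" by simp
      have b: "?b \<noteq> 0" "?b \<noteq> \<top>" using r unfolding emeasure_lebesgue_ball[OF less_imp_le[OF r]] using ub by auto
      have bb: "a / ?b * ?b = a" for a by (rule ennreal_divide_mult_cancel[OF b])
      have "?B \<in> balls" using r by (auto simp: balls_def)
      then have le: "avg ?B (\<lambda>x. enn_powr (avg ?B (\<lambda>y. ennreal (?k x y powr q))) (p / q)) \<le> S"
        unfolding S_def by (rule SUP_upper)
      define G where "G = (\<integral>\<^sup>+y\<in>?B. enn_powr (g y) p \<partial>lebesgue)"
      define a where "a x = avg ?B (\<lambda>y. ennreal (?k x y powr q))" for x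
      have [measurable]: "a \<in> borel_measurable lebesgue" 
      proof -
        obtain \<beta> where \<beta>: "?b = \<beta>" by blast
        show ?thesis unfolding a_def avg_def \<beta> by measurable
      qed
      have pt: "enn_powr (\<integral>\<^sup>+y\<in>?B. ennreal (?k x y) * g y \<partial>lebesgue) p \<le> enn_powr ?b (p / q) * G * enn_powr (a x) (p / q)" for x
      proof -
        have "(\<integral>\<^sup>+y\<in>?B. ennreal (?k x y) * g y \<partial>lebesgue) =
            (\<integral>\<^sup>+y. (ennreal (?k x y) * indicator ?B y) * (g y * indicator ?B y) \<partial>lebesgue)"
          by (intro nn_integral_cong) (auto simp: indicator_def)
        then have "enn_powr (\<integral>\<^sup>+y\<in>?B. ennreal (?k x y) * g y \<partial>lebesgue) p \<le>
            enn_powr (\<integral>\<^sup>+y. enn_powr (ennreal (?k x y) * indicator ?B y) q \<partial>lebesgue) (p / q) *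
            (\<integral>\<^sup>+y. enn_powr (g y * indicator ?B y) p \<partial>lebesgue)"
          by (simp only:) (rule nn_integral_Hoelder[OF p1 q]; measurable)
        also have "(\<integral>\<^sup>+y. enn_powr (g y * indicator ?B y) p \<partial>lebesgue) = G"
          unfolding G_def using p1 by (simp add: enn_powr_indicator)
        also have "(\<integral>\<^sup>+y. enn_powr (ennreal (?k x y) * indicator ?B y) q \<partial>lebesgue) = a x * ?b"
          unfolding a_def avg_def bb using q(1) by (simp add: enn_powr_indicator enn_powr_ennreal)
        finally show ?thesis using pq(1) by (simp add: enn_powr_mult mult_ac)
      qed
      have "(\<integral>\<^sup>+x\<in>?B. enn_powr (\<integral>\<^sup>+y\<in>?B. ennreal (?k x y) * g y \<partial>lebesgue) p \<partial>lebesgue) \<le>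
          (\<integral>\<^sup>+x. (enn_powr ?b (p / q) * G) * (enn_powr (a x) (p / q) * indicator ?B x) \<partial>lebesgue)"
        using pt by (intro nn_integral_mono) (auto simp: indicator_def)
      also have "\<dots> = (enn_powr ?b (p / q) * G) * (\<integral>\<^sup>+x\<in>?B. enn_powr (a x) (p / q) \<partial>lebesgue)"
        by (rule nn_integral_cmult) measurable
      also have "(\<integral>\<^sup>+x\<in>?B. enn_powr (a x) (p / q) \<partial>lebesgue) = avg ?B (\<lambda>x. enn_powr (a x) (p / q)) * ?b"
        unfolding avg_def bb ..
      also have "avg ?B (\<lambda>x. enn_powr (a x) (p / q)) \<le> S" using le unfolding a_def .
      also have "enn_powr ?b (p / q) * G * (S * ?b) = S * (?b * enn_powr ?b (p / q)) * G" by (simp add: mult_ac)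
      also have "?b * enn_powr ?b (p / q) = enn_powr ?b p"
      proof -
        obtain t where t: "?b = ennreal t" "0 < t" using b by (cases ?b) (auto simp: less_le)
        then have "t * t powr (p / q) = t powr p" using powr_add[of t 1 "p / q"] pq(2) by simp
        then show ?thesis using t by (simp add: enn_powr_ennreal ennreal_mult[symmetric])
      qed
      finally show "(\<integral>\<^sup>+x\<in>?B. enn_powr (\<integral>\<^sup>+y\<in>?B. ennreal (?k x y) * g y \<partial>lebesgue) p \<partial>lebesgue) \<le>
          ennreal s * enn_powr ?b p * (\<integral>\<^sup>+y\<in>?B. enn_powr (g y) p \<partial>lebesgue)"
        unfolding G_def s(1) by (simp add: mult_right_mono mult_left_mono)
    qed
  qed
qed

lemma indicator_ball_diff_measurable:
  "(\<lambda>z::('a::euclidean_space) \<times> 'a. indicator (ball 0 R) (fst z - snd z) :: ennreal) \<in> borel_measurable (lebesgue \<Otimes>\<^sub>M lebesgue)"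
  "(\<lambda>z::('a::euclidean_space) \<times> 'a. indicator (ball 0 R) (snd z - fst z) :: ennreal) \<in> borel_measurable (lebesgue \<Otimes>\<^sub>M lebesgue)"
  "(\<lambda>c. indicator (ball 0 R) (x - c) :: ennreal) \<in> borel_measurable (lebesgue :: 'a measure)"
proof -
  have 1: "(indicator (ball (0::'a) R) :: 'a \<Rightarrow> ennreal) \<in> borel_measurable borel"
    by (rule borel_measurable_indicator) auto
  show "(\<lambda>z::'a \<times> 'a. indicator (ball 0 R) (fst z - snd z) :: ennreal) \<in> borel_measurable (lebesgue \<Otimes>\<^sub>M lebesgue)"
    "(\<lambda>z::'a \<times> 'a. indicator (ball 0 R) (snd z - fst z) :: ennreal) \<in> borel_measurable (lebesgue \<Otimes>\<^sub>M lebesgue)"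
    by (intro lebesgue_pair_borel_measurable measurable_compose[OF _ 1] borel_measurable_continuous_onI continuous_intros)+
  show "(\<lambda>c. indicator (ball 0 R) (x - c) :: ennreal) \<in> borel_measurable lebesgue"
    by (intro borel_imp_lebesgue_measurable measurable_compose[OF _ 1] borel_measurable_continuous_onI continuous_intros)
qed

lemma ball_sets_lebesgue [measurable]: "ball (c::'a::euclidean_space) r \<in> sets lebesgue"
  by simp

section \<open>The weighted norm and consequences of the averaging inequality\<close>

definition weight_norm :: "real \<Rightarrow> (real^'n \<Rightarrow> complex^'m^'m) \<Rightarrow> real^'n \<Rightarrow> complex^'m \<Rightarrow> real" where
  "weight_norm p W x v = norm (mat_powr (W x) (1 / p) *v v)"

text \<open>The p-th power of the norm. The estimates are carried out on this level, where the outer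
  root is absent and integrals can be exchanged.\<close>

definition Lp_modular :: "real \<Rightarrow> (real^'n \<Rightarrow> complex^'m^'m) \<Rightarrow> (real^'n \<Rightarrow> complex^'m) \<Rightarrow> ennreal" where
  "Lp_modular p W f = (\<integral>\<^sup>+x. ennreal (weight_norm p W x (f x) powr p) \<partial>lebesgue)"

lemma Lp_norm_eq: "Lp_norm p W f = enn_powr (Lp_modular p W f) (1 / p)"
  by (simp add: Lp_norm_def Lp_modular_def weight_norm_def)

lemma Lp_norm_le_iff:
  assumes "1 \<le> p" "0 \<le> \<tau>"
  shows "Lp_norm p W f \<le> ennreal \<tau> \<longleftrightarrow> Lp_modular p W f \<le> ennreal (\<tau> powr p)"
  using enn_powr_le_iff[of "1 / p" "Lp_modular p W f" "ennreal \<tau>"] assms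
  by (simp add: Lp_norm_eq enn_powr_ennreal)

lemma weight_norm_nonneg [simp]: "0 \<le> weight_norm p W x v"
  by (simp add: weight_norm_def)

locale Ap_weight =
  fixes p :: real and W :: "real^'n \<Rightarrow> complex^'m^'m"
  assumes p: "1 \<le> p" and W: "matrix_weight W" and Ap: "in_Ap p W"
begin

lemma nonneg_definite_W: "nonneg_definite (W x)"
  using W by (simp add: matrix_weight_def)

lemma mat_powr_W_measurable [measurable]: "(\<lambda>x. mat_powr (W x) s) \<in> borel_measurable lebesgue"
  by (rule borel_measurable_mat_powr[OF matrix_weight_measurable[OF W] nonneg_definite_W])

lemma weight_norm_measurable [measurable (raw)]:
  assumes g: "g \<in> measurable M lebesgue" and [measurable]: "f \<in> borel_measurable M"
  shows "(\<lambda>z. weight_norm p W (g z) (f z)) \<in> borel_measurable M"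
proof -
  note [measurable] = measurable_compose[OF g mat_powr_W_measurable]
  show ?thesis unfolding weight_norm_def by measurable
qed

lemma p_pos: "0 < p" using p by simp

lemma inverse_weight:
  "AE x in lebesgue. \<forall>v. mat_powr (W x) (- 1 / p) *v (mat_powr (W x) (1 / p) *v v) = v"
proof -
  have "AE x in lebesgue. invertible (W x)" using W by (simp add: matrix_weight_def)
  then show ?thesis
  proof eventually_elim
    fix x assume "invertible (W x)"
    from mat_powr_minus_mult[OF nonneg_definite_W this, of "1 / p"]
    show "\<forall>v. mat_powr (W x) (- 1 / p) *v (mat_powr (W x) (1 / p) *v v) = v"
      by (simp add: matrix_vector_mul_assoc)
  qed
qed

text \<open>Inserting W(y)^(-1/p) W(y)^(1/p) before f(y) splits off the matrix of the A_p condition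
  and leaves the scalar function |W(y)^(1/p) f(y)|.\<close>

lemma ball_average:
  "\<exists>S\<ge>0. \<forall>c r f. 0 < r \<longrightarrow> f \<in> borel_measurable lebesgue \<longrightarrow>
    (\<integral>\<^sup>+x\<in>ball c r. enn_powr (\<integral>\<^sup>+y\<in>ball c r. ennreal (weight_norm p W x (f y)) \<partial>lebesgue) p \<partial>lebesgue) \<le>
    ennreal S * enn_powr (emeasure lebesgue (ball c r)) p * (\<integral>\<^sup>+y\<in>ball c r. ennreal (weight_norm p W y (f y) powr p) \<partial>lebesgue)"
proof -
  let ?k = "\<lambda>x y. op_norm (mat_powr (W x) (1 / p) ** mat_powr (W y) (- 1 / p))"
  from Ap_kernel_bound[OF p W Ap] obtain S where S: "S \<ge> 0"
    "\<And>c r g. 0 < r \<Longrightarrow> g \<in> borel_measurable lebesgue \<Longrightarrow>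
    (\<integral>\<^sup>+x\<in>ball c r. enn_powr (\<integral>\<^sup>+y\<in>ball c r. ennreal (?k x y) * g y \<partial>lebesgue) p \<partial>lebesgue) \<le>
    ennreal S * enn_powr (emeasure lebesgue (ball c r)) p * (\<integral>\<^sup>+y\<in>ball c r. enn_powr (g y) p \<partial>lebesgue)" by blast
  show ?thesis
  proof (intro exI[of _ S] conjI S(1) allI impI)
    fix c :: "real^'n" and r :: real and f :: "real^'n \<Rightarrow> complex^'m"
    assume r: "0 < r" and [measurable]: "f \<in> borel_measurable lebesgue"
    define g where "g y = ennreal (weight_norm p W y (f y))" for y
    have [measurable]: "g \<in> borel_measurable lebesgue" unfolding g_def by measurable
    have le: "(\<integral>\<^sup>+y\<in>ball c r. ennreal (weight_norm p W x (f y)) \<partial>lebesgue) \<le> (\<integral>\<^sup>+y\<in>ball c r. ennreal (?k x y) * g y \<partial>lebesgue)" for x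
    proof (rule nn_integral_mono_AE, use inverse_weight in eventually_elim)
      fix y assume inv: "\<forall>v. mat_powr (W y) (- 1 / p) *v (mat_powr (W y) (1 / p) *v v) = v"
      have "weight_norm p W x (f y) = norm ((mat_powr (W x) (1 / p) ** mat_powr (W y) (- 1 / p)) *v (mat_powr (W y) (1 / p) *v f y))"
        by (simp only: weight_norm_def matrix_vector_mul_assoc[symmetric] inv[rule_format])
      also have "\<dots> \<le> ?k x y * weight_norm p W y (f y)" unfolding weight_norm_def by (rule norm_matrix_vector_le)
      finally show "ennreal (weight_norm p W x (f y)) * indicator (ball c r) y \<le> ennreal (?k x y) * g y * indicator (ball c r) y"
        by (simp add: g_def ennreal_mult[symmetric] op_norm_nonneg ennreal_leI mult_right_mono)
    qed
    have "(\<integral>\<^sup>+x\<in>ball c r. enn_powr (\<integral>\<^sup>+y\<in>ball c r. ennreal (weight_norm p W x (f y)) \<partial>lebesgue) p \<partial>lebesgue) \<le>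
      (\<integral>\<^sup>+x\<in>ball c r. enn_powr (\<integral>\<^sup>+y\<in>ball c r. ennreal (?k x y) * g y \<partial>lebesgue) p \<partial>lebesgue)"
      by (intro nn_integral_mono mult_right_mono enn_powr_mono[OF le p_pos]) simp
    also have "\<dots> \<le> ennreal S * enn_powr (emeasure lebesgue (ball c r)) p * (\<integral>\<^sup>+y\<in>ball c r. enn_powr (g y) p \<partial>lebesgue)"
      by (rule S(2)[OF r]) measurable
    finally show "(\<integral>\<^sup>+x\<in>ball c r. enn_powr (\<integral>\<^sup>+y\<in>ball c r. ennreal (weight_norm p W x (f y)) \<partial>lebesgue) p \<partial>lebesgue) \<le>
      ennreal S * enn_powr (emeasure lebesgue (ball c r)) p * (\<integral>\<^sup>+y\<in>ball c r. ennreal (weight_norm p W y (f y) powr p) \<partial>lebesgue)"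
      by (simp add: g_def enn_powr_ennreal)
  qed
qed

text \<open>The sublevel sets of the finite function x \<mapsto> |W(x)^(-1/p)| exhaust the unit
  ball. If all were null, so would be the ball.\<close>

lemma bounded_inverse_set:
  "\<exists>M>0. \<exists>G\<in>sets lebesgue. G \<subseteq> ball 0 1 \<and> emeasure lebesgue G > 0 \<and>
    (\<forall>x\<in>G. op_norm (mat_powr (W x) (- 1 / p)) \<le> M)"
proof (rule ccontr)
  assume contra: "\<not> ?thesis"
  define G where "G k = {x\<in>ball 0 1. op_norm (mat_powr (W x) (- 1 / p)) \<le> real (Suc k)}" for k
  have G [measurable]: "G k \<in> sets lebesgue" for k
  proof -
    have "{x \<in> space lebesgue. x \<in> ball 0 1 \<and> op_norm (mat_powr (W x) (- 1 / p)) \<le> real (Suc k)} \<in> sets lebesgue"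
      by measurable
    then show ?thesis by (simp add: G_def)
  qed
  have "emeasure lebesgue (G k) = 0" for k
  proof (rule ccontr)
    assume "emeasure lebesgue (G k) \<noteq> 0"
    then have "emeasure lebesgue (G k) > 0" by (simp add: zero_less_iff_neq_zero)
    moreover have "\<forall>x\<in>G k. op_norm (mat_powr (W x) (- 1 / p)) \<le> real (Suc k)" "G k \<subseteq> ball 0 1" by (auto simp: G_def)
    ultimately show False using contra G[of k] by (metis of_nat_0_less_iff zero_less_Suc)
  qed
  then have "emeasure lebesgue (\<Union>k. G k) = 0" by (intro emeasure_UN_eq_0) auto
  moreover have "(\<Union>k. G k) = ball 0 1"
  proof safe
    fix x :: "real^'n" assume x: "x \<in> ball 0 1"
    obtain k where "op_norm (mat_powr (W x) (- 1 / p)) \<le> real k" using real_arch_simple by blast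
    then have "x \<in> G k" using x by (simp add: G_def)
    then show "x \<in> (\<Union>k. G k)" by blast
  qed (auto simp: G_def)
  moreover have "emeasure lebesgue (ball 0 1 :: (real^'n) set) = ennreal (unit_ball_vol (real CARD('n)))"
    by (subst emeasure_lebesgue_ball) auto
  moreover have "\<not> unit_ball_vol (real CARD('n)) \<le> 0" unfolding not_le by simp
  ultimately show False by (simp add: ennreal_eq_0_iff del: emeasure_completion)
qed

lemma ball_L1_bound:
  "\<exists>C\<ge>0. \<forall>f \<tau> R. f \<in> borel_measurable lebesgue \<longrightarrow> 0 \<le> \<tau> \<longrightarrow> Lp_modular p W f \<le> ennreal (\<tau> powr p) \<longrightarrow> 0 < R \<longrightarrow>
    (\<integral>\<^sup>+y\<in>ball 0 R. ennreal (norm (f y)) \<partial>lebesgue) \<le> ennreal (C * (R + 1) ^ CARD('n) * \<tau>)"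
proof -
  from ball_average obtain S where S: "S \<ge> 0"
    "\<And>c r f. 0 < r \<Longrightarrow> f \<in> borel_measurable lebesgue \<Longrightarrow>
    (\<integral>\<^sup>+x\<in>ball c r. enn_powr (\<integral>\<^sup>+y\<in>ball c r. ennreal (weight_norm p W x (f y)) \<partial>lebesgue) p \<partial>lebesgue) \<le>
    ennreal S * enn_powr (emeasure lebesgue (ball c r)) p * (\<integral>\<^sup>+y\<in>ball c r. ennreal (weight_norm p W y (f y) powr p) \<partial>lebesgue)"
    by blast
  from bounded_inverse_set obtain M G where M: "M > 0" and [measurable]: "G \<in> sets lebesgue" and G: "G \<subseteq> ball 0 1"
    "emeasure lebesgue G > 0" "\<And>x. x \<in> G \<Longrightarrow> op_norm (mat_powr (W x) (- 1 / p)) \<le> M" by blast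
  have "emeasure lebesgue G \<le> emeasure lebesgue (ball 0 1 :: (real^'n) set)" by (rule emeasure_mono[OF G(1)]) simp
  also have "\<dots> < \<top>" by (subst emeasure_lebesgue_ball) auto
  finally obtain \<gamma> where \<gamma>: "emeasure lebesgue G = ennreal \<gamma>" "\<gamma> > 0"
    using G(2) by (cases "emeasure lebesgue G") (auto simp: ennreal_less_zero_iff)
  let ?v = "unit_ball_vol (real CARD('n))"
  show ?thesis
  \<comment> \<open>\<open>M\<close> bounds the inverse weight on G, S / \<gamma> compares the
    averaging constant with the measure of G, and \<open>?v\<close> is the volume factor of the
    ball.\<close>
  proof (intro exI[of _ "M * (S / \<gamma>) powr (1 / p) * ?v"] conjI allI impI)
    show "0 \<le> M * (S / \<gamma>) powr (1 / p) * ?v" using M by simp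
    fix f :: "real^'n \<Rightarrow> complex^'m" and \<tau> R :: real
    assume [measurable]: "f \<in> borel_measurable lebesgue" and \<tau>: "0 \<le> \<tau>"
      and f: "Lp_modular p W f \<le> ennreal (\<tau> powr p)" and R: "0 < R"
    \<comment> \<open>Enlarging the radius by 1 makes the ball contain G, however small R
      is.\<close>
    let ?B = "ball (0::real^'n) (R + 1)"
    define b where "b = ?v * (R + 1) ^ CARD('n)"
    have b: "emeasure lebesgue ?B = ennreal b" "0 \<le> b" using R by (simp_all only: emeasure_lebesgue_ball b_def) simp_all
    define I where "I = (\<integral>\<^sup>+y\<in>?B. ennreal (norm (f y)) \<partial>lebesgue)"
    define E where "E x = (\<integral>\<^sup>+y\<in>?B. ennreal (weight_norm p W x (f y)) \<partial>lebesgue)" for x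
    have IE: "AE x in lebesgue. x \<in> G \<longrightarrow> I \<le> ennreal M * E x"
      using inverse_weight
    proof eventually_elim
      fix x assume inv: "\<forall>v. mat_powr (W x) (- 1 / p) *v (mat_powr (W x) (1 / p) *v v) = v"
      show "x \<in> G \<longrightarrow> I \<le> ennreal M * E x"
      proof
        assume x: "x \<in> G"
        have le: "norm v \<le> M * weight_norm p W x v" for v
        proof -
          have "norm v = norm (mat_powr (W x) (- 1 / p) *v (mat_powr (W x) (1 / p) *v v))" using inv by simp
          also have "\<dots> \<le> op_norm (mat_powr (W x) (- 1 / p)) * weight_norm p W x v"
            unfolding weight_norm_def by (rule norm_matrix_vector_le)
          also have "\<dots> \<le> M * weight_norm p W x v" using G(3)[OF x] by (intro mult_right_mono) auto
          finally show ?thesis .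
        qed
        have "I \<le> (\<integral>\<^sup>+y. ennreal M * (ennreal (weight_norm p W x (f y)) * indicator ?B y) \<partial>lebesgue)"
          unfolding I_def using le M
          by (intro nn_integral_mono) (auto simp: indicator_def ennreal_mult[symmetric] intro!: ennreal_leI)
        also have "\<dots> = ennreal M * E x" unfolding E_def by (rule nn_integral_cmult) measurable
        finally show "I \<le> ennreal M * E x" .
      qed
    qed
    \<comment> \<open>\<open>I\<close> does not depend on x, so integrating its power over G only
      multiplies it by the positive number \<gamma>, by which one can divide in the end.\<close>
    have "enn_powr I p * ennreal \<gamma> = (\<integral>\<^sup>+x. enn_powr I p * indicator G x \<partial>lebesgue)"
      by (simp add: nn_integral_cmult_indicator \<gamma>)
    also have "\<dots> \<le> (\<integral>\<^sup>+x. enn_powr (ennreal M) p * (enn_powr (E x) p * indicator ?B x) \<partial>lebesgue)"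
    proof (rule nn_integral_mono_AE, use IE in eventually_elim)
      fix x assume le: "x \<in> G \<longrightarrow> I \<le> ennreal M * E x"
      show "enn_powr I p * indicator G x \<le> enn_powr (ennreal M) p * (enn_powr (E x) p * indicator ?B x)"
      proof (cases "x \<in> G")
        case True
        then have "x \<in> ?B" using G(1) R by auto
        moreover have "enn_powr I p \<le> enn_powr (ennreal M * E x) p" using le True by (intro enn_powr_mono p_pos) auto
        ultimately show ?thesis using True by (simp add: enn_powr_mult p_pos)
      qed simp
    qed
    also have "\<dots> = enn_powr (ennreal M) p * (\<integral>\<^sup>+x\<in>?B. enn_powr (E x) p \<partial>lebesgue)"
    proof (rule nn_integral_cmult)
      interpret pair_sigma_finite "lebesgue :: (real^'n) measure" "lebesgue :: (real^'n) measure"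
        by (rule pair_sigma_finite_lebesgue)
      show "(\<lambda>x. enn_powr (E x) p * indicator ?B x) \<in> borel_measurable lebesgue"
        unfolding E_def by measurable
    qed
    also have "\<dots> \<le> enn_powr (ennreal M) p * (ennreal S * enn_powr (ennreal b) p * (\<integral>\<^sup>+y\<in>?B. ennreal (weight_norm p W y (f y) powr p) \<partial>lebesgue))"
      unfolding E_def b(1)[symmetric] using R by (intro mult_left_mono S(2)) auto
    also have "\<dots> \<le> enn_powr (ennreal M) p * (ennreal S * enn_powr (ennreal b) p * ennreal (\<tau> powr p))"
    proof (intro mult_left_mono)
      have "(\<integral>\<^sup>+y\<in>?B. ennreal (weight_norm p W y (f y) powr p) \<partial>lebesgue) \<le> Lp_modular p W f"
        unfolding Lp_modular_def by (intro nn_integral_mono) (auto simp: indicator_def)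
      then show "(\<integral>\<^sup>+y\<in>?B. ennreal (weight_norm p W y (f y) powr p) \<partial>lebesgue) \<le> ennreal (\<tau> powr p)" using f by simp
    qed auto
    also have "\<dots> = ennreal ((M * b * \<tau>) powr p * S)"
      using M b(2) \<tau> S(1) by (simp add: enn_powr_ennreal ennreal_mult[symmetric] powr_mult mult_ac)
    finally have "enn_powr I p * ennreal \<gamma> \<le> ennreal ((M * b * \<tau>) powr p * S)" .
    then have "enn_powr I p * ennreal \<gamma> * ennreal (1 / \<gamma>) \<le> ennreal ((M * b * \<tau>) powr p * S) * ennreal (1 / \<gamma>)"
      by (rule mult_right_mono) simp
    moreover have "ennreal \<gamma> * ennreal (1 / \<gamma>) = 1" using \<gamma>(2) by (simp flip: ennreal_mult)
    ultimately have "enn_powr I p \<le> ennreal ((M * b * \<tau>) powr p * (S / \<gamma>))"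
      using S(1) \<gamma>(2) M b(2) \<tau> by (simp add: mult.assoc ennreal_mult[symmetric])
    then have "I \<le> enn_powr (ennreal ((M * b * \<tau>) powr p * (S / \<gamma>))) (1 / p)"
      using enn_powr_le_iff[OF p_pos] by blast
    also have "\<dots> = ennreal (M * (S / \<gamma>) powr (1 / p) * ?v * (R + 1) ^ CARD('n) * \<tau>)"
    proof -
      have "((M * b * \<tau>) powr p * (S / \<gamma>)) powr (1 / p) = M * b * \<tau> * (S / \<gamma>) powr (1 / p)"
      proof -
        have "((M * b * \<tau>) powr p * (S / \<gamma>)) powr (1 / p) = ((M * b * \<tau>) powr p) powr (1 / p) * (S / \<gamma>) powr (1 / p)"
          by (rule powr_mult)
        also have "((M * b * \<tau>) powr p) powr (1 / p) = M * b * \<tau>"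
          using M b(2) \<tau> p_pos by (simp add: powr_powr del: powr_mult)
        finally show ?thesis .
      qed
      then show ?thesis using S(1) \<gamma>(2) by (simp add: enn_powr_ennreal b_def mult_ac)
    qed
    finally have "I \<le> ennreal (M * (S / \<gamma>) powr (1 / p) * ?v * (R + 1) ^ CARD('n) * \<tau>)" .
    moreover have "(\<integral>\<^sup>+y\<in>ball 0 R. ennreal (norm (f y)) \<partial>lebesgue) \<le> I"
      unfolding I_def by (intro nn_integral_mono) (auto simp: indicator_def)
    ultimately show "(\<integral>\<^sup>+y\<in>ball 0 R. ennreal (norm (f y)) \<partial>lebesgue) \<le> ennreal (M * (S / \<gamma>) powr (1 / p) * ?v * (R + 1) ^ CARD('n) * \<tau>)"
      by (rule order_trans[rotated])
  qed
qed

end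

text \<open>A single term suffices: for j the integer part of |z|, the indicator is 1 and 1 + j is
  at most 1 + |z|.\<close>

lemma inverse_power_le_shells:
  fixes z :: "'a::real_normed_vector"
  shows "ennreal (1 / (1 + norm z) ^ N) \<le> (\<Sum>j. ennreal (1 / (1 + real j) ^ N) * indicator (ball 0 (real j + 1)) z)"
proof -
  define j where "j = nat \<lfloor>norm z\<rfloor>"
  have j: "real j \<le> norm z" "norm z < real j + 1" unfolding j_def by (auto simp: of_nat_floor)
  have "ennreal (1 / (1 + norm z) ^ N) \<le> ennreal (1 / (1 + real j) ^ N) * indicator (ball 0 (real j + 1)) z"
    using j by (auto simp: indicator_def intro!: ennreal_leI divide_left_mono power_mono mult_pos_pos zero_less_power add_pos_nonneg)
  also have "f j \<le> suminf f" for f :: "nat \<Rightarrow> ennreal" using sum_le_suminf[of f "{j}"] by simp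
  finally show ?thesis .
qed

lemma summable_inverse_square: "summable (\<lambda>j. 1 / (1 + real j)\<^sup>2)"
  using inverse_squares_sums by (auto simp: sums_iff add.commute)

lemma suminf_ennreal_inverse_square:
  assumes "0 \<le> A"
  shows "(\<Sum>j. ennreal (A * (1 / (1 + real j)\<^sup>2))) = ennreal (A * (\<Sum>j. 1 / (1 + real j)\<^sup>2))"
proof -
  have "(\<Sum>j. ennreal (A * (1 / (1 + real j)\<^sup>2))) = ennreal (\<Sum>j. A * (1 / (1 + real j)\<^sup>2))"
    by (rule suminf_ennreal2) (use assms in \<open>auto intro!: summable_mult summable_inverse_square simp del: mult_cancel_left1 times_divide_eq_right\<close>)
  then show ?thesis unfolding suminf_mult[OF summable_inverse_square] .
qed

context Ap_weight
begin

text \<open>The ball of radius j + 1 contributes (j + 2)^n \<le> 2^n (1 + j)^n. The exponent n + 2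
  of the weight leaves the summable factor 1 / (1 + j)^2.\<close>

lemma weighted_L1_bound:
  "\<exists>C\<ge>0. \<forall>f \<tau>. f \<in> borel_measurable lebesgue \<longrightarrow> 0 \<le> \<tau> \<longrightarrow> Lp_modular p W f \<le> ennreal (\<tau> powr p) \<longrightarrow>
    (\<integral>\<^sup>+y. ennreal (1 / (1 + norm y) ^ (CARD('n) + 2) * norm (f y)) \<partial>lebesgue) \<le> ennreal (C * \<tau>)"
proof -
  let ?n = "CARD('n)"
  from ball_L1_bound obtain C where C: "C \<ge> 0" "\<And>f \<tau> R. f \<in> borel_measurable lebesgue \<Longrightarrow> 0 \<le> \<tau> \<Longrightarrow>
    Lp_modular p W f \<le> ennreal (\<tau> powr p) \<Longrightarrow> 0 < R \<Longrightarrow>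
    (\<integral>\<^sup>+y\<in>ball 0 R. ennreal (norm (f y)) \<partial>lebesgue) \<le> ennreal (C * (R + 1) ^ ?n * \<tau>)" by blast
  show ?thesis
  proof (intro exI[of _ "C * 2 ^ ?n * (\<Sum>j. 1 / (1 + real j)\<^sup>2)"] conjI allI impI)
    show "0 \<le> C * 2 ^ ?n * (\<Sum>j. 1 / (1 + real j)\<^sup>2)"
      using C(1) by (intro mult_nonneg_nonneg suminf_nonneg summable_inverse_square) auto
    fix f :: "real^'n \<Rightarrow> complex^'m" and \<tau> :: real
    assume [measurable]: "f \<in> borel_measurable lebesgue" and \<tau>: "0 \<le> \<tau>" and f: "Lp_modular p W f \<le> ennreal (\<tau> powr p)"
    have "(\<integral>\<^sup>+y. ennreal (1 / (1 + norm y) ^ (?n + 2) * norm (f y)) \<partial>lebesgue) \<le>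
        (\<integral>\<^sup>+y. (\<Sum>j. ennreal (1 / (1 + real j) ^ (?n + 2)) * (ennreal (norm (f y)) * indicator (ball 0 (real j + 1)) y)) \<partial>lebesgue)"
    proof (rule nn_integral_mono)
      fix y :: "real^'n"
      have "ennreal (1 / (1 + norm y) ^ (?n + 2) * norm (f y)) = ennreal (1 / (1 + norm y) ^ (?n + 2)) * ennreal (norm (f y))"
        by (rule ennreal_mult) auto
      also have "\<dots> \<le> (\<Sum>j. ennreal (1 / (1 + real j) ^ (?n + 2)) * indicator (ball 0 (real j + 1)) y) * ennreal (norm (f y))"
        by (intro mult_right_mono inverse_power_le_shells) simp
      also have "\<dots> = (\<Sum>j. ennreal (1 / (1 + real j) ^ (?n + 2)) * (ennreal (norm (f y)) * indicator (ball 0 (real j + 1)) y))"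
        unfolding ennreal_suminf_multc[symmetric] by (intro suminf_cong) (simp add: mult_ac)
      finally show "ennreal (1 / (1 + norm y) ^ (?n + 2) * norm (f y)) \<le>
        (\<Sum>j. ennreal (1 / (1 + real j) ^ (?n + 2)) * (ennreal (norm (f y)) * indicator (ball 0 (real j + 1)) y))" .
    qed
    also have "\<dots> = (\<Sum>j. ennreal (1 / (1 + real j) ^ (?n + 2)) * (\<integral>\<^sup>+y\<in>ball 0 (real j + 1). ennreal (norm (f y)) \<partial>lebesgue))"
      by (subst nn_integral_suminf) (auto simp: nn_integral_cmult)
    also have "\<dots> \<le> (\<Sum>j. ennreal (C * 2 ^ ?n * \<tau> * (1 / (1 + real j)\<^sup>2)))"
    proof (rule suminf_le)
      fix j
      have "(real j + 1 + 1) ^ ?n \<le> (2 * (1 + real j)) ^ ?n" by (intro power_mono) auto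
      then have le: "(real j + 1 + 1) ^ ?n \<le> 2 ^ ?n * (1 + real j) ^ ?n" by (simp only: power_mult_distrib)
      have "ennreal (1 / (1 + real j) ^ (?n + 2)) * (\<integral>\<^sup>+y\<in>ball 0 (real j + 1). ennreal (norm (f y)) \<partial>lebesgue) \<le>
          ennreal (1 / (1 + real j) ^ (?n + 2)) * ennreal (C * (real j + 1 + 1) ^ ?n * \<tau>)"
        by (intro mult_left_mono C(2) f \<tau>) auto
      also have "\<dots> \<le> ennreal (1 / (1 + real j) ^ (?n + 2)) * ennreal (C * (2 ^ ?n * (1 + real j) ^ ?n) * \<tau>)"
        using C(1) \<tau> le by (intro mult_left_mono ennreal_leI mult_right_mono) auto
      also have "\<dots> = ennreal (C * 2 ^ ?n * \<tau> * (1 / (1 + real j)\<^sup>2))"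
        using C(1) \<tau> by (simp add: ennreal_mult[symmetric] power_add power2_eq_square)
      finally show "ennreal (1 / (1 + real j) ^ (?n + 2)) * (\<integral>\<^sup>+y\<in>ball 0 (real j + 1). ennreal (norm (f y)) \<partial>lebesgue) \<le>
        ennreal (C * 2 ^ ?n * \<tau> * (1 / (1 + real j)\<^sup>2))" .
    qed auto
    also have "\<dots> = ennreal (C * 2 ^ ?n * (\<Sum>j. 1 / (1 + real j)\<^sup>2) * \<tau>)"
      using C(1) \<tau> by (subst suminf_ennreal_inverse_square) (simp_all add: mult_ac)
    finally show "(\<integral>\<^sup>+y. ennreal (1 / (1 + norm y) ^ (?n + 2) * norm (f y)) \<partial>lebesgue) \<le>
        ennreal (C * 2 ^ ?n * (\<Sum>j. 1 / (1 + real j)\<^sup>2) * \<tau>)" .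
  qed
qed

text \<open>The fixed ball of the averaging inequality is made to move with \<open>x\<close> by averaging over all
  centres \<open>c\<close> with \<open>|x - c| < 1\<close>.\<close>
lemma translated_ball_average:
  "\<exists>C>0. \<forall>f \<tau> R. f \<in> borel_measurable lebesgue \<longrightarrow> 0 \<le> \<tau> \<longrightarrow> Lp_modular p W f \<le> ennreal (\<tau> powr p) \<longrightarrow> 0 < R \<longrightarrow>
    (\<integral>\<^sup>+x. enn_powr (\<integral>\<^sup>+y. ennreal (weight_norm p W x (f y)) * indicator (ball 0 R) (x - y) \<partial>lebesgue) p \<partial>lebesgue) \<le>
    ennreal ((C * (R + 1) ^ (2 * CARD('n)) * \<tau>) powr p)"
proof -
  let ?n = "CARD('n)" and ?v = "unit_ball_vol (real CARD('n))"
  interpret pair_sigma_finite "lebesgue :: (real^'n) measure" "lebesgue :: (real^'n) measure"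
    by (rule pair_sigma_finite_lebesgue)
  have v: "0 < ?v" by simp
  from ball_average obtain S where S: "S \<ge> 0"
    "\<And>c r f. 0 < r \<Longrightarrow> f \<in> borel_measurable lebesgue \<Longrightarrow>
    (\<integral>\<^sup>+x\<in>ball c r. enn_powr (\<integral>\<^sup>+y\<in>ball c r. ennreal (weight_norm p W x (f y)) \<partial>lebesgue) p \<partial>lebesgue) \<le>
    ennreal S * enn_powr (emeasure lebesgue (ball c r)) p * (\<integral>\<^sup>+y\<in>ball c r. ennreal (weight_norm p W y (f y) powr p) \<partial>lebesgue)"
    by blast
  have ind: "(\<lambda>z::(real^'n) \<times> (real^'n). indicator (ball 0 R) (fst z - snd z) :: ennreal) \<in> borel_measurable (lebesgue \<Otimes>\<^sub>M lebesgue)" for R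
    by (rule indicator_ball_diff_measurable)
  have ind_int: "(\<integral>\<^sup>+c. indicator (ball 0 R) (x - c) \<partial>lebesgue) = ennreal (?v * R ^ ?n)" if "0 \<le> R" for x :: "real^'n" and R
  proof -
    have "(\<integral>\<^sup>+c. indicator (ball 0 R) (x - c) \<partial>lebesgue) = (\<integral>\<^sup>+c. indicator (ball x R) c \<partial>lebesgue)"
      by (intro nn_integral_cong) (simp add: indicator_def dist_norm norm_minus_commute)
    then show ?thesis using emeasure_lebesgue_ball[OF that, of x] by (simp del: emeasure_completion)
  qed
  show ?thesis
  \<comment> \<open>\<open>S + 1\<close> keeps the constant positive even if S = 0, as the weights
    in Minkowski's inequality require; \<open>?v\<close> comes from the volume of the ball of radius
    R + 1.\<close>
  proof (intro exI[of _ "(S + 1) powr (1 / p) * ?v"] conjI allI impI)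
    show "0 < (S + 1) powr (1 / p) * ?v" using S(1) v by simp
    fix f :: "real^'n \<Rightarrow> complex^'m" and \<tau> R :: real
    assume fm [measurable]: "f \<in> borel_measurable lebesgue" and \<tau>: "0 \<le> \<tau>"
      and f: "Lp_modular p W f \<le> ennreal (\<tau> powr p)" and R: "0 < R"
    note [measurable] = ind[of R] ind[of 1] ind[of "R + 1"] indicator_ball_diff_measurable(2)[of 1] indicator_ball_diff_measurable(2)[of "R + 1"]
    define b where "b = ?v * (R + 1) ^ ?n"
    have b: "0 < b" using R v by (simp add: b_def)
    have bB: "emeasure lebesgue (ball c (R + 1)) = ennreal b" for c :: "real^'n"
      unfolding b_def using R by (intro emeasure_lebesgue_ball) simp
    define E where "E x = (\<integral>\<^sup>+y. ennreal (weight_norm p W x (f y)) * indicator (ball 0 R) (x - y) \<partial>lebesgue)" for x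
    define g where "g y = ennreal (weight_norm p W y (f y) powr p)" for y
    have [measurable]: "g \<in> borel_measurable lebesgue" unfolding g_def by measurable
    have [measurable]: "E \<in> borel_measurable lebesgue" unfolding E_def by measurable
    \<comment> \<open>The constant \<open>?v\<close> is rewritten as the integral over the centres c
      within distance 1 of x, and x and c are then exchanged. For such c the ball of radius R about
      x lies in the fixed ball of radius R + 1 about c.\<close>
    have "ennreal ?v * (\<integral>\<^sup>+x. enn_powr (E x) p \<partial>lebesgue) =
        (\<integral>\<^sup>+x. enn_powr (E x) p * (\<integral>\<^sup>+c. indicator (ball 0 1) (x - c) \<partial>lebesgue) \<partial>lebesgue)"
      using ind_int[of 1] by (simp add: nn_integral_multc mult.commute)
    also have "\<dots> = (\<integral>\<^sup>+x. \<integral>\<^sup>+c. enn_powr (E x) p * indicator (ball 0 1) (x - c) \<partial>lebesgue \<partial>lebesgue)"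
    proof (intro nn_integral_cong nn_integral_cmult[symmetric])
      fix x :: "real^'n"
      show "(\<lambda>c. indicator (ball 0 1) (x - c) :: ennreal) \<in> borel_measurable lebesgue"
        by (rule indicator_ball_diff_measurable)
    qed
    also have "\<dots> = (\<integral>\<^sup>+c. \<integral>\<^sup>+x. enn_powr (E x) p * indicator (ball 0 1) (x - c) \<partial>lebesgue \<partial>lebesgue)"
      by (rule Fubini') measurable
    also have "\<dots> \<le> (\<integral>\<^sup>+c. ennreal S * enn_powr (ennreal b) p * (\<integral>\<^sup>+y. g y * indicator (ball 0 (R + 1)) (y - c) \<partial>lebesgue) \<partial>lebesgue)"
    proof (rule nn_integral_mono)
      fix c :: "real^'n"
      have "(\<integral>\<^sup>+x. enn_powr (E x) p * indicator (ball 0 1) (x - c) \<partial>lebesgue) \<le>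
        (\<integral>\<^sup>+x\<in>ball c (R + 1). enn_powr (\<integral>\<^sup>+y\<in>ball c (R + 1). ennreal (weight_norm p W x (f y)) \<partial>lebesgue) p \<partial>lebesgue)"
      proof (rule nn_integral_mono)
        fix x :: "real^'n"
        show "enn_powr (E x) p * indicator (ball 0 1) (x - c) \<le>
          enn_powr (\<integral>\<^sup>+y\<in>ball c (R + 1). ennreal (weight_norm p W x (f y)) \<partial>lebesgue) p * indicator (ball c (R + 1)) x"
        proof (cases "norm (x - c) < 1")
          case True
          then have "x \<in> ball c (R + 1)" using R by (simp add: dist_norm norm_minus_commute)
          moreover have "E x \<le> (\<integral>\<^sup>+y\<in>ball c (R + 1). ennreal (weight_norm p W x (f y)) \<partial>lebesgue)"
            unfolding E_def
          proof (rule nn_integral_mono)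
            fix y
            have "norm (c - y) < R + 1" if "norm (x - y) < R"
              using norm_triangle_ineq[of "c - x" "x - y"] that True by (simp add: norm_minus_commute)
            then show "ennreal (weight_norm p W x (f y)) * indicator (ball 0 R) (x - y) \<le>
              ennreal (weight_norm p W x (f y)) * indicator (ball c (R + 1)) y"
              by (auto simp: indicator_def dist_norm norm_minus_commute)
          qed
          ultimately show ?thesis by (simp add: enn_powr_mono p_pos indicator_def)
        qed (simp add: indicator_def)
      qed
      also have "\<dots> \<le> ennreal S * enn_powr (emeasure lebesgue (ball c (R + 1))) p * (\<integral>\<^sup>+y\<in>ball c (R + 1). ennreal (weight_norm p W y (f y) powr p) \<partial>lebesgue)"
        using R by (intro S(2) fm) simp
      also have "(\<integral>\<^sup>+y\<in>ball c (R + 1). ennreal (weight_norm p W y (f y) powr p) \<partial>lebesgue) =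
          (\<integral>\<^sup>+y. g y * indicator (ball 0 (R + 1)) (y - c) \<partial>lebesgue)"
        by (intro nn_integral_cong) (simp add: g_def indicator_def dist_norm norm_minus_commute)
      finally show "(\<integral>\<^sup>+x. enn_powr (E x) p * indicator (ball 0 1) (x - c) \<partial>lebesgue) \<le>
          ennreal S * enn_powr (ennreal b) p * (\<integral>\<^sup>+y. g y * indicator (ball 0 (R + 1)) (y - c) \<partial>lebesgue)"
        by (simp only: bB)
    qed
    also have "\<dots> = ennreal S * enn_powr (ennreal b) p * (\<integral>\<^sup>+c. \<integral>\<^sup>+y. g y * indicator (ball 0 (R + 1)) (y - c) \<partial>lebesgue \<partial>lebesgue)"
    proof (rule nn_integral_cmult)
      have "(\<lambda>z::(real^'n) \<times> (real^'n). indicator (ball 0 (R + 1)) (snd z - fst z) :: ennreal) \<in> borel_measurable (lebesgue \<Otimes>\<^sub>M lebesgue)"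
        by (rule indicator_ball_diff_measurable)
      then show "(\<lambda>c. \<integral>\<^sup>+y. g y * indicator (ball 0 (R + 1)) (y - c) \<partial>lebesgue) \<in> borel_measurable lebesgue"
        by measurable
    qed
    also have "(\<integral>\<^sup>+c. \<integral>\<^sup>+y. g y * indicator (ball 0 (R + 1)) (y - c) \<partial>lebesgue \<partial>lebesgue) =
        (\<integral>\<^sup>+y. \<integral>\<^sup>+c. g y * indicator (ball 0 (R + 1)) (y - c) \<partial>lebesgue \<partial>lebesgue)"
      by (rule Fubini'[symmetric]) measurable
    also have "\<dots> = (\<integral>\<^sup>+y. g y * ennreal b \<partial>lebesgue)"
    proof (intro nn_integral_cong)
      fix y :: "real^'n"
      have "(\<integral>\<^sup>+c. g y * indicator (ball 0 (R + 1)) (y - c) \<partial>lebesgue) = g y * (\<integral>\<^sup>+c. indicator (ball 0 (R + 1)) (y - c) \<partial>lebesgue)"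
      proof (rule nn_integral_cmult)
        show "(\<lambda>c. indicator (ball 0 (R + 1)) (y - c) :: ennreal) \<in> borel_measurable lebesgue"
          by (rule indicator_ball_diff_measurable)
      qed
      then show "(\<integral>\<^sup>+c. g y * indicator (ball 0 (R + 1)) (y - c) \<partial>lebesgue) = g y * ennreal b"
        using R by (simp only: ind_int b_def)
    qed
    also have "\<dots> = Lp_modular p W f * ennreal b" unfolding Lp_modular_def g_def[symmetric] by (rule nn_integral_multc) measurable
    also have "ennreal S * enn_powr (ennreal b) p * (Lp_modular p W f * ennreal b) \<le> ennreal S * enn_powr (ennreal b) p * (ennreal (\<tau> powr p) * ennreal b)"
      using f by (intro mult_left_mono mult_right_mono) auto
    also have "\<dots> = ennreal ((b * \<tau>) powr p * S * b)"
      using b \<tau> S(1) by (simp add: enn_powr_ennreal ennreal_mult[symmetric] powr_mult mult_ac)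
    finally have "ennreal ?v * (\<integral>\<^sup>+x. enn_powr (E x) p \<partial>lebesgue) \<le> ennreal ((b * \<tau>) powr p * S * b)" .
    then have "ennreal (1 / ?v) * (ennreal ?v * (\<integral>\<^sup>+x. enn_powr (E x) p \<partial>lebesgue)) \<le> ennreal (1 / ?v) * ennreal ((b * \<tau>) powr p * S * b)"
      by (rule mult_left_mono) simp
    moreover have "ennreal (1 / ?v) * ennreal ?v = 1" using less_imp_neq[OF v] by (simp flip: ennreal_mult)
    ultimately have "(\<integral>\<^sup>+x. enn_powr (E x) p \<partial>lebesgue) \<le> ennreal (1 / ?v) * ennreal ((b * \<tau>) powr p * S * b)"
      by (simp add: mult.assoc[symmetric])
    also have "\<dots> = ennreal ((b * \<tau>) powr p * S * (R + 1) ^ ?n)"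
      using S(1) b less_imp_neq[OF v] by (simp add: ennreal_mult[symmetric] b_def mult.assoc)
    also have "\<dots> \<le> ennreal (((S + 1) powr (1 / p) * ?v * (R + 1) ^ (2 * ?n) * \<tau>) powr p)"
    proof (rule ennreal_leI)
      \<comment> \<open>One factor (R + 1)^n is left outside the p-th power, from the integration
        over the centres. Being at least 1, it is at most its own p-th power; this produces the
        exponent 2n.\<close>
      have R1: "1 \<le> (R + 1) ^ ?n" using R by (intro one_le_power) simp
      have "(R + 1) ^ ?n = ((R + 1) ^ ?n) powr 1" using R by simp
      also have "\<dots> \<le> ((R + 1) ^ ?n) powr p" using R1 p by (intro powr_mono) auto
      finally have "(b * \<tau>) powr p * S * (R + 1) ^ ?n \<le> (b * \<tau>) powr p * (S + 1) * ((R + 1) ^ ?n) powr p"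
        using S(1) R by (intro mult_mono) auto
      also have "S + 1 = ((S + 1) powr (1 / p)) powr p" using S(1) p_pos by (simp add: powr_powr)
      also have "(b * \<tau>) powr p * ((S + 1) powr (1 / p)) powr p * ((R + 1) ^ ?n) powr p =
          ((b * \<tau>) * (S + 1) powr (1 / p) * (R + 1) ^ ?n) powr p"
        using b \<tau> R by (simp add: powr_mult)
      also have "(b * \<tau>) * (S + 1) powr (1 / p) * (R + 1) ^ ?n = (S + 1) powr (1 / p) * ?v * (R + 1) ^ (2 * ?n) * \<tau>"
        unfolding b_def mult_2 power_add by (simp only: mult_ac)
      finally show "(b * \<tau>) powr p * S * (R + 1) ^ ?n \<le> ((S + 1) powr (1 / p) * ?v * (R + 1) ^ (2 * ?n) * \<tau>) powr p" .
    qed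
    finally show "(\<integral>\<^sup>+x. enn_powr (\<integral>\<^sup>+y. ennreal (weight_norm p W x (f y)) * indicator (ball 0 R) (x - y) \<partial>lebesgue) p \<partial>lebesgue) \<le>
        ennreal (((S + 1) powr (1 / p) * ?v * (R + 1) ^ (2 * ?n) * \<tau>) powr p)" unfolding E_def .
  qed
qed

text \<open>The shell with index j costs (j + 2)^(2n), against which the kernel decays with exponent
  2n + 2. The terms are then bounded in the weighted norm by multiples of 1 / (1 + j)^2 and can be
  added by Minkowski's inequality.\<close>

lemma convolution_majorant_bound:
  "\<exists>C>0. \<forall>f \<tau>. f \<in> borel_measurable lebesgue \<longrightarrow> 0 < \<tau> \<longrightarrow> Lp_modular p W f \<le> ennreal (\<tau> powr p) \<longrightarrow>
    (\<integral>\<^sup>+x. enn_powr (\<integral>\<^sup>+y. ennreal (1 / (1 + norm (x - y)) ^ (2 * CARD('n) + 2) * weight_norm p W x (f y)) \<partial>lebesgue) p \<partial>lebesgue) \<le>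
    ennreal ((C * \<tau>) powr p)"
proof -
  let ?n = "CARD('n)" and ?N = "2 * CARD('n) + 2"
  interpret pair_sigma_finite "lebesgue :: (real^'n) measure" "lebesgue :: (real^'n) measure"
    by (rule pair_sigma_finite_lebesgue)
  from translated_ball_average obtain C where C: "C > 0" "\<And>f \<tau> R. f \<in> borel_measurable lebesgue \<Longrightarrow> 0 \<le> \<tau> \<Longrightarrow>
    Lp_modular p W f \<le> ennreal (\<tau> powr p) \<Longrightarrow> 0 < R \<Longrightarrow>
    (\<integral>\<^sup>+x. enn_powr (\<integral>\<^sup>+y. ennreal (weight_norm p W x (f y)) * indicator (ball 0 R) (x - y) \<partial>lebesgue) p \<partial>lebesgue) \<le>
    ennreal ((C * (R + 1) ^ (2 * ?n) * \<tau>) powr p)" by blast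
  have ind: "(\<lambda>z::(real^'n) \<times> (real^'n). indicator (ball 0 R) (fst z - snd z) :: ennreal) \<in> borel_measurable (lebesgue \<Otimes>\<^sub>M lebesgue)" for R
    by (rule indicator_ball_diff_measurable)
  define s where "s = (\<Sum>j. 1 / (1 + real j)\<^sup>2)"
  have s: "s > 0" unfolding s_def by (intro suminf_pos summable_inverse_square) auto
  define D where "D = C * 2 ^ (2 * ?n)"
  have D: "D > 0" using C(1) by (simp add: D_def)
  show ?thesis
  proof (intro exI[of _ "D * s"] conjI allI impI)
    show "0 < D * s" using D s by simp
    fix f :: "real^'n \<Rightarrow> complex^'m" and \<tau> :: real
    assume [measurable]: "f \<in> borel_measurable lebesgue" and \<tau>: "0 < \<tau>" and f: "Lp_modular p W f \<le> ennreal (\<tau> powr p)"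
    define E where "E j x = (\<integral>\<^sup>+y. ennreal (weight_norm p W x (f y)) * indicator (ball 0 (real j + 1)) (x - y) \<partial>lebesgue)" for j x
    have [measurable]: "E j \<in> borel_measurable lebesgue" for j
      unfolding E_def using ind[of "real j + 1", measurable] by measurable
    have H: "(\<integral>\<^sup>+y. ennreal (1 / (1 + norm (x - y)) ^ ?N * weight_norm p W x (f y)) \<partial>lebesgue) \<le>
        (\<Sum>j. ennreal (1 / (1 + real j) ^ ?N) * E j x)" for x
    proof -
      have [measurable]: "(\<lambda>y. indicator (ball 0 R) (x - y) :: ennreal) \<in> borel_measurable lebesgue" for R
        by (rule indicator_ball_diff_measurable)
      have "(\<integral>\<^sup>+y. ennreal (1 / (1 + norm (x - y)) ^ ?N * weight_norm p W x (f y)) \<partial>lebesgue) \<le>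
        (\<integral>\<^sup>+y. (\<Sum>j. ennreal (1 / (1 + real j) ^ ?N) * (ennreal (weight_norm p W x (f y)) * indicator (ball 0 (real j + 1)) (x - y))) \<partial>lebesgue)"
      proof (rule nn_integral_mono)
        fix y
        have "ennreal (1 / (1 + norm (x - y)) ^ ?N * weight_norm p W x (f y)) = ennreal (1 / (1 + norm (x - y)) ^ ?N) * ennreal (weight_norm p W x (f y))"
          by (rule ennreal_mult) auto
        also have "\<dots> \<le> (\<Sum>j. ennreal (1 / (1 + real j) ^ ?N) * indicator (ball 0 (real j + 1)) (x - y)) * ennreal (weight_norm p W x (f y))"
          by (intro mult_right_mono inverse_power_le_shells) simp
        also have "\<dots> = (\<Sum>j. ennreal (1 / (1 + real j) ^ ?N) * (ennreal (weight_norm p W x (f y)) * indicator (ball 0 (real j + 1)) (x - y)))"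
          unfolding ennreal_suminf_multc[symmetric] by (intro suminf_cong) (simp only: mult_ac)
        finally show "ennreal (1 / (1 + norm (x - y)) ^ ?N * weight_norm p W x (f y)) \<le>
          (\<Sum>j. ennreal (1 / (1 + real j) ^ ?N) * (ennreal (weight_norm p W x (f y)) * indicator (ball 0 (real j + 1)) (x - y)))" .
      qed
      also have "\<dots> = (\<Sum>j. \<integral>\<^sup>+y. ennreal (1 / (1 + real j) ^ ?N) * (ennreal (weight_norm p W x (f y)) * indicator (ball 0 (real j + 1)) (x - y)) \<partial>lebesgue)"
        by (rule nn_integral_suminf) measurable
      also have "\<dots> = (\<Sum>j. ennreal (1 / (1 + real j) ^ ?N) * E j x)"
        unfolding E_def by (intro suminf_cong nn_integral_cmult) measurable
      finally show ?thesis .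
    qed
    \<comment> \<open>The prescribed bounds for the shells, which serve as weights in Minkowski's
      inequality; they are positive because \<tau> is.\<close>
    define b where "b j = D * \<tau> * (1 / (1 + real j)\<^sup>2)" for j
    have b: "b j > 0" for j using D \<tau> by (simp add: b_def add_pos_nonneg zero_less_power)
    have sb: "summable b" unfolding b_def by (intro summable_mult summable_inverse_square)
    have "(\<integral>\<^sup>+x. enn_powr (\<integral>\<^sup>+y. ennreal (1 / (1 + norm (x - y)) ^ ?N * weight_norm p W x (f y)) \<partial>lebesgue) p \<partial>lebesgue) \<le>
        (\<integral>\<^sup>+x. enn_powr (\<Sum>j. ennreal (1 / (1 + real j) ^ ?N) * E j x) p \<partial>lebesgue)"
      by (intro nn_integral_mono enn_powr_mono[OF H p_pos])
    also have "\<dots> \<le> ennreal (suminf b powr p)"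
    proof (rule nn_integral_Minkowski_suminf[OF p b sb])
      fix j
      show "(\<lambda>x. ennreal (1 / (1 + real j) ^ ?N) * E j x) \<in> borel_measurable lebesgue" by measurable
      let ?d = "1 / (1 + real j) ^ ?N"
      have "(\<integral>\<^sup>+x. enn_powr (ennreal ?d * E j x) p \<partial>lebesgue) = enn_powr (ennreal ?d) p * (\<integral>\<^sup>+x. enn_powr (E j x) p \<partial>lebesgue)"
        unfolding enn_powr_mult[OF p_pos] by (rule nn_integral_cmult) measurable
      also have "\<dots> \<le> enn_powr (ennreal ?d) p * ennreal ((C * (real j + 1 + 1) ^ (2 * ?n) * \<tau>) powr p)"
        unfolding E_def using \<tau> by (intro mult_left_mono C(2) f) auto
      also have "\<dots> = ennreal ((?d * (C * (real j + 1 + 1) ^ (2 * ?n) * \<tau>)) powr p)"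
      proof -
        have "(?d * (C * (real j + 1 + 1) ^ (2 * ?n) * \<tau>)) powr p = ?d powr p * (C * (real j + 1 + 1) ^ (2 * ?n) * \<tau>) powr p"
          by (rule powr_mult)
        then show ?thesis by (simp only: enn_powr_ennreal zero_le_divide_1_iff zero_le_power add_nonneg_nonneg of_nat_0_le_iff zero_le_one ennreal_mult powr_ge_zero)
      qed
      also have "\<dots> \<le> ennreal (b j powr p)"
      proof (intro ennreal_leI powr_mono2)
        have "(real j + 1 + 1) ^ (2 * ?n) \<le> (2 * (1 + real j)) ^ (2 * ?n)" by (intro power_mono) auto
        then have le: "(real j + 1 + 1) ^ (2 * ?n) \<le> 2 ^ (2 * ?n) * (1 + real j) ^ (2 * ?n)" by (simp only: power_mult_distrib)
        have "?d * (C * (real j + 1 + 1) ^ (2 * ?n) * \<tau>) \<le> ?d * (C * (2 ^ (2 * ?n) * (1 + real j) ^ (2 * ?n)) * \<tau>)"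
          using C(1) \<tau> le by (intro mult_left_mono mult_right_mono) auto
        also have "\<dots> = b j" by (simp add: b_def D_def power_add power2_eq_square)
        finally show "?d * (C * (real j + 1 + 1) ^ (2 * ?n) * \<tau>) \<le> b j" .
        show "0 \<le> ?d * (C * (real j + 1 + 1) ^ (2 * ?n) * \<tau>)" using C(1) \<tau> by simp
      qed (use p_pos in simp)
      finally show "(\<integral>\<^sup>+x. enn_powr (ennreal ?d * E j x) p \<partial>lebesgue) \<le> ennreal (b j powr p)" .
    qed
    also have "suminf b = D * s * \<tau>"
      unfolding b_def s_def by (subst suminf_mult[OF summable_inverse_square]) (simp add: mult_ac)
    finally show "(\<integral>\<^sup>+x. enn_powr (\<integral>\<^sup>+y. ennreal (1 / (1 + norm (x - y)) ^ ?N * weight_norm p W x (f y)) \<partial>lebesgue) p \<partial>lebesgue) \<le>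
        ennreal ((D * s * \<tau>) powr p)" .
  qed
qed

end

section \<open>Convolution operators and the embeddings\<close>

lemma matrix_vector_scalar_mult: "A *v (c *s v) = c *s (A *v v)" for A :: "complex^'m^'m"
  by (simp add: vec_eq_iff matrix_vector_mult_def sum_distrib_left mult_ac)

lemma borel_measurable_vector_scalar_mult [measurable (raw)]:
  fixes g :: "'a \<Rightarrow> complex^'m"
  assumes [measurable]: "c \<in> borel_measurable M" "g \<in> borel_measurable M"
  shows "(\<lambda>x. c x *s g x) \<in> borel_measurable M"
  by (intro borel_measurable_vecI) simp

text \<open>No Fourier inversion is needed here, only Fubini.\<close>
lemma fourier_mult_inv_fourier:
  fixes h \<psi> :: "real^'n \<Rightarrow> complex"
  assumes h: "h \<in> schwartz" and \<psi>: "\<psi> \<in> schwartz"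
  shows "fourier (\<lambda>\<xi>. h \<xi> * inv_fourier \<psi> \<xi>) y =
    (LINT x|lebesgue. \<psi> x * (of_real ((2 * pi) powr (- real CARD('n) / 2)) * inv_fourier h (x - y)))"
proof -
  interpret pair_sigma_finite "lebesgue :: (real^'n) measure" "lebesgue :: (real^'n) measure"
    by (rule pair_sigma_finite_lebesgue)
  let ?c = "complex_of_real ((2 * pi) powr (- real CARD('n) / 2))"
  let ?h = "\<lambda>x \<xi>. \<psi> x * (h \<xi> * cis ((x - y) \<bullet> \<xi>))"
  have "integrable (lebesgue \<Otimes>\<^sub>M lebesgue) (\<lambda>(x, \<xi>). ?h x \<xi>)"
  proof (rule integrable_pair_bound[OF _ integrable_norm[OF schwartz_integrable[OF \<psi>]] integrable_norm[OF schwartz_integrable[OF h]]])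
    show "(\<lambda>(x, \<xi>). ?h x \<xi>) \<in> borel_measurable (lebesgue \<Otimes>\<^sub>M lebesgue)"
    proof (rule lebesgue_pair_borel_measurable, rule borel_measurable_continuous_onI)
      have "continuous_on UNIV (\<lambda>z::(real^'n) \<times> (real^'n). \<psi> (fst z))" "continuous_on UNIV (\<lambda>z::(real^'n) \<times> (real^'n). h (snd z))"
        using continuous_on_compose2[OF smooth_continuous_on[OF schwartz_smooth[OF \<psi>], of UNIV] continuous_on_fst[OF continuous_on_id]]
          continuous_on_compose2[OF smooth_continuous_on[OF schwartz_smooth[OF h], of UNIV] continuous_on_snd[OF continuous_on_id]] by simp_all
      then show "continuous_on UNIV (\<lambda>(x, \<xi>). ?h x \<xi>)"
        unfolding split_beta by (intro continuous_intros) auto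
    qed
  qed (auto simp: norm_mult)
  note Fub = Fubini_integral[OF this]
  have "fourier (\<lambda>\<xi>. h \<xi> * inv_fourier \<psi> \<xi>) y = ?c * (LINT \<xi>|lebesgue. ?c * (LINT x|lebesgue. ?h x \<xi>))"
    unfolding fourier_def
  proof (rule arg_cong2[of _ _ _ _ "(*)"], rule refl, rule Bochner_Integration.integral_cong[OF refl])
    fix \<xi>
    have "(LINT x|lebesgue. \<psi> x * cis (\<xi> \<bullet> x)) * (h \<xi> * cis (- (\<xi> \<bullet> y))) = (LINT x|lebesgue. \<psi> x * cis (\<xi> \<bullet> x) * (h \<xi> * cis (- (\<xi> \<bullet> y))))"
      by (rule integral_mult_left_zero[symmetric])
    also have "\<dots> = (LINT x|lebesgue. ?h x \<xi>)"
    proof (intro Bochner_Integration.integral_cong refl)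
      fix x
      have "cis ((x - y) \<bullet> \<xi>) = cis (\<xi> \<bullet> x) * cis (- (\<xi> \<bullet> y))"
        by (simp add: inner_commute[of "x - y" \<xi>] inner_diff_right cis_mult)
      then show "\<psi> x * cis (\<xi> \<bullet> x) * (h \<xi> * cis (- (\<xi> \<bullet> y))) = ?h x \<xi>" by (simp only: mult_ac)
    qed
    finally have e: "(LINT x|lebesgue. \<psi> x * cis (\<xi> \<bullet> x)) * (h \<xi> * cis (- (\<xi> \<bullet> y))) = (LINT x|lebesgue. ?h x \<xi>)" .
    have "h \<xi> * inv_fourier \<psi> \<xi> * cis (- (\<xi> \<bullet> y)) = ?c * ((LINT x|lebesgue. \<psi> x * cis (\<xi> \<bullet> x)) * (h \<xi> * cis (- (\<xi> \<bullet> y))))"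
      unfolding inv_fourier_def by (simp only: mult_ac)
    then show "h \<xi> * inv_fourier \<psi> \<xi> * cis (- (\<xi> \<bullet> y)) = ?c * (LINT x|lebesgue. ?h x \<xi>)" unfolding e .
  qed
  also have "\<dots> = ?c * (?c * (LINT x|lebesgue. LINT \<xi>|lebesgue. ?h x \<xi>))" using Fub by simp
  also have "\<dots> = (LINT x|lebesgue. ?c * (?c * (LINT \<xi>|lebesgue. ?h x \<xi>)))" by simp
  also have "\<dots> = (LINT x|lebesgue. \<psi> x * (?c * inv_fourier h (x - y)))"
  proof (intro Bochner_Integration.integral_cong refl)
    fix x
    have "(LINT \<xi>|lebesgue. ?h x \<xi>) = \<psi> x * (LINT \<xi>|lebesgue. h \<xi> * cis ((x - y) \<bullet> \<xi>))" by (rule integral_mult_right_zero)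
    then show "?c * (?c * (LINT \<xi>|lebesgue. ?h x \<xi>)) = \<psi> x * (?c * inv_fourier h (x - y))"
      unfolding inv_fourier_def by (simp only: mult_ac)
  qed
  finally show ?thesis .
qed

text \<open>Peetre's inequality 1 + |y| \<le> (1 + |x|) (1 + |x - y|) trades decay away from x for
  decay away from the origin, at the price of polynomial growth in x.\<close>

lemma peetre_inverse_power:
  fixes x y :: "'a::real_normed_vector"
  assumes "N \<le> M"
  shows "1 / (1 + norm (x - y)) ^ M \<le> (1 + norm x) ^ M * (1 / (1 + norm y) ^ N)"
proof -
  have "norm y \<le> norm x + norm (x - y)" using norm_triangle_ineq4[of x "x - y"] by simp
  also have "1 + \<dots> \<le> (1 + norm x) * (1 + norm (x - y))" by (simp add: algebra_simps)
  finally have "1 + norm y \<le> (1 + norm x) * (1 + norm (x - y))" by simp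
  then have "(1 + norm y) ^ M \<le> ((1 + norm x) * (1 + norm (x - y))) ^ M" by (intro power_mono) auto
  moreover have "(1 + norm y) ^ N \<le> (1 + norm y) ^ M" using assms by (intro power_increasing) auto
  ultimately have "(1 + norm y) ^ N \<le> (1 + norm x) ^ M * (1 + norm (x - y)) ^ M" by (simp add: power_mult_distrib)
  moreover have "0 < (1 + norm y) ^ N" "0 < (1 + norm (x - y)) ^ M" by (auto intro!: zero_less_power add_pos_nonneg)
  ultimately show ?thesis by (simp add: field_simps)
qed

section \<open>Tempered distributions and enumeration of the lattice\<close>

lemma schwartz_0: "(\<lambda>_. 0) \<in> schwartz"
  by (rule schwartzI) (auto simp: smooth_const pderivs_const)

lemma tempered_cmult: "tempered u \<Longrightarrow> f \<in> schwartz \<Longrightarrow> u (\<lambda>x. c * f x) = c * u f"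
  by (simp add: tempered_def)

lemma tempered_add: "tempered u \<Longrightarrow> f \<in> schwartz \<Longrightarrow> g \<in> schwartz \<Longrightarrow> u (\<lambda>x. f x + g x) = u f + u g"
  by (simp add: tempered_def)

lemma tempered_sum:
  fixes f :: "nat \<Rightarrow> real^'n \<Rightarrow> complex"
  assumes u: "tempered u" and f: "\<And>i. f i \<in> schwartz"
  shows "u (\<lambda>x. \<Sum>i<J. f i x) = (\<Sum>i<J. u (f i))"
proof (induction J)
  case 0
  show ?case using tempered_cmult[OF u schwartz_0, of 0] by simp
next
  case (Suc J)
  have "(\<lambda>x. \<Sum>i<J. f i x) \<in> schwartz" by (rule schwartz_sum[OF f])
  from tempered_add[OF u this f[of J]] Suc show ?case by simp
qed

lemma tempered_bound: "tempered u \<Longrightarrow> \<exists>C N. 0 \<le> C \<and> (\<forall>f\<in>schwartz. norm (u f) \<le> C * schwartz_norm N f)"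
proof -
  assume "tempered u"
  then obtain C N where C: "\<forall>f\<in>schwartz. norm (u f) \<le> C * schwartz_norm N f" unfolding tempered_def by blast
  have "norm (u f) \<le> \<bar>C\<bar> * schwartz_norm N f" if "f \<in> schwartz" for f
    using C that mult_right_mono[OF abs_ge_self[of C] schwartz_norm_nonneg[OF that, of N]] by force
  then show ?thesis by (intro exI[of _ "\<bar>C\<bar>"] exI[of _ N]) simp
qed

lemma tempered_diff:
  assumes u: "tempered u" and v: "tempered v" shows "tempered (\<lambda>\<psi>. v \<psi> - u \<psi>)"
proof -
  from tempered_bound[OF u] tempered_bound[OF v] obtain C N D M where
    CN: "0 \<le> C" "\<And>f. f \<in> schwartz \<Longrightarrow> norm (u f) \<le> C * schwartz_norm N f" and
    DM: "0 \<le> D" "\<And>f. f \<in> schwartz \<Longrightarrow> norm (v f) \<le> D * schwartz_norm M f" by blast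
  have "norm (v f - u f) \<le> (C + D) * schwartz_norm (max N M) f" if f: "f \<in> schwartz" for f
  proof -
    have "norm (v f - u f) \<le> D * schwartz_norm M f + C * schwartz_norm N f"
      using CN(2)[OF f] DM(2)[OF f] norm_triangle_ineq4[of "v f" "u f"] by linarith
    also have "\<dots> \<le> D * schwartz_norm (max N M) f + C * schwartz_norm (max N M) f"
      using CN(1) DM(1) f by (intro add_mono mult_left_mono schwartz_norm_mono) auto
    finally show ?thesis by (simp add: algebra_simps)
  qed
  then have "\<exists>C N. \<forall>f\<in>schwartz. norm (v f - u f) \<le> C * schwartz_norm N f" by blast
  then show ?thesis unfolding tempered_def
    by (simp add: tempered_add[OF u] tempered_add[OF v] tempered_cmult[OF u] tempered_cmult[OF v] right_diff_distrib)
qed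

text \<open>Nonnegative extended sums always exist and do not depend on the order. The sum over the
  lattice thus becomes a series, to which monotone and dominated convergence apply.\<close>

lemma infsum_ennreal_eq_suminf:
  fixes d :: "'a \<Rightarrow> ennreal" and e :: "nat \<Rightarrow> 'a"
  assumes "bij e" shows "infsum d UNIV = (\<Sum>j. d (e j))"
proof -
  have "infsum d UNIV = infsum (\<lambda>j. d (e j)) UNIV" using infsum_reindex_bij_betw[OF assms, of d] by simp
  moreover have "((\<lambda>j. d (e j)) has_sum infsum (\<lambda>j. d (e j)) UNIV) UNIV"
    by (intro has_sum_infsum nonneg_summable_on_complete) simp
  ultimately show ?thesis using has_sum_imp_sums sums_unique by metis
qed

lemma ex_bij_nat_int_vec: "\<exists>e :: nat \<Rightarrow> int^'n. bij e"
proof -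
  have "inj (\<lambda>z::int. (\<chi> i. z) :: int^'n)" by (auto simp: inj_on_def vec_eq_iff)
  then have "infinite (UNIV :: (int^'n) set)" using infinite_UNIV_int finite_imageD finite_subset[OF subset_UNIV] by blast
  then have "bij_betw (from_nat_into (UNIV :: (int^'n) set)) UNIV UNIV" by (intro bij_betw_from_nat_into) auto
  then show ?thesis by blast
qed

section \<open>The two embeddings\<close>

context Ap_weight
begin

text \<open>The Schwartz norm of order n + 2 supplies exactly the weight of
  \<open>weighted_L1_bound\<close>. Bounding the integral of the modulus, and not only the pairing,
  later allows termwise integration of a series.\<close>

lemma schwartz_pairing_bound:
  "\<exists>C\<ge>0. \<forall>f \<tau> j. \<forall>\<psi>\<in>schwartz. f \<in> borel_measurable lebesgue \<longrightarrow> 0 \<le> \<tau> \<longrightarrow> Lp_modular p W f \<le> ennreal (\<tau> powr p) \<longrightarrow>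
    integrable lebesgue (\<lambda>x. f x $ j * \<psi> x) \<and>
    (LINT x|lebesgue. norm (f x $ j * \<psi> x)) \<le> C * \<tau> * schwartz_norm (CARD('n) + 2) \<psi>"
proof -
  let ?N = "CARD('n) + 2"
  from weighted_L1_bound obtain C where C: "C \<ge> 0" "\<And>f \<tau>. f \<in> borel_measurable lebesgue \<Longrightarrow> 0 \<le> \<tau> \<Longrightarrow>
    Lp_modular p W f \<le> ennreal (\<tau> powr p) \<Longrightarrow> (\<integral>\<^sup>+y. ennreal (1 / (1 + norm y) ^ ?N * norm (f y)) \<partial>lebesgue) \<le> ennreal (C * \<tau>)"
    by blast
  show ?thesis
  proof (intro exI[of _ C] conjI C(1) allI ballI impI)
    fix f :: "real^'n \<Rightarrow> complex^'m" and \<tau> j and \<psi> :: "real^'n \<Rightarrow> complex"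
    assume \<psi>: "\<psi> \<in> schwartz" and [measurable]: "f \<in> borel_measurable lebesgue" and \<tau>: "0 \<le> \<tau>" and f: "Lp_modular p W f \<le> ennreal (\<tau> powr p)"
    note [measurable] = borel_imp_lebesgue_measurable[OF schwartz_borel_measurable[OF \<psi>]]
    have m: "(\<lambda>x. f x $ j * \<psi> x) \<in> borel_measurable lebesgue" by measurable
    let ?s = "schwartz_norm ?N \<psi>"
    have s: "0 \<le> ?s" by (rule schwartz_norm_nonneg[OF \<psi>])
    have wm: "(\<lambda>x. ennreal (1 / (1 + norm x) ^ ?N * norm (f x))) \<in> borel_measurable lebesgue"
    proof -
      have [measurable]: "(\<lambda>x::real^'n. 1 / (1 + norm x) ^ ?N) \<in> borel_measurable lebesgue"
        by (rule borel_imp_lebesgue_measurable) measurable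
      show ?thesis by measurable
    qed
    have le: "norm (f x $ j * \<psi> x) \<le> ?s * (1 / (1 + norm x) ^ ?N * norm (f x))" for x
    proof -
      have "norm (\<psi> x) \<le> ?s * (1 / (1 + norm x) ^ ?N)"
        using schwartz_norm_upper[OF \<psi>, of "[]" ?N x] by (simp add: field_simps add_pos_nonneg)
      then have "norm (f x $ j) * norm (\<psi> x) \<le> norm (f x) * (?s * (1 / (1 + norm x) ^ ?N))"
        by (intro mult_mono Finite_Cartesian_Product.norm_nth_le) auto
      then show ?thesis by (simp add: norm_mult mult_ac)
    qed
    have "(\<integral>\<^sup>+x. ennreal (norm (f x $ j * \<psi> x)) \<partial>lebesgue) \<le> (\<integral>\<^sup>+x. ennreal ?s * ennreal (1 / (1 + norm x) ^ ?N * norm (f x)) \<partial>lebesgue)"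
      using le s by (intro nn_integral_mono) (simp add: ennreal_mult[symmetric] ennreal_leI)
    also have "\<dots> = ennreal ?s * (\<integral>\<^sup>+x. ennreal (1 / (1 + norm x) ^ ?N * norm (f x)) \<partial>lebesgue)"
      by (rule nn_integral_cmult[OF wm])
    also have "\<dots> \<le> ennreal ?s * ennreal (C * \<tau>)" by (intro mult_left_mono C(2) \<tau> f) auto
    also have "\<dots> = ennreal (C * \<tau> * ?s)" using s C(1) \<tau> by (simp add: ennreal_mult[symmetric] mult.commute)
    finally have I: "(\<integral>\<^sup>+x. ennreal (norm (f x $ j * \<psi> x)) \<partial>lebesgue) \<le> ennreal (C * \<tau> * ?s)" .
    then show int: "integrable lebesgue (\<lambda>x. f x $ j * \<psi> x)"
      by (intro integrableI_bounded m) (auto simp: less_top[symmetric] top_unique)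
    have "ennreal (LINT x|lebesgue. norm (f x $ j * \<psi> x)) = (\<integral>\<^sup>+x. ennreal (norm (f x $ j * \<psi> x)) \<partial>lebesgue)"
      by (rule nn_integral_eq_integral[OF integrable_norm[OF int], symmetric]) simp
    with I have "ennreal (LINT x|lebesgue. norm (f x $ j * \<psi> x)) \<le> ennreal (C * \<tau> * ?s)" by simp
    then show "(LINT x|lebesgue. norm (f x $ j * \<psi> x)) \<le> C * \<tau> * ?s"
      using s C(1) \<tau> by (subst (asm) ennreal_le_iff) auto
  qed
qed

lemma Lp_norm_le_obtain:
  assumes "Lp_norm p W f < \<top>" obtains \<tau> where "0 < \<tau>" "Lp_modular p W f \<le> ennreal (\<tau> powr p)"
proof -
  from assms obtain r where r: "Lp_norm p W f = ennreal r" "0 \<le> r" by (cases "Lp_norm p W f") auto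
  then have "Lp_norm p W f \<le> ennreal (r + 1)" by (simp add: ennreal_leI del: ennreal_plus)
  then have "Lp_modular p W f \<le> ennreal ((r + 1) powr p)" using r(2) by (subst (asm) Lp_norm_le_iff[OF p]) auto
  then show ?thesis using r(2) by (intro that[of "r + 1"]) auto
qed

lemma Lp_represents:
  assumes "f \<in> Lp p W" shows "\<exists>u\<in>temp_dists. represents f u"
proof -
  from assms have fm: "f \<in> borel_measurable lebesgue" and "Lp_norm p W f < \<top>" by (auto simp: Lp_def)
  from Lp_norm_le_obtain[OF this(2)] obtain \<tau> where \<tau>: "0 < \<tau>" "Lp_modular p W f \<le> ennreal (\<tau> powr p)" .
  from schwartz_pairing_bound obtain C where C: "C \<ge> 0" "\<And>f \<tau> j \<psi>. \<psi> \<in> schwartz \<Longrightarrow> f \<in> borel_measurable lebesgue \<Longrightarrow> 0 \<le> \<tau> \<Longrightarrow>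
    Lp_modular p W f \<le> ennreal (\<tau> powr p) \<Longrightarrow> integrable lebesgue (\<lambda>x. f x $ j * \<psi> x) \<and>
    (LINT x|lebesgue. norm (f x $ j * \<psi> x)) \<le> C * \<tau> * schwartz_norm (CARD('n) + 2) \<psi>" by blast
  have int: "integrable lebesgue (\<lambda>x. f x $ j * \<psi> x)" if "\<psi> \<in> schwartz" for j \<psi>
    using C(2)[OF that fm less_imp_le[OF \<tau>(1)] \<tau>(2)] by blast
  have bd: "norm (LINT x|lebesgue. f x $ j * \<psi> x) \<le> C * \<tau> * schwartz_norm (CARD('n) + 2) \<psi>" if "\<psi> \<in> schwartz" for j \<psi>
    by (rule order_trans[OF integral_norm_bound conjunct2[OF C(2)[OF that fm less_imp_le[OF \<tau>(1)] \<tau>(2)]]])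
  define u where "u j \<psi> = (LINT x|lebesgue. f x $ j * \<psi> x)" for j \<psi>
  have "tempered (u j)" for j
    unfolding tempered_def u_def
  proof (intro conjI ballI allI exI)
    fix g h :: "real^'n \<Rightarrow> complex" and c assume g: "g \<in> schwartz"
    show "(LINT x|lebesgue. f x $ j * (c * g x)) = c * (LINT x|lebesgue. f x $ j * g x)"
      by (simp add: mult.left_commute)
    assume h: "h \<in> schwartz"
    show "(LINT x|lebesgue. f x $ j * (g x + h x)) = (LINT x|lebesgue. f x $ j * g x) + (LINT x|lebesgue. f x $ j * h x)"
      using int[OF g, of j] int[OF h, of j] by (simp add: distrib_left)
  qed (rule bd)
  moreover have "represents f u" using fm int by (simp add: represents_def u_def)
  ultimately show ?thesis unfolding temp_dists_def by blast
qed

text \<open>The function representing the localized distribution is g, the convolution of f with K.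
  Its weighted norm is controlled through the majorant H; that it represents the right distribution
  follows by moving the operator to the test function and applying Fubini's theorem.\<close>

lemma kernel_operator_bound:
  fixes \<phi> :: "int^'n \<Rightarrow> real^'n \<Rightarrow> complex"
  assumes \<phi>: "\<phi> \<in> Y_family"
  shows "\<exists>C>0. \<forall>f u \<tau> k. represents f u \<longrightarrow> 0 < \<tau> \<longrightarrow> Lp_norm p W f \<le> ennreal \<tau> \<longrightarrow>
    dist_Lp_norm p W (freq_proj (\<phi> k) u) \<le> ennreal (C * \<tau>)"
proof -
  let ?c = "(2 * pi) powr (- real CARD('n) / 2)" and ?M = "2 * CARD('n) + 2" and ?N = "CARD('n) + 2"
  interpret pair_sigma_finite "lebesgue :: (real^'n) measure" "lebesgue :: (real^'n) measure"
    by (rule pair_sigma_finite_lebesgue)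
  from Y_family_kernel_bound[OF \<phi>, of ?M] obtain A where A: "0 \<le> A" "\<And>k z. (1 + norm z) ^ ?M * norm (inv_fourier (\<phi> k) z) \<le> A" by blast
  \<comment> \<open>\<open>A + 1\<close> keeps D positive even if A = 0.\<close>
  define D where "D = ?c * (A + 1)"
  have D: "0 < D" using A(1) by (simp add: D_def)
  from convolution_majorant_bound obtain C where C: "C > 0" "\<And>f \<tau>. f \<in> borel_measurable lebesgue \<Longrightarrow> 0 < \<tau> \<Longrightarrow>
    Lp_modular p W f \<le> ennreal (\<tau> powr p) \<Longrightarrow>
    (\<integral>\<^sup>+x. enn_powr (\<integral>\<^sup>+y. ennreal (1 / (1 + norm (x - y)) ^ ?M * weight_norm p W x (f y)) \<partial>lebesgue) p \<partial>lebesgue) \<le>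
    ennreal ((C * \<tau>) powr p)" by blast
  from weighted_L1_bound obtain B where B: "B \<ge> 0" "\<And>f \<tau>. f \<in> borel_measurable lebesgue \<Longrightarrow> 0 \<le> \<tau> \<Longrightarrow>
    Lp_modular p W f \<le> ennreal (\<tau> powr p) \<Longrightarrow> (\<integral>\<^sup>+y. ennreal (1 / (1 + norm y) ^ ?N * norm (f y)) \<partial>lebesgue) \<le> ennreal (B * \<tau>)" by blast
  show ?thesis
  proof (intro exI[of _ "D * C"] conjI allI impI)
    show "0 < D * C" using D C(1) by simp
    fix f :: "real^'n \<Rightarrow> complex^'m" and u \<tau> k
    assume fu: "represents f u" and \<tau>: "0 < \<tau>" and "Lp_norm p W f \<le> ennreal \<tau>"
    then have f: "Lp_modular p W f \<le> ennreal (\<tau> powr p)" using Lp_norm_le_iff[OF p less_imp_le[OF \<tau>], of W f] by blast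
    from fu have fm [measurable]: "f \<in> borel_measurable lebesgue" by (simp add: represents_def)
    define K where "K z = of_real ?c * inv_fourier (\<phi> k) z" for z
    have Kb: "K \<in> borel_measurable borel"
      unfolding K_def using schwartz_borel_measurable[OF schwartz_inv_fourier[OF Y_family_schwartz[OF \<phi>]]] by measurable
    have Kle: "norm (K z) \<le> D * (1 / (1 + norm z) ^ ?M)" for z
    proof -
      have pos: "0 < (1 + norm z) ^ ?M" by (intro zero_less_power add_pos_nonneg) auto
      have "norm (K z) = ?c * norm (inv_fourier (\<phi> k) z)" by (simp add: K_def norm_mult)
      also have "\<dots> \<le> ?c * ((A + 1) * (1 / (1 + norm z) ^ ?M))"
        using A(2)[of z k] pos by (intro mult_left_mono) (auto simp: le_divide_eq mult.commute intro: order_trans)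
      finally show ?thesis by (simp add: D_def)
    qed
    have diffm: "(\<lambda>z. fst z - snd z) \<in> measurable borel (borel :: (real^'n) measure)" "(\<lambda>y. x - y) \<in> measurable borel (borel :: (real^'n) measure)" for x
      by (intro borel_measurable_continuous_onI continuous_intros)+
    have [measurable]: "(\<lambda>z. K (fst z - snd z)) \<in> borel_measurable (lebesgue \<Otimes>\<^sub>M lebesgue)"
      by (rule lebesgue_pair_borel_measurable, rule measurable_compose[OF diffm(1) Kb])
    have [measurable]: "(\<lambda>y. K (x - y)) \<in> borel_measurable lebesgue" for x
      by (rule borel_imp_lebesgue_measurable, rule measurable_compose[OF diffm(2) Kb])
    have Pb: "(\<lambda>z::real^'n. 1 / (1 + norm z) ^ ?M) \<in> borel_measurable borel" by measurable
    have [measurable]: "(\<lambda>z::(real^'n) \<times> (real^'n). 1 / (1 + norm (fst z - snd z)) ^ ?M) \<in> borel_measurable (lebesgue \<Otimes>\<^sub>M lebesgue)"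
      by (rule lebesgue_pair_borel_measurable, rule measurable_compose[OF diffm(1) Pb])
    have [measurable]: "(\<lambda>y::real^'n. 1 / (1 + norm (x - y)) ^ ?M) \<in> borel_measurable lebesgue" for x
      by (rule borel_imp_lebesgue_measurable, rule measurable_compose[OF diffm(2) Pb])
    have [measurable]: "(\<lambda>y::real^'n. 1 / (1 + norm y) ^ ?N) \<in> borel_measurable lebesgue"
      by (rule borel_imp_lebesgue_measurable) measurable
    define w where "w y = 1 / (1 + norm y) ^ ?N * norm (f y)" for y
    have w_nonneg: "0 \<le> w y" for y by (simp add: w_def)
    have wint: "integrable lebesgue w"
    proof (rule integrableI_bounded)
      show "w \<in> borel_measurable lebesgue" unfolding w_def by measurable
      have "(\<integral>\<^sup>+y. ennreal (w y) \<partial>lebesgue) \<le> ennreal (B * \<tau>)"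
        unfolding w_def by (rule B(2)[OF fm less_imp_le[OF \<tau>] f])
      then show "(\<integral>\<^sup>+y. ennreal (norm (w y)) \<partial>lebesgue) < \<infinity>"
        using w_nonneg by (simp add: le_less_trans[OF _ ennreal_less_top])
    qed
    \<comment> \<open>The growth in x is harmless: x is fixed when the convolution integral is
      formed, and the test function absorbs the growth in the application of Fubini's
      theorem.\<close>
    have Kw: "norm (K (x - y)) * norm (f y) \<le> D * (1 + norm x) ^ ?M * w y" for x y
    proof -
      have "norm (K (x - y)) * norm (f y) \<le> (D * (1 / (1 + norm (x - y)) ^ ?M)) * norm (f y)"
        by (intro mult_right_mono Kle) simp
      also have "\<dots> \<le> (D * ((1 + norm x) ^ ?M * (1 / (1 + norm y) ^ ?N))) * norm (f y)"
        using D by (intro mult_right_mono mult_left_mono peetre_inverse_power) auto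
      finally show ?thesis by (simp only: w_def mult.assoc)
    qed
    define g where "g x = (LINT y|lebesgue. K (x - y) *s f y)" for x
    have gint: "integrable lebesgue (\<lambda>y. K (x - y) *s f y)" for x
    proof (rule Bochner_Integration.integrable_bound[OF integrable_mult_right[OF wint, of "D * (1 + norm x) ^ ?M"]])
      show "AE y in lebesgue. norm (K (x - y) *s f y) \<le> norm (D * (1 + norm x) ^ ?M * w y)"
        using Kw D w_nonneg by (intro AE_I2) (simp add: norm_vector_scalar_mult abs_mult)
    qed measurable
    have gm [measurable]: "g \<in> borel_measurable lebesgue"
      unfolding g_def by (rule sigma_finite_measure.borel_measurable_lebesgue_integral[OF sigma_finite_lebesgue]) measurable
    define H where "H x = (\<integral>\<^sup>+y. ennreal (1 / (1 + norm (x - y)) ^ ?M * weight_norm p W x (f y)) \<partial>lebesgue)" for x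
    have Hm [measurable]: "H \<in> borel_measurable lebesgue"
      unfolding H_def by measurable
    have gH: "ennreal (weight_norm p W x (g x)) \<le> ennreal D * H x" for x
    proof -
      let ?V = "mat_powr (W x) (1 / p)"
      \<comment> \<open>The matrix is evaluated at x, so it is constant in the variable of
        integration and passes under the integral; this produces the weight at x and the function at
        y, the form handled by \<open>convolution_majorant_bound\<close>.\<close>
      have "?V *v g x = (LINT y|lebesgue. ?V *v (K (x - y) *s f y))"
        unfolding g_def by (rule integral_bounded_linear[OF matrix_vector_mul_bounded_linear gint, symmetric])
      then have "ennreal (weight_norm p W x (g x)) \<le> (\<integral>\<^sup>+y. ennreal (norm (?V *v (K (x - y) *s f y))) \<partial>lebesgue)"
        unfolding weight_norm_def
        using integral_norm_bound_ennreal[OF integrable_bounded_linear[OF matrix_vector_mul_bounded_linear gint[of x], of ?V]] by simp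
      also have "\<dots> \<le> (\<integral>\<^sup>+y. ennreal D * ennreal (1 / (1 + norm (x - y)) ^ ?M * weight_norm p W x (f y)) \<partial>lebesgue)"
      proof (rule nn_integral_mono)
        fix y
        have "norm (?V *v (K (x - y) *s f y)) = norm (K (x - y)) * weight_norm p W x (f y)"
          by (simp add: matrix_vector_scalar_mult norm_vector_scalar_mult weight_norm_def)
        also have "\<dots> \<le> (D * (1 / (1 + norm (x - y)) ^ ?M)) * weight_norm p W x (f y)" by (intro mult_right_mono Kle) simp
        finally have "norm (?V *v (K (x - y) *s f y)) \<le> D * (1 / (1 + norm (x - y)) ^ ?M * weight_norm p W x (f y))" by (simp only: mult.assoc)
        then have "ennreal (norm (?V *v (K (x - y) *s f y))) \<le> ennreal (D * (1 / (1 + norm (x - y)) ^ ?M * weight_norm p W x (f y)))" by (rule ennreal_leI)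
        also have "\<dots> = ennreal D * ennreal (1 / (1 + norm (x - y)) ^ ?M * weight_norm p W x (f y))" using D by (intro ennreal_mult) auto
        finally show "ennreal (norm (?V *v (K (x - y) *s f y))) \<le> ennreal D * ennreal (1 / (1 + norm (x - y)) ^ ?M * weight_norm p W x (f y))" .
      qed
      also have "\<dots> = ennreal D * H x" unfolding H_def by (rule nn_integral_cmult) measurable
      finally show ?thesis .
    qed
    have "Lp_modular p W g = (\<integral>\<^sup>+x. enn_powr (ennreal (weight_norm p W x (g x))) p \<partial>lebesgue)"
      unfolding Lp_modular_def by (simp add: enn_powr_ennreal)
    also have "\<dots> \<le> (\<integral>\<^sup>+x. enn_powr (ennreal D) p * enn_powr (H x) p \<partial>lebesgue)"
      unfolding enn_powr_mult[OF p_pos, symmetric] by (intro nn_integral_mono enn_powr_mono[OF gH p_pos])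
    also have "\<dots> = enn_powr (ennreal D) p * (\<integral>\<^sup>+x. enn_powr (H x) p \<partial>lebesgue)" by (rule nn_integral_cmult) measurable
    also have "\<dots> \<le> enn_powr (ennreal D) p * ennreal ((C * \<tau>) powr p)"
      unfolding H_def by (intro mult_left_mono C(2)[OF fm \<tau> f]) simp
    also have "\<dots> = ennreal ((D * C * \<tau>) powr p)"
      using D C(1) \<tau> by (simp add: enn_powr_ennreal ennreal_mult[symmetric] powr_mult mult.assoc)
    finally have gLp: "Lp_norm p W g \<le> ennreal (D * C * \<tau>)"
      using D C(1) \<tau> by (subst Lp_norm_le_iff[OF p]) auto
    have "represents g (freq_proj (\<phi> k) u)"
      unfolding represents_def
    proof (intro conjI gm allI ballI)
      fix j and \<psi> :: "real^'n \<Rightarrow> complex" assume \<psi>: "\<psi> \<in> schwartz"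
      note [measurable] = borel_imp_lebesgue_measurable[OF schwartz_borel_measurable[OF \<psi>]]
      define h where "h x y = \<psi> x * (K (x - y) * f y $ j)" for x y
      have hint: "integrable (lebesgue \<Otimes>\<^sub>M lebesgue) (\<lambda>(x, y). h x y)"
      proof (rule integrable_pair_bound[OF _ integrable_mult_right[OF schwartz_integrable_power[OF \<psi>, of ?M], of D] wint])
        show "(\<lambda>(x, y). h x y) \<in> borel_measurable (lebesgue \<Otimes>\<^sub>M lebesgue)" unfolding h_def by measurable
        fix x y
        have "norm (K (x - y) * f y $ j) \<le> D * (1 + norm x) ^ ?M * w y"
          using Kw[of x y] mult_left_mono[OF Finite_Cartesian_Product.norm_nth_le[of "f y" j], of "norm (K (x - y))"] by (simp add: norm_mult)
        from mult_left_mono[OF this, of "norm (\<psi> x)"]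
        show "norm (case (x, y) of (x, y) \<Rightarrow> h x y) \<le> D * ((1 + norm x) ^ ?M * norm (\<psi> x)) * w y"
          by (simp add: h_def norm_mult mult_ac)
      qed (use D w_nonneg in auto)
      have hx: "(LINT y|lebesgue. h x y) = g x $ j * \<psi> x" for x
      proof -
        have "g x $ j = (LINT y|lebesgue. (K (x - y) *s f y) $ j)"
          unfolding g_def by (rule integral_bounded_linear[OF bounded_linear_vec_nth gint, symmetric])
        then show ?thesis unfolding h_def by (simp add: mult.commute)
      qed
      have hy: "(LINT x|lebesgue. h x y) = f y $ j * fourier (\<lambda>\<xi>. \<phi> k \<xi> * inv_fourier \<psi> \<xi>) y" for y
      proof -
        have "f y $ j * fourier (\<lambda>\<xi>. \<phi> k \<xi> * inv_fourier \<psi> \<xi>) y = f y $ j * (LINT x|lebesgue. \<psi> x * K (x - y))"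
          unfolding K_def by (simp only: fourier_mult_inv_fourier[OF Y_family_schwartz[OF \<phi>] \<psi>])
        also have "\<dots> = (LINT x|lebesgue. f y $ j * (\<psi> x * K (x - y)))" by (rule integral_mult_right_zero[symmetric])
        finally show ?thesis unfolding h_def by (simp only: mult_ac)
      qed
      show "integrable lebesgue (\<lambda>x. g x $ j * \<psi> x)"
        using integrable_fst'[OF hint] by (simp add: hx)
      have S: "fourier (\<lambda>\<xi>. \<phi> k \<xi> * inv_fourier \<psi> \<xi>) \<in> schwartz"
        by (intro schwartz_fourier Y_family_mult_schwartz \<phi> schwartz_inv_fourier \<psi>)
      \<comment> \<open>By duality all factors act on the test function. By
        \<open>fourier_mult_inv_fourier\<close> the result is \<psi> integrated against translates
        of K, which is what \<open>hy\<close> records.\<close>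
      have "freq_proj (\<phi> k) u j \<psi> = u j (fourier (\<lambda>\<xi>. \<phi> k \<xi> * inv_fourier \<psi> \<xi>))"
        by (simp add: freq_proj_def dist_inv_fourier_def dist_mult_def dist_fourier_def)
      also have "\<dots> = (LINT y|lebesgue. LINT x|lebesgue. h x y)"
        using fu S unfolding represents_def by (simp add: hy)
      also have "\<dots> = (LINT x|lebesgue. LINT y|lebesgue. h x y)" by (rule Fubini_integral[OF hint])
      finally show "freq_proj (\<phi> k) u j \<psi> = (LINT x|lebesgue. g x $ j * \<psi> x)" by (simp add: hx)
    qed
    then have "dist_Lp_norm p W (freq_proj (\<phi> k) u) \<le> Lp_norm p W g"
      unfolding dist_Lp_norm_def by (intro INF_lower) simp
    with gLp show "dist_Lp_norm p W (freq_proj (\<phi> k) u) \<le> ennreal (D * C * \<tau>)" by (rule order_trans[rotated])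
  qed
qed

text \<open>The strict inequality leaves room to choose, for each frequency, a function with norm
  slightly above the infimum and still to keep the sum of the norms within \<tau>.\<close>

lemma M_1_represented:
  fixes \<phi> :: "int^'n \<Rightarrow> real^'n \<Rightarrow> complex"
  assumes \<phi>: "\<phi> \<in> Y_family" and u: "u \<in> temp_dists" and M: "M_1_norm \<phi> p W u < ennreal \<tau>"
  shows "\<exists>f. represents f u \<and> Lp_norm p W f \<le> ennreal \<tau>"
proof -
  let ?N = "CARD('n) + 2"
  from ex_bij_nat_int_vec[where 'n='n] obtain e :: "nat \<Rightarrow> int^'n" where e: "bij e" by blast
  define d where "d j = dist_Lp_norm p W (freq_proj (\<phi> (e j)) u)" for j
  have sum_d: "(\<Sum>j. d j) < ennreal \<tau>"
    using M unfolding M_1_norm_def infsum_ennreal_eq_suminf[OF e] d_def .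
  have tau: "0 < \<tau>" using sum_d by (metis ennreal_eq_0_iff not_le not_less_zero zero_le)
  obtain s where s: "(\<Sum>j. d j) = ennreal s" "0 \<le> s" "s < \<tau>"
    using sum_d by (cases "\<Sum>j. d j") (auto simp: ennreal_less_iff)
  have d_fin: "d j < \<top>" for j
  proof -
    have "d j \<le> (\<Sum>j. d j)" using sum_le_suminf[of d "{j}"] by simp
    then show ?thesis using s(1) by (auto intro: le_less_trans)
  qed
  define r where "r j = enn2real (d j)" for j
  have dr: "d j = ennreal (r j)" "0 \<le> r j" for j using d_fin[of j] by (auto simp: r_def less_top)
  have r_sums: "r sums s"
  proof -
    have "(\<Sum>j. ennreal (r j)) = ennreal s" using s(1) by (simp add: dr(1)[symmetric])
    moreover from this have "summable r" using dr(2) by (intro summable_suminf_not_top) auto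
    ultimately have "ennreal (suminf r) = ennreal s" using dr(2) by (simp add: suminf_ennreal2)
    then have "suminf r = s" using dr(2) \<open>summable r\<close> s(2) by (simp add: suminf_nonneg)
    then show ?thesis using \<open>summable r\<close> by (simp add: sums_iff)
  qed
  \<comment> \<open>The slack \<tau> - s is spread geometrically: each \<open>a j\<close> is
    positive and strictly above the infimum \<open>d j\<close>, and their sum is exactly
    \<tau>.\<close>
  define a where "a j = r j + (\<tau> - s) * (1 / 2) ^ Suc j" for j
  have a_pos: "0 < a j" for j unfolding a_def using dr(2)[of j] s(3) by (intro add_nonneg_pos) auto
  have "a sums (s + (\<tau> - s) * 1)" unfolding a_def by (intro sums_add r_sums sums_mult power_half_series)
  then have a_sum: "summable a" "suminf a = \<tau>" by (auto simp: sums_iff)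
  have "\<exists>f. represents f (freq_proj (\<phi> (e j)) u) \<and> Lp_norm p W f < ennreal (a j)" for j
  proof -
    have "d j < ennreal (a j)" unfolding dr(1) using dr(2)[of j] s(3) by (simp add: ennreal_less_iff a_def)
    then show ?thesis unfolding d_def dist_Lp_norm_def INF_less_iff by auto
  qed
  then obtain F where F: "\<And>j. represents (F j) (freq_proj (\<phi> (e j)) u)" "\<And>j. Lp_norm p W (F j) < ennreal (a j)" by metis
  have Fm [measurable]: "F j \<in> borel_measurable lebesgue" for j using F(1) by (simp add: represents_def)
  have Fmod: "Lp_modular p W (F j) \<le> ennreal (a j powr p)" for j
    using F(2)[of j] a_pos[of j] by (subst Lp_norm_le_iff[OF p, symmetric]) auto
  from weighted_L1_bound obtain B where B: "B \<ge> 0" "\<And>f \<tau>. f \<in> borel_measurable lebesgue \<Longrightarrow> 0 \<le> \<tau> \<Longrightarrow>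
    Lp_modular p W f \<le> ennreal (\<tau> powr p) \<Longrightarrow> (\<integral>\<^sup>+y. ennreal (1 / (1 + norm y) ^ ?N * norm (f y)) \<partial>lebesgue) \<le> ennreal (B * \<tau>)" by blast
  have [measurable]: "(\<lambda>y::real^'n. 1 / (1 + norm y) ^ ?N) \<in> borel_measurable lebesgue"
    by (rule borel_imp_lebesgue_measurable) measurable
  \<comment> \<open>The weighted L^1 norms of the pieces have a finite sum, so the weighted series
    converges absolutely at almost every x; the weight is positive and can be divided out.\<close>
  have summ: "AE x in lebesgue. summable (\<lambda>j. norm (F j x))"
  proof -
    have "(\<integral>\<^sup>+x. (\<Sum>j. ennreal (1 / (1 + norm x) ^ ?N * norm (F j x))) \<partial>lebesgue) =
        (\<Sum>j. \<integral>\<^sup>+x. ennreal (1 / (1 + norm x) ^ ?N * norm (F j x)) \<partial>lebesgue)" by (rule nn_integral_suminf) measurable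
    also have "\<dots> \<le> (\<Sum>j. ennreal (B * a j))"
      using a_pos by (intro suminf_le B(2) Fmod Fm) (auto simp: less_imp_le)
    also have "\<dots> = ennreal (\<Sum>j. B * a j)"
      using a_pos B(1) a_sum by (intro suminf_ennreal2) (auto simp: less_imp_le intro!: summable_mult)
    finally have "(\<integral>\<^sup>+x. (\<Sum>j. ennreal (1 / (1 + norm x) ^ ?N * norm (F j x))) \<partial>lebesgue) \<noteq> \<infinity>"
      by (auto simp: top_unique)
    then have "AE x in lebesgue. (\<Sum>j. ennreal (1 / (1 + norm x) ^ ?N * norm (F j x))) \<noteq> \<infinity>"
      by (intro nn_integral_noteq_infinite) measurable
    then show ?thesis
    proof eventually_elim
      fix x assume "(\<Sum>j. ennreal (1 / (1 + norm x) ^ ?N * norm (F j x))) \<noteq> \<infinity>"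
      then have "summable (\<lambda>j. 1 / (1 + norm x) ^ ?N * norm (F j x))" by (intro summable_suminf_not_top) auto
      moreover have "1 / (1 + norm x) ^ ?N \<noteq> 0" by (simp add: add_nonneg_eq_0_iff)
      ultimately show "summable (\<lambda>j. norm (F j x))" by (simp only: summable_cmult_iff) simp
    qed
  qed
  \<comment> \<open>On the null set where the series diverges, the value of \<open>suminf\<close> is
    a default; everything about f is therefore derived almost everywhere.\<close>
  define f where "f x = (\<Sum>j. F j x)" for x
  have fm [measurable]: "f \<in> borel_measurable lebesgue" unfolding f_def by measurable
  have "Lp_modular p W f \<le> (\<integral>\<^sup>+x. enn_powr (\<Sum>j. ennreal (weight_norm p W x (F j x))) p \<partial>lebesgue)"
    unfolding Lp_modular_def
  proof (rule nn_integral_mono_AE, use summ in eventually_elim)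
    fix x assume sm: "summable (\<lambda>j. norm (F j x))"
    let ?V = "mat_powr (W x) (1 / p)"
    have sF: "summable (\<lambda>j. F j x)" using sm by (rule summable_norm_cancel)
    have smV: "summable (\<lambda>j. norm (?V *v F j x))"
    proof (rule summable_comparison_test'[OF summable_mult[OF sm, of "op_norm ?V"]])
      show "norm (norm (?V *v F j x)) \<le> op_norm ?V * norm (F j x)" if "0 \<le> j" for j using norm_matrix_vector_le by simp
    qed
    have "?V *v f x = (\<Sum>j. ?V *v F j x)" unfolding f_def by (rule bounded_linear.suminf[OF matrix_vector_mul_bounded_linear sF])
    then have "weight_norm p W x (f x) \<le> (\<Sum>j. norm (?V *v F j x))"
      unfolding weight_norm_def using summable_norm[OF smV] by simp
    then have "ennreal (weight_norm p W x (f x)) \<le> ennreal (\<Sum>j. norm (?V *v F j x))" by (rule ennreal_leI)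
    also have "\<dots> = (\<Sum>j. ennreal (weight_norm p W x (F j x)))"
      unfolding weight_norm_def by (rule suminf_ennreal2[symmetric]) (auto intro: smV)
    finally show "ennreal (weight_norm p W x (f x) powr p) \<le> enn_powr (\<Sum>j. ennreal (weight_norm p W x (F j x))) p"
      using enn_powr_mono[OF _ p_pos] by (metis enn_powr_ennreal weight_norm_nonneg)
  qed
  also have "\<dots> \<le> ennreal (suminf a powr p)"
  proof (rule nn_integral_Minkowski_suminf[OF p a_pos a_sum(1)])
    fix j
    show "(\<lambda>x. ennreal (weight_norm p W x (F j x))) \<in> borel_measurable lebesgue" by measurable
    show "(\<integral>\<^sup>+x. enn_powr (ennreal (weight_norm p W x (F j x))) p \<partial>lebesgue) \<le> ennreal (a j powr p)"
      using Fmod[of j] by (simp add: enn_powr_ennreal Lp_modular_def)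
  qed
  finally have "Lp_norm p W f \<le> ennreal \<tau>" using tau by (subst Lp_norm_le_iff[OF p]) (auto simp: a_sum(2))
  moreover have "represents f u"
    unfolding represents_def
  proof (intro conjI fm allI ballI)
    fix j and \<psi> :: "real^'n \<Rightarrow> complex" assume \<psi>: "\<psi> \<in> schwartz"
    note [measurable] = borel_imp_lebesgue_measurable[OF schwartz_borel_measurable[OF \<psi>]]
    from schwartz_pairing_bound obtain C where C: "C \<ge> 0" "\<And>f \<tau> j \<psi>. \<psi> \<in> schwartz \<Longrightarrow> f \<in> borel_measurable lebesgue \<Longrightarrow> 0 \<le> \<tau> \<Longrightarrow>
      Lp_modular p W f \<le> ennreal (\<tau> powr p) \<Longrightarrow> integrable lebesgue (\<lambda>x. f x $ j * \<psi> x) \<and>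
      (LINT x|lebesgue. norm (f x $ j * \<psi> x)) \<le> C * \<tau> * schwartz_norm ?N \<psi>" by blast
    note CF = C(2)[OF \<psi> Fm less_imp_le[OF a_pos] Fmod]
    \<comment> \<open>The test function seen by u when the i-th piece is tested against \<psi>. The
      limit of the partial sums of \<open>u j (H i)\<close> is then computed twice: by termwise
      integration, and by continuity of u.\<close>
    define H where "H i = fourier (\<lambda>\<xi>. \<phi> (e i) \<xi> * inv_fourier \<psi> \<xi>)" for i
    have H: "H i \<in> schwartz" for i
      unfolding H_def by (intro schwartz_fourier Y_family_mult_schwartz \<phi> schwartz_inv_fourier \<psi>)
    have uj: "tempered (u j)" using u by (simp add: temp_dists_def)
    have FH: "(LINT x|lebesgue. F i x $ j * \<psi> x) = u j (H i)" for i
      using F(1)[of i] \<psi> by (simp add: represents_def freq_proj_def dist_inv_fourier_def dist_mult_def dist_fourier_def H_def)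
    have int: "integrable lebesgue (\<lambda>x. F i x $ j * \<psi> x)" for i using CF by blast
    have AEs: "AE x in lebesgue. summable (\<lambda>i. norm (F i x $ j * \<psi> x))"
      using summ
    proof eventually_elim
      fix x assume "summable (\<lambda>i. norm (F i x))"
      then have "summable (\<lambda>i. norm (F i x) * norm (\<psi> x))" by (rule summable_mult2)
      then show "summable (\<lambda>i. norm (F i x $ j * \<psi> x))"
        by (rule summable_comparison_test'[where N = 0])
          (simp add: norm_mult mult_right_mono Finite_Cartesian_Product.norm_nth_le)
    qed
    have sumI: "summable (\<lambda>i. LINT x|lebesgue. norm (F i x $ j * \<psi> x))"
    proof (rule summable_comparison_test'[where N = 0])
      show "summable (\<lambda>i. C * schwartz_norm ?N \<psi> * a i)" by (intro summable_mult a_sum)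
      show "norm (LINT x|lebesgue. norm (F i x $ j * \<psi> x)) \<le> C * schwartz_norm ?N \<psi> * a i" if "0 \<le> i" for i
        using CF[of i j] by (simp add: mult_ac)
    qed
    have eq: "AE x in lebesgue. (\<Sum>i. F i x $ j * \<psi> x) = f x $ j * \<psi> x"
      using summ
    proof eventually_elim
      fix x assume "summable (\<lambda>i. norm (F i x))"
      then have "summable (\<lambda>i. F i x)" by (rule summable_norm_cancel)
      from bounded_linear.sums[OF bounded_linear_vec_nth summable_sums[OF this]]
      have "(\<lambda>i. F i x $ j) sums (f x $ j)" by (simp add: f_def)
      then have "(\<lambda>i. F i x $ j * \<psi> x) sums (f x $ j * \<psi> x)" by (rule sums_mult2)
      then show "(\<Sum>i. F i x $ j * \<psi> x) = f x $ j * \<psi> x" by (simp add: sums_iff)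
    qed
    have Im: "(\<lambda>x. \<Sum>i. F i x $ j * \<psi> x) \<in> borel_measurable lebesgue"
      by (rule borel_measurable_integrable[OF integrable_suminf[OF int AEs sumI]])
    have fm': "(\<lambda>x. f x $ j * \<psi> x) \<in> borel_measurable lebesgue" by measurable
    show "integrable lebesgue (\<lambda>x. f x $ j * \<psi> x)"
      using integrable_suminf[OF int AEs sumI] integrable_cong_AE[OF Im fm' eq] by blast
    have L1: "(\<lambda>J. \<Sum>i<J. u j (H i)) \<longlonglongrightarrow> (LINT x|lebesgue. f x $ j * \<psi> x)"
      using sums_integral[OF int AEs sumI] unfolding sums_def FH integral_cong_AE[OF Im fm' eq] .
    from tempered_bound[OF uj] obtain A N where A: "0 \<le> A" "\<And>f. f \<in> schwartz \<Longrightarrow> norm (u j f) \<le> A * schwartz_norm N f" by blast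
    have dS: "(\<lambda>x. \<psi> x + (-1) * (\<Sum>i<J. H i x)) \<in> schwartz" for J
      by (intro schwartz_add schwartz_cmult schwartz_sum \<psi> H)
    have ud: "u j (\<lambda>x. \<psi> x + (-1) * (\<Sum>i<J. H i x)) = u j \<psi> - (\<Sum>i<J. u j (H i))" for J
    proof -
      have "u j (\<lambda>x. \<psi> x + (-1) * (\<Sum>i<J. H i x)) = u j \<psi> + u j (\<lambda>x. (-1) * (\<Sum>i<J. H i x))"
        by (intro tempered_add[OF uj] schwartz_cmult schwartz_sum \<psi> H)
      also have "u j (\<lambda>x. (-1) * (\<Sum>i<J. H i x)) = (-1) * u j (\<lambda>x. \<Sum>i<J. H i x)"
        by (intro tempered_cmult[OF uj] schwartz_sum H)
      also have "u j (\<lambda>x. \<Sum>i<J. H i x) = (\<Sum>i<J. u j (H i))" by (rule tempered_sum[OF uj H])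
      finally show ?thesis by simp
    qed
    \<comment> \<open>By linearity this is u applied to \<psi> minus the partial sum of the
      \<open>H i\<close>. Temperedness bounds it by one Schwartz norm, which tends to 0 by
      \<open>Y_family_decomposition\<close>.\<close>
    have "(\<lambda>J. u j \<psi> - (\<Sum>i<J. u j (H i))) \<longlonglongrightarrow> 0"
    proof (rule Lim_null_comparison)
      show "\<forall>\<^sub>F J in sequentially. norm (u j \<psi> - (\<Sum>i<J. u j (H i))) \<le> A * schwartz_norm N (\<lambda>x. \<psi> x + (-1) * (\<Sum>i<J. H i x))"
        unfolding ud[symmetric] using A(2)[OF dS] by (intro always_eventually allI)
      show "(\<lambda>J. A * schwartz_norm N (\<lambda>x. \<psi> x + (-1) * (\<Sum>i<J. H i x))) \<longlonglongrightarrow> 0"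
        unfolding H_def by (rule tendsto_mult_right_zero[OF Y_family_decomposition[OF \<phi> e \<psi>]])
    qed
    from tendsto_diff[OF tendsto_const[of "u j \<psi>"] this] have "(\<lambda>J. \<Sum>i<J. u j (H i)) \<longlonglongrightarrow> u j \<psi>" by simp
    from LIMSEQ_unique[OF this L1] show "u j \<psi> = (LINT x|lebesgue. f x $ j * \<psi> x)" .
  qed
  ultimately show ?thesis by blast
qed

end

text \<open>\<open>dist_Lp\<close> consists of distributions by construction. The middle conjunct
  records that no function of L^p(W) is lost in passing to it, so that the second inclusion indeed
  speaks of the whole space.\<close>

theorem lemma5p2:
  fixes p :: real
    and W :: "real^'n \<Rightarrow> complex^'m^'m"
    and \<phi> :: "int^'n \<Rightarrow> real^'n \<Rightarrow> complex"
  assumes "1 \<le> p"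
    and "matrix_weight W"
    and "in_Ap p W"
    and "\<phi> \<in> Y_family"
  shows "cont_incl (M_1 \<phi> p W) (M_1_norm \<phi> p W) (dist_Lp p W) (dist_Lp_norm p W) \<and>
    (\<forall>f\<in>Lp p W. \<exists>u\<in>temp_dists. represents f u) \<and>
    cont_incl (dist_Lp p W) (dist_Lp_norm p W) (M_inf \<phi> p W) (M_inf_norm \<phi> p W)"
proof -
  interpret Ap_weight p W by unfold_locales (fact assms)+
  note \<phi> = assms(4)
  have diff: "(\<lambda>j \<psi>. v j \<psi> - u j \<psi>) \<in> temp_dists" if "u \<in> temp_dists" "v \<in> temp_dists" for u v :: "'m \<Rightarrow> 'n functional"
    using that unfolding temp_dists_def by (auto intro: tempered_diff)
  from kernel_operator_bound[OF \<phi>] obtain C where C: "C > 0"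
    "\<And>f u \<tau> k. represents f u \<Longrightarrow> 0 < \<tau> \<Longrightarrow> Lp_norm p W f \<le> ennreal \<tau> \<Longrightarrow>
      dist_Lp_norm p W (freq_proj (\<phi> k) u) \<le> ennreal (C * \<tau>)" by blast
  \<comment> \<open>The norm on the left of the implication is an infimum, so a strict bound hands
    over a representing function; the operator bound for it is uniform in k and passes to the
    supremum.\<close>
  have M_inf_le: "M_inf_norm \<phi> p W u \<le> ennreal (C * \<tau>)" if "dist_Lp_norm p W u < ennreal \<tau>" for u \<tau>
  proof -
    from that have \<tau>: "0 < \<tau>" by (metis ennreal_eq_0_iff not_le not_less_zero zero_le)
    from that obtain f where "represents f u" "Lp_norm p W f < ennreal \<tau>"
      unfolding dist_Lp_norm_def INF_less_iff by auto
    then show ?thesis unfolding M_inf_norm_def using \<tau> by (intro SUP_least C(2)) auto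
  qed
  have "cont_incl (M_1 \<phi> p W) (M_1_norm \<phi> p W) (dist_Lp p W) (dist_Lp_norm p W)"
    unfolding cont_incl_def
  proof (intro conjI subsetI ballI allI impI)
    fix u assume "u \<in> M_1 \<phi> p W"
    then have u: "u \<in> temp_dists" "M_1_norm \<phi> p W u < \<top>" by (auto simp: M_1_def)
    then obtain t where "M_1_norm \<phi> p W u = ennreal t" "0 \<le> t" by (cases "M_1_norm \<phi> p W u") auto
    then have "M_1_norm \<phi> p W u < ennreal (t + 1)" by (simp add: ennreal_less_iff del: ennreal_plus)
    from M_1_represented[OF \<phi> u(1) this] obtain f where f: "represents f u" "Lp_norm p W f \<le> ennreal (t + 1)" by blast
    then have "f \<in> Lp p W" unfolding Lp_def represents_def by (auto intro: le_less_trans)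
    then show "u \<in> dist_Lp p W" using u(1) f(1) unfolding dist_Lp_def by blast
  next
    fix u and \<epsilon> :: real assume u: "u \<in> M_1 \<phi> p W" and \<epsilon>: "0 < \<epsilon>"
    show "\<exists>\<delta>>0. \<forall>v\<in>M_1 \<phi> p W. M_1_norm \<phi> p W (\<lambda>j \<psi>. v j \<psi> - u j \<psi>) < ennreal \<delta> \<longrightarrow>
        dist_Lp_norm p W (\<lambda>j \<psi>. v j \<psi> - u j \<psi>) < ennreal \<epsilon>"
    \<comment> \<open>The function obtained for the difference satisfies only a non-strict bound;
      halving restores the strict one.\<close>
    proof (intro exI[of _ "\<epsilon> / 2"] conjI ballI impI)
      fix v assume v: "v \<in> M_1 \<phi> p W" and le: "M_1_norm \<phi> p W (\<lambda>j \<psi>. v j \<psi> - u j \<psi>) < ennreal (\<epsilon> / 2)"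
      have "(\<lambda>j \<psi>. v j \<psi> - u j \<psi>) \<in> temp_dists" using u v by (intro diff) (auto simp: M_1_def)
      from M_1_represented[OF \<phi> this le] obtain f where
        f: "represents f (\<lambda>j \<psi>. v j \<psi> - u j \<psi>)" "Lp_norm p W f \<le> ennreal (\<epsilon> / 2)" by blast
      have "dist_Lp_norm p W (\<lambda>j \<psi>. v j \<psi> - u j \<psi>) \<le> Lp_norm p W f"
        unfolding dist_Lp_norm_def using f(1) by (intro INF_lower) simp
      also have "\<dots> \<le> ennreal (\<epsilon> / 2)" by (rule f(2))
      also have "\<dots> < ennreal \<epsilon>" using \<epsilon> by (simp add: ennreal_less_iff)
      finally show "dist_Lp_norm p W (\<lambda>j \<psi>. v j \<psi> - u j \<psi>) < ennreal \<epsilon>" .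
    qed (use \<epsilon> in simp)
  qed
  moreover have "cont_incl (dist_Lp p W) (dist_Lp_norm p W) (M_inf \<phi> p W) (M_inf_norm \<phi> p W)"
    unfolding cont_incl_def
  proof (intro conjI subsetI ballI allI impI)
    fix u assume "u \<in> dist_Lp p W"
    then obtain f where u: "u \<in> temp_dists" and f: "f \<in> Lp p W" "represents f u" by (auto simp: dist_Lp_def)
    have "dist_Lp_norm p W u \<le> Lp_norm p W f"
      unfolding dist_Lp_norm_def using f(2) by (intro INF_lower) simp
    also have "\<dots> < \<top>" using f(1) by (simp add: Lp_def)
    finally obtain t where "dist_Lp_norm p W u = ennreal t" "0 \<le> t" by (cases "dist_Lp_norm p W u") auto
    then have "dist_Lp_norm p W u < ennreal (t + 1)" by (simp add: ennreal_less_iff del: ennreal_plus)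
    from M_inf_le[OF this] have "M_inf_norm \<phi> p W u < \<top>" by (auto intro: le_less_trans)
    then show "u \<in> M_inf \<phi> p W" using u by (simp add: M_inf_def)
  next
    fix u and \<epsilon> :: real assume \<epsilon>: "0 < \<epsilon>"
    show "\<exists>\<delta>>0. \<forall>v\<in>dist_Lp p W. dist_Lp_norm p W (\<lambda>j \<psi>. v j \<psi> - u j \<psi>) < ennreal \<delta> \<longrightarrow>
        M_inf_norm \<phi> p W (\<lambda>j \<psi>. v j \<psi> - u j \<psi>) < ennreal \<epsilon>"
    \<comment> \<open>C compensates the operator bound, and the factor 2 again turns a non-strict
      bound into a strict one.\<close>
    proof (intro exI[of _ "\<epsilon> / (2 * C)"] conjI ballI impI)
      fix v assume "dist_Lp_norm p W (\<lambda>j \<psi>. v j \<psi> - u j \<psi>) < ennreal (\<epsilon> / (2 * C))"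
      from M_inf_le[OF this] have "M_inf_norm \<phi> p W (\<lambda>j \<psi>. v j \<psi> - u j \<psi>) \<le> ennreal (\<epsilon> / 2)" using C(1) by simp
      also have "\<dots> < ennreal \<epsilon>" using \<epsilon> by (simp add: ennreal_less_iff)
      finally show "M_inf_norm \<phi> p W (\<lambda>j \<psi>. v j \<psi> - u j \<psi>) < ennreal \<epsilon>" .
    qed (use \<epsilon> C(1) in simp)
  qed
  ultimately show ?thesis using Lp_represents by blast
qed

end
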